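(* On the eyebolted Vicsek cross $K$, there are two kinds of (non-primal) local regular Dirichlet forms that can be constructed: there exists one that satisfies the energy self-similar identity, and there exists another one that is obtained from a reverse recursive construction and does not satisfy the energy self-similar identity.
   Context: **Eyebolted Vicsek cross.** In $\mathbb R^2$ let $p_1=(-\frac12,-\frac12)$, $p_2=(\frac12,-\frac12)$, $p_3=(\frac12,\frac12)$, $p_4=(-\frac12,\frac12)$, and let $S$ be the unit square with these vertices, divided into $81$ sub-squares of side $1/9$; the sub-square with index $(i,j)$, $-4\le i,j\le 4$, has center $(i/9,j/9)$. Select the following $21$ sub-squares: the nine $(k,k)$, $|k|\le 4$ (along $\overline{p_1p_3}$); the eight $(k,-k)$, $1\le |k|\le 4$ (along $\overline{p_2p_4}$); and two "eyebolts", the lower-right one consisting of the pair $(3,-1),(4,-2)$ or the pair $(1,-3),(2,-4)$, and the upper-left one consisting of the pair $(-3,1),(-4,2)$ or the pair $(-1,3),(-2,4)$ (a fixed choice is made for each eyebolt; the assertions do not depend on it). Let $a_1,\dots,a_{21}$ be the centers of the selected sub-squares, $F_i(x)=\frac19x+a_i$, and let $K$ be the nonempty compact set with $K=\bigcup_{i=1}^{21}F_i(K)$. Put $V_0=\{p_1,p_2,p_3,p_4\}$, $V_n=\bigcup_{i}F_i(V_{n-1})$; for a word $\omega=\omega_1\cdots\omega_n$, $|\omega|=n$, $F_\omega=F_{\omega_1}\circ\cdots\circ F_{\omega_n}$, $V_\omega=F_\omega(V_0)$. **Dirichlet forms.** A Dirichlet form on $L^2(K,\nu)$ ($\nu$ a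 Radon measure with support $K$) is a closed, non-negative definite, densely defined symmetric bilinear form $\mathcal E$ with domain $\mathcal F$ having the Markov property; write $\mathcal E[u]=\mathcal E(u,u)$. It is regular if $\mathcal F\cap C(K)$ is dense in $C(K)$ (sup norm) and in $\mathcal F$ (norm $(\mathcal E[u]+\|u\|_2^2)^{1/2}$), and local if $\mathcal E(u,v)=0$ whenever $u,v\in\mathcal F$ have disjoint compact supports. A Dirichlet form "on $K$" means one on $L^2(K,\nu)$ for some Radon measure $\nu$ of full support. The forms "constructed on $K$" are those obtained as follows. One has energies $\mathcal E_n[u]=\sum_{|\omega|=n}\sum_{\{x,y\}\subset V_\omega}c_\omega(x,y)|u(x)-u(y)|^2$ on $V_n$ ($n\ge0$) with positive conductances $c_\omega(x,y)$, compatible in the sense that $\min\{\mathcal E_n[v]:v:V_n\to\mathbb R,\ v|_{V_{n-1}}=u\}=\mathcal E_{n-1}[u]$ for all $n\ge1$ and $u:V_{n-1}\to\mathbb R$; then $\mathcal E[u]=\lim_n\mathcal E_n[u]$ and $\mathcal F=\{u\in C(K):\mathcal E[u]<\infty\}$. "Non-primal" means that the $\mathcal E_n$ are not all scalar multiples of the primal energies $E_n[u]=\sum_{|\omega|=n}\sum_{\{x,y\}\subset V_\omega}|u(x)-u(y)|^2$. *Energy self-similar identity:* there are $0<\tau_i<1$ with $\mathcal E[u]=\sum_{i=1}^{21}\tau_i^{-1}\mathcal E[u\circ F_i]$ for all $u\in\mathcal F$. *Reverse recursive construction:* the conductances on level $n$ are the same on every $n$-cell, $c_\omega(F_\omega(p),F_\omega(q))=c_n(p,q)$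 for all $|\omega|=n$ and $p\ne q$ in $V_0$; one fixes the data $c_0$ on $V_0$ and finds positive $c_n$, $n\ge1$, making the sequence $(\mathcal E_n)$ compatible, i.e. such that $\min\{\mathcal E_n[v]:v:V_n\to\mathbb R,\ v|_{V_{n-1}}=u\}=\mathcal E_{n-1}[u]$ for all $n\ge1$ and $u:V_{n-1}\to\mathbb R$. *)

theory Defs
  imports "HOL-Analysis.Analysis"
begin

section \<open>The eyebolted Vicsek cross\<close>

type_synonym point = "real \<times> real"
type_synonym index = "int \<times> int"

definition lower_right_eyebolts :: "index set set" where
  "lower_right_eyebolts = {{(3, -1), (4, -2)}, {(1, -3), (2, -4)}}"

definition upper_left_eyebolts :: "index set set" where
  "upper_left_eyebolts = {{(-3, 1), (-4, 2)}, {(-1, 3), (-2, 4)}}"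

definition eyebolted_indices :: "index set \<Rightarrow> index set \<Rightarrow> index set" where
  "eyebolted_indices L U =
     {(k, k) | k. \<bar>k\<bar> \<le> 4} \<union> {(k, -k) | k. 1 \<le> \<bar>k\<bar> \<and> \<bar>k\<bar> \<le> 4} \<union> L \<union> U"

definition contraction :: "index \<Rightarrow> point \<Rightarrow> point" where
  "contraction i x = (1 / 9) *\<^sub>R x + (of_int (fst i) / 9, of_int (snd i) / 9)"

definition attractor :: "index set \<Rightarrow> point set \<Rightarrow> bool" where
  "attractor I K \<longleftrightarrow> K \<noteq> {} \<and> compact K \<and> K = (\<Union>i\<in>I. contraction i ` K)"

definition corners :: "point set" where
  "corners = {(-1/2, -1/2), (1/2, -1/2), (1/2, 1/2), (-1/2, 1/2)}"

fun vertices :: "index set \<Rightarrow> nat \<Rightarrow> point set" where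
  "vertices I 0 = corners"
| "vertices I (Suc n) = (\<Union>i\<in>I. contraction i ` vertices I n)"

fun word_map :: "index list \<Rightarrow> point \<Rightarrow> point" where
  "word_map [] = id"
| "word_map (i # w) = contraction i \<circ> word_map w"

definition words :: "index set \<Rightarrow> nat \<Rightarrow> index list set" where
  "words I n = {w. length w = n \<and> set w \<subseteq> I}"

definition cell_vertices :: "index list \<Rightarrow> point set" where
  "cell_vertices w = word_map w ` corners"


section \<open>Compatible energies and their limits\<close>

type_synonym conductance = "index list \<Rightarrow> point \<Rightarrow> point \<Rightarrow> real"

definition positive_conductance :: "index set \<Rightarrow> conductance \<Rightarrow> bool" where
  "positive_conductance I c \<longleftrightarrow>
     (\<forall>w x y. set w \<subseteq> I \<and> x \<in> cell_vertices w \<and> y \<in> cell_vertices w \<and> x \<noteq> y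
        \<longrightarrow> c w x y > 0 \<and> c w x y = c w y x)"

text \<open>The factor 1/2 turns the sum over ordered pairs into the sum over unordered pairs, the
  conductances being symmetric. Functions on the level-\<open>n\<close> vertices are represented by total
  functions, whose values elsewhere are irrelevant.\<close>

definition energy :: "index set \<Rightarrow> conductance \<Rightarrow> nat \<Rightarrow> (point \<Rightarrow> real) \<Rightarrow> real" where
  "energy I c n u =
     (\<Sum>w\<in>words I n. (1 / 2) *
        (\<Sum>x\<in>cell_vertices w. \<Sum>y\<in>cell_vertices w. c w x y * \<bar>u x - u y\<bar>\<^sup>2))"

definition compatible :: "index set \<Rightarrow> conductance \<Rightarrow> bool" where
  "compatible I c \<longleftrightarrow>
     (\<forall>n u. let A = {energy I c (Suc n) v | v. \<forall>x\<in>vertices I n. v x = u x}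
        in energy I c n u \<in> A \<and> (\<forall>e\<in>A. energy I c n u \<le> e))"

definition primal_energy :: "index set \<Rightarrow> nat \<Rightarrow> (point \<Rightarrow> real) \<Rightarrow> real" where
  "primal_energy I = energy I (\<lambda>w x y. 1)"

definition non_primal :: "index set \<Rightarrow> conductance \<Rightarrow> bool" where
  "non_primal I c \<longleftrightarrow>
     \<not> (\<forall>n. \<exists>k::real. \<forall>u. energy I c n u = k * primal_energy I n u)"

text \<open>For compatible conductances the energies of a fixed function increase with the level, so
  the limit exists in the extended reals.\<close>

definition limit_energy :: "index set \<Rightarrow> conductance \<Rightarrow> (point \<Rightarrow> real) \<Rightarrow> ereal" where
  "limit_energy I c u = lim (\<lambda>n. ereal (energy I c n u))"

definition energy_domain ::
  "index set \<Rightarrow> point set \<Rightarrow> conductance \<Rightarrow> (point \<Rightarrow> real) set" where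
  "energy_domain I K c = {u. continuous_on K u \<and> limit_energy I c u < \<infinity>}"

definition energy_form ::
  "index set \<Rightarrow> conductance \<Rightarrow> (point \<Rightarrow> real) \<Rightarrow> (point \<Rightarrow> real) \<Rightarrow> real" where
  "energy_form I c u v =
     (real_of_ereal (limit_energy I c (\<lambda>x. u x + v x))
      - real_of_ereal (limit_energy I c (\<lambda>x. u x - v x))) / 4"

text \<open>Being an identity in the extended reals, this includes that \<open>u \<circ> contraction i\<close> has
  finite energy whenever \<open>u\<close> has.\<close>

definition self_similar_identity :: "index set \<Rightarrow> point set \<Rightarrow> conductance \<Rightarrow> bool" where
  "self_similar_identity I K c \<longleftrightarrow>
     (\<exists>\<tau> :: index \<Rightarrow> real. (\<forall>i\<in>I. 0 < \<tau> i \<and> \<tau> i < 1) \<and>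
        (\<forall>u\<in>energy_domain I K c.
           limit_energy I c u =
             (\<Sum>i\<in>I. ereal (inverse (\<tau> i)) * limit_energy I c (u \<circ> contraction i))))"

definition reverse_recursive :: "index set \<Rightarrow> conductance \<Rightarrow> bool" where
  "reverse_recursive I c \<longleftrightarrow>
     (\<exists>c' :: nat \<Rightarrow> point \<Rightarrow> point \<Rightarrow> real.
        \<forall>n. \<forall>w\<in>words I n. \<forall>p\<in>corners. \<forall>q\<in>corners. p \<noteq> q
          \<longrightarrow> c w (word_map w p) (word_map w q) = c' n p q)"


section \<open>Dirichlet forms\<close>

text \<open>Elements of \<open>L\<^sup>2(M)\<close> are represented by square-integrable functions. The domain \<open>D\<close> of a
  form is a set of such representatives (not necessarily all representatives of each class); the
  form has to respect equality almost everywhere.\<close>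

definition square_integrable :: "'a measure \<Rightarrow> ('a \<Rightarrow> real) set" where
  "square_integrable M = {u \<in> borel_measurable M. integrable M (\<lambda>x. (u x)\<^sup>2)}"

definition L2_norm :: "'a measure \<Rightarrow> ('a \<Rightarrow> real) \<Rightarrow> real" where
  "L2_norm M u = sqrt (LINT x|M. (u x)\<^sup>2)"

definition form_norm ::
  "'a measure \<Rightarrow> (('a \<Rightarrow> real) \<Rightarrow> ('a \<Rightarrow> real) \<Rightarrow> real) \<Rightarrow> ('a \<Rightarrow> real) \<Rightarrow> real" where
  "form_norm M E u = sqrt (E u u + (L2_norm M u)\<^sup>2)"

locale dirichlet_form =
  fixes M :: "'a measure"
    and E :: "('a \<Rightarrow> real) \<Rightarrow> ('a \<Rightarrow> real) \<Rightarrow> real"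
    and D :: "('a \<Rightarrow> real) set"
  assumes domain_L2: "D \<subseteq> square_integrable M"
    and domain_zero: "(\<lambda>x. 0) \<in> D"
    and domain_lincomb: "\<And>a b u v. u \<in> D \<Longrightarrow> v \<in> D \<Longrightarrow> (\<lambda>x. a * u x + b * v x) \<in> D"
    and respects_AE: "\<And>u v w. u \<in> D \<Longrightarrow> v \<in> D \<Longrightarrow> w \<in> D
          \<Longrightarrow> (AE x in M. u x = v x) \<Longrightarrow> E u w = E v w"
    and symmetric: "\<And>u v. u \<in> D \<Longrightarrow> v \<in> D \<Longrightarrow> E u v = E v u"
    and bilinear: "\<And>a b u v w. u \<in> D \<Longrightarrow> v \<in> D \<Longrightarrow> w \<in> D
          \<Longrightarrow> E (\<lambda>x. a * u x + b * v x) w = a * E u w + b * E v w"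
    and nonnegative: "\<And>u. u \<in> D \<Longrightarrow> E u u \<ge> 0"
    and densely_defined: "\<And>f e. f \<in> square_integrable M \<Longrightarrow> e > 0
          \<Longrightarrow> \<exists>u\<in>D. L2_norm M (\<lambda>x. f x - u x) < e"
    and closed_form: "\<And>f :: nat \<Rightarrow> 'a \<Rightarrow> real. (\<And>n. f n \<in> D)
          \<Longrightarrow> (\<forall>e>0. \<exists>N. \<forall>m\<ge>N. \<forall>n\<ge>N. form_norm M E (\<lambda>x. f m x - f n x) < e)
          \<Longrightarrow> \<exists>u\<in>D. (\<lambda>n. form_norm M E (\<lambda>x. f n x - u x)) \<longlonglongrightarrow> 0"
    and markov: "\<And>u. u \<in> D
          \<Longrightarrow> \<exists>v\<in>D. (AE x in M. v x = min 1 (max 0 (u x))) \<and> E v v \<le> E u u"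

definition regular_form ::
  "'a::topological_space measure \<Rightarrow> (('a \<Rightarrow> real) \<Rightarrow> ('a \<Rightarrow> real) \<Rightarrow> real)
     \<Rightarrow> ('a \<Rightarrow> real) set \<Rightarrow> bool" where
  "regular_form M E D \<longleftrightarrow>
     (\<forall>f e. continuous_on (space M) f \<and> e > 0
        \<longrightarrow> (\<exists>u\<in>D. continuous_on (space M) u \<and> (\<forall>x\<in>space M. \<bar>f x - u x\<bar> < e))) \<and>
     (\<forall>f\<in>D. \<forall>e>0. \<exists>u\<in>D. continuous_on (space M) u \<and> form_norm M E (\<lambda>x. f x - u x) < e)"

text \<open>The support of a class in \<open>L\<^sup>2(M)\<close>, that is, the smallest relatively closed set outside
  of which the function vanishes almost everywhere. For continuous functions and measures of full
  support it is the closure of the set where the function does not vanish.\<close>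

definition AE_support :: "'a::topological_space measure \<Rightarrow> ('a \<Rightarrow> real) \<Rightarrow> 'a set" where
  "AE_support M u =
     {x \<in> space M. \<forall>U. open U \<and> x \<in> U \<longrightarrow> \<not> (AE y in M. y \<in> U \<longrightarrow> u y = 0)}"

definition local_form ::
  "'a::topological_space measure \<Rightarrow> (('a \<Rightarrow> real) \<Rightarrow> ('a \<Rightarrow> real) \<Rightarrow> real)
     \<Rightarrow> ('a \<Rightarrow> real) set \<Rightarrow> bool" where
  "local_form M E D \<longleftrightarrow>
     (\<forall>u\<in>D. \<forall>v\<in>D. compact (AE_support M u) \<and> compact (AE_support M v)
        \<and> AE_support M u \<inter> AE_support M v = {} \<longrightarrow> E u v = 0)"

text \<open>Radon measures on a compact subset \<open>K\<close> of the plane are exactly the finite Borel measures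
  on \<open>K\<close>.\<close>

definition radon_full_support :: "point set \<Rightarrow> point measure \<Rightarrow> bool" where
  "radon_full_support K \<nu> \<longleftrightarrow>
     sets \<nu> = sets (restrict_space borel K) \<and> finite_measure \<nu> \<and>
     (\<forall>U. open U \<and> U \<inter> K \<noteq> {} \<longrightarrow> emeasure \<nu> (U \<inter> K) > 0)"

definition local_regular_dirichlet_form_on ::
  "point set \<Rightarrow> ((point \<Rightarrow> real) \<Rightarrow> (point \<Rightarrow> real) \<Rightarrow> real) \<Rightarrow> (point \<Rightarrow> real) set \<Rightarrow> bool" where
  "local_regular_dirichlet_form_on K E D \<longleftrightarrow>
     (\<exists>\<nu>. radon_full_support K \<nu> \<and> dirichlet_form \<nu> E D \<and> regular_form \<nu> E D \<and> local_form \<nu> E D)"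

end

theory Submission
  imports Defs "HOL-Probability.Probability_Mass_Function"
begin

text \<open>
  Every cell carries a star network: a central node is joined to the corners on the main diagonal
  by wires of resistance \<open>r\<close> and to the two other corners by wires of resistance \<open>s\<close>, the legs of
  the star. Eliminating the node leaves six positive conductances between the corners.
  The stars of the 21 cells of the first level form a tree except for two loops, each of which lies
  inside one arm of the cross. Legs \<open>\<rho>, \<sigma>\<close> on the nine diagonal cells and \<open>\<rho>', \<sigma>'\<close> on the other
  twelve are therefore equivalent to a single star again, with legs
  \<open>r = 9 \<rho>\<close> and \<open>s = \<sigma> + 8 \<sigma>' - \<sigma>'\<^sup>2 / (\<rho>' + \<sigma>')\<close>; the last term is the effect of the eyebolt. Cells
  meet only in corners, so minimising the energy of the next level is a separate problem in each
  cell, and legs that obey these two relations at every word give compatible energies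
  (\<open>one_step_lower\<close>, \<open>one_step_extension\<close>, \<open>compatible_network\<close>).

  The relations have two kinds of solutions. Legs scaled by \<open>1/9\<close> in the diagonal cells and by \<open>4/33\<close>
  in the others solve them with \<open>r = 1\<close>, \<open>s = 2\<close>, and the resulting form is self-similar. For legs
  that are equal on all cells of a level, the next \<open>r\<close> is a ninth of the last one and the next \<open>s\<close>
  is the positive root of a quadratic equation; this is the reverse recursive construction.

  In both cases the legs are at most of order \<open>(1/8)\<^sup>n\<close>. Hence a function of energy \<open>B\<close> oscillates at most by a
  multiple of \<open>sqrt (B / 8\<^sup>n)\<close> on an \<open>n\<close>-cell (\<open>cell_osc_bound\<close>), and everything else follows from
  this. Functions of finite energy on the vertices are uniformly continuous, so the minimisers
  extend to continuous harmonic functions on \<open>K\<close>. The form norm dominates the supremum norm, so the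
  form is closed. Its domain is an algebra that contains the constants and separates points, so it
  is dense in the continuous functions by the theorem of Stone and Weierstrass. The form is local
  because the diameters of the cells tend to zero. As a measure one may take a sum of point masses
  on a countable dense subset of \<open>K\<close>.

  The reverse recursive form is not self-similar because the identity, for functions that
  are constant outside one corner cell, would make the form with all legs moved down by one level
  a multiple of the form itself. The energy of a harmonic function that varies along the main
  diagonal is multiplied by nine when the legs are moved down, that of one that varies along the
  other diagonal by less than nine, again because of the eyebolts.
\<close>

section \<open>Cells and their corners\<close>

definition square :: "point set" where
  "square = {x. \<bar>fst x\<bar> \<le> 1/2 \<and> \<bar>snd x\<bar> \<le> 1/2}"

lemma corners_iff: "x \<in> corners \<longleftrightarrow> \<bar>fst x\<bar> = 1/2 \<and> \<bar>snd x\<bar> = 1/2"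
  by (cases x) (auto simp: corners_def abs_if split: if_splits)

lemma finite_corners [simp]: "finite corners"
  by (simp add: corners_def)

lemma corners_subset_square: "corners \<subseteq> square"
  by (auto simp: corners_iff square_def)

text \<open>An \<open>n\<close>-cell is the square of side \<open>1/9\<^sup>n\<close> centred at \<open>1/9\<^sup>n\<close> times an integer vector, the offset of
  the word. Incidence of cells becomes integer arithmetic.\<close>

fun offset :: "index list \<Rightarrow> index" where
  "offset [] = (0, 0)"
| "offset (i # w) = (fst (offset w) + 9 ^ length w * fst i, snd (offset w) + 9 ^ length w * snd i)"

lemma word_map_offset:
  "fst (word_map w x) = (fst x + of_int (fst (offset w))) / 9 ^ length w"
  "snd (word_map w x) = (snd x + of_int (snd (offset w))) / 9 ^ length w"
  by (induction w) (auto simp: contraction_def field_simps)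

lemma word_map_append: "word_map (v @ w) = word_map v \<circ> word_map w"
  by (induction v) auto

lemma inj_word_map: "inj (word_map w)"
proof (rule injI)
  fix x y assume "word_map w x = word_map w y"
  then have "fst (word_map w x) = fst (word_map w y)" "snd (word_map w x) = snd (word_map w y)"
    by auto
  then show "x = y" by (auto simp: word_map_offset prod_eq_iff)
qed

lemma word_map_eq_iff [simp]: "word_map w x = word_map w y \<longleftrightarrow> x = y"
  using inj_word_map by (metis injD)

lemma contraction_eq_iff [simp]: "contraction i x = contraction i y \<longleftrightarrow> x = y"
  using word_map_eq_iff[of "[i]"] by simp

lemma continuous_contraction: "continuous_on A (contraction i)"
  unfolding contraction_def by (intro continuous_intros)

lemma continuous_word_map: "continuous_on A (word_map w)"
proof (induction w arbitrary: A)
  case (Cons i w)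
  then show ?case
    using continuous_on_compose[OF Cons continuous_contraction] by simp
qed (simp add: id_def)

lemma words_0 [simp]: "words I 0 = {[]}"
  by (auto simp: words_def)

lemma words_Suc: "words I (Suc n) = (\<lambda>(i, w). i # w) ` (I \<times> words I n)"
  by (auto simp: words_def length_Suc_conv image_iff)

lemma finite_words: "finite I \<Longrightarrow> finite (words I n)"
  by (induction n) (auto simp: words_Suc)

lemma sum_words_Suc: "(\<Sum>w\<in>words I (Suc n). f w) = (\<Sum>i\<in>I. \<Sum>w\<in>words I n. f (i # w))"
proof -
  have "inj_on (\<lambda>(i, w). i # w) (I \<times> words I n)" by (auto simp: inj_on_def)
  then show ?thesis
    unfolding words_Suc by (subst sum.reindex) (auto simp: sum.cartesian_product case_prod_unfold)
qed

lemma sum_words_add: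
  "(\<Sum>w\<in>words I (m + n). f w) = (\<Sum>v\<in>words I m. \<Sum>w\<in>words I n. f (v @ w))"
  by (induction m arbitrary: f) (simp_all add: sum_words_Suc)

lemma vertices_add: "vertices I (m + n) = (\<Union>w\<in>words I m. word_map w ` vertices I n)"
proof (induction m)
  case (Suc m)
  have "vertices I (Suc m + n) = (\<Union>i\<in>I. contraction i ` (\<Union>w\<in>words I m. word_map w ` vertices I n))"
    using Suc by simp
  then show ?case
    unfolding words_Suc by (auto simp: image_iff) (metis comp_apply)+
qed simp

lemma vertices_words: "vertices I n = (\<Union>w\<in>words I n. word_map w ` corners)"
  using vertices_add[of I n 0] by simp

locale eyebolted_cross =
  fixes L U :: "index set"
  assumes L: "L \<in> lower_right_eyebolts" and U: "U \<in> upper_left_eyebolts"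
begin

abbreviation I :: "index set" where "I \<equiv> eyebolted_indices L U"

definition diagonal_cells :: "index set" where
  "diagonal_cells = {(0,0), (1,1), (2,2), (3,3), (4,4), (-1,-1), (-2,-2), (-3,-3), (-4,-4)}"

definition lower_right_cells :: "index set" where
  "lower_right_cells = {(1,-1), (2,-2), (3,-3), (4,-4)} \<union> L"

definition upper_left_cells :: "index set" where
  "upper_left_cells = {(-1,1), (-2,2), (-3,3), (-4,4)} \<union> U"

lemma cells_eq: "I = diagonal_cells \<union> lower_right_cells \<union> upper_left_cells"
proof -
  have "{(k, k) | k. \<bar>k\<bar> \<le> 4} = (\<lambda>k. (k, k)) ` {-4..4::int}"
    by (auto simp: abs_le_iff)
  also have "{-4..4::int} = {0,1,2,3,4,-1,-2,-3,-4}"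
  proof -
    have "k \<in> {-4..4} \<longleftrightarrow> k \<in> {0,1,2,3,4,-1,-2,-3,-4}" for k :: int
      unfolding atLeastAtMost_iff insert_iff empty_iff by arith
    then show ?thesis by (rule set_eqI)
  qed
  finally have 1: "{(k, k) | k. \<bar>k\<bar> \<le> 4} = diagonal_cells"
    by (simp add: diagonal_cells_def)
  have "{(k, -k) | k. 1 \<le> \<bar>k\<bar> \<and> \<bar>k\<bar> \<le> 4} = (\<lambda>k. (k, -k)) ` ({1..4} \<union> {-4..-1::int})"
  proof -
    have "1 \<le> \<bar>k\<bar> \<and> \<bar>k\<bar> \<le> 4 \<longleftrightarrow> k \<in> {1..4} \<union> {-4..-1}" for k :: int
      unfolding atLeastAtMost_iff Un_iff by arith
    then show ?thesis by blast
  qed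
  also have "{1..4} \<union> {-4..-1::int} = {1,2,3,4,-1,-2,-3,-4}"
  proof -
    have "k \<in> {1..4} \<union> {-4..-1} \<longleftrightarrow> k \<in> {1,2,3,4,-1,-2,-3,-4}" for k :: int
      unfolding atLeastAtMost_iff insert_iff empty_iff Un_iff by arith
    then show ?thesis by (rule set_eqI)
  qed
  finally have 2: "{(k, -k) | k. 1 \<le> \<bar>k\<bar> \<and> \<bar>k\<bar> \<le> (4::int)} \<union> L \<union> U
      = lower_right_cells \<union> upper_left_cells"
    unfolding lower_right_cells_def upper_left_cells_def by auto
  show ?thesis
    unfolding eyebolted_indices_def 1 Un_assoc using 2 by (simp add: Un_assoc)
qed

lemma L_cases: "L = {(3,-1),(4,-2)} \<or> L = {(1,-3),(2,-4)}"
  using L by (auto simp: lower_right_eyebolts_def)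

lemma U_cases: "U = {(-3,1),(-4,2)} \<or> U = {(-1,3),(-2,4)}"
  using U by (auto simp: upper_left_eyebolts_def)

lemma index_bounds: "i \<in> I \<Longrightarrow> \<bar>fst i\<bar> \<le> 4 \<and> \<bar>snd i\<bar> \<le> 4 \<and> even (fst i + snd i)"
  unfolding cells_eq diagonal_cells_def lower_right_cells_def upper_left_cells_def
  using L_cases U_cases by auto

lemma finite_cells [simp]: "finite I"
  unfolding cells_eq diagonal_cells_def lower_right_cells_def upper_left_cells_def
  using L_cases U_cases by auto

lemma diagonal_cellsD: "i \<in> diagonal_cells \<Longrightarrow> fst i = snd i"
  and lower_right_cellsD: "i \<in> lower_right_cells \<Longrightarrow> fst i > snd i"
  and upper_left_cellsD: "i \<in> upper_left_cells \<Longrightarrow> fst i < snd i"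
  unfolding diagonal_cells_def lower_right_cells_def upper_left_cells_def
  using L_cases U_cases by auto

lemma sum_cells:
  fixes f :: "index \<Rightarrow> real"
  shows "(\<Sum>i\<in>I. f i) = (\<Sum>i\<in>diagonal_cells. f i) + (\<Sum>i\<in>lower_right_cells. f i)
     + (\<Sum>i\<in>upper_left_cells. f i)"
proof -
  have "diagonal_cells \<inter> lower_right_cells = {}"
    "(diagonal_cells \<union> lower_right_cells) \<inter> upper_left_cells = {}"
    by (auto dest!: diagonal_cellsD lower_right_cellsD upper_left_cellsD)
  moreover have "finite diagonal_cells" "finite lower_right_cells" "finite upper_left_cells"
    using finite_cells unfolding cells_eq by simp_all
  ultimately show ?thesis unfolding cells_eq by (simp add: sum.union_disjoint)
qed

text \<open>All selected squares have an even index sum, and so do the offsets, since \<open>9\<close> is odd. Two cells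
  of the same level can therefore never share an edge.\<close>

lemma offset_even: "set w \<subseteq> I \<Longrightarrow> even (fst (offset w) + snd (offset w))"
proof (induction w)
  case (Cons i w)
  then have "even (fst i + snd i)" using index_bounds by auto
  with Cons show ?case by auto
qed simp

lemma offset_bound:
  "set w \<subseteq> I \<Longrightarrow> 2 * \<bar>fst (offset w)\<bar> < 9 ^ length w \<and> 2 * \<bar>snd (offset w)\<bar> < 9 ^ length w"
proof (induction w)
  case (Cons i w)
  have b: "2 * \<bar>x + P * j\<bar> < 9 * P" if "2 * \<bar>x\<bar> < P" "\<bar>j\<bar> \<le> 4" for x P j :: int
  proof -
    have "\<bar>P * j\<bar> \<le> P * 4" using that by (auto simp: abs_mult intro!: mult_mono)
    moreover have "\<bar>x + P * j\<bar> \<le> \<bar>x\<bar> + \<bar>P * j\<bar>" by (rule abs_triangle_ineq)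
    moreover have "Z \<le> X + A \<Longrightarrow> A \<le> P * 4 \<Longrightarrow> 2 * X < P \<Longrightarrow> 2 * Z < 9 * P" for X A Z :: int
      by linarith
    ultimately show ?thesis using that(1) by blast
  qed
  have "\<bar>fst i\<bar> \<le> 4" "\<bar>snd i\<bar> \<le> 4" using Cons.prems index_bounds[of i] by auto
  then show ?case
    using Cons.IH Cons.prems b[of "fst (offset w)" "9 ^ length w" "fst i"]
      b[of "snd (offset w)" "9 ^ length w" "snd i"] by simp
qed simp

text \<open>The coordinates of the indices are balanced digits in base nine.\<close>

lemma offset_inj:
  "set v \<subseteq> I \<Longrightarrow> set w \<subseteq> I \<Longrightarrow> length v = length w \<Longrightarrow> offset v = offset w \<Longrightarrow> v = w"
proof (induction v arbitrary: w)
  case (Cons i v)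
  then obtain j w' where w: "w = j # w'" by (cases w) auto
  let ?P = "9 ^ length v :: int"
  have b: "x = y \<and> m = k"
    if h: "2 * \<bar>x\<bar> < P" "2 * \<bar>y\<bar> < P" "x + P * m = y + P * k" for x y P m k :: int
  proof -
    have e: "P * (k - m) = x - y" using h(3) by (simp add: right_diff_distrib)
    have "m = k"
    proof (rule ccontr)
      assume "m \<noteq> k"
      then have "P * 1 \<le> P * \<bar>k - m\<bar>" using h by (intro mult_left_mono) linarith+
      then have "P \<le> \<bar>x - y\<bar>" unfolding e[symmetric] abs_mult using h by simp
      then show False using h by linarith
    qed
    then show ?thesis using e by simp
  qed
  have len: "length w' = length v" and vw: "set v \<subseteq> I" "set w' \<subseteq> I" using Cons.prems w by auto
  have "fst (offset v) + ?P * fst i = fst (offset w') + ?P * fst j"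
    "snd (offset v) + ?P * snd i = snd (offset w') + ?P * snd j"
    using Cons.prems(4) unfolding w by (simp_all add: len)
  then have "offset v = offset w' \<and> i = j"
    using b offset_bound[OF vw(1)] offset_bound[OF vw(2)] unfolding prod_eq_iff len by blast
  then show ?case using Cons w by auto
qed simp

text \<open>Offsets of cells at distance less than the side length differ by at most one in each coordinate.
  By parity they differ in both coordinates or in none, so the cells touch in a corner.\<close>

lemma close_cells_share_corner:
  assumes w: "w \<in> words I n" "w' \<in> words I n" and x: "x \<in> square" "y \<in> square"
    and d: "\<bar>fst (word_map w x) - fst (word_map w' y)\<bar> < 1 / 9 ^ n"
      "\<bar>snd (word_map w x) - snd (word_map w' y)\<bar> < 1 / 9 ^ n"
  shows "\<exists>p\<in>corners. \<exists>q\<in>corners. word_map w p = word_map w' q"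
proof -
  define d1 d2 where "d1 = fst (offset w) - fst (offset w')" "d2 = snd (offset w) - snd (offset w')"
  have len: "length w = n" "length w' = n" using w by (auto simp: words_def)
  have aux: "\<bar>(a + b) / P - (a' + b') / P\<bar> < 1 / P \<longleftrightarrow> \<bar>a - a' + (b - b')\<bar> < 1" if "P > 0"
    for a a' b b' P :: real
  proof -
    have "(a + b) / P - (a' + b') / P = (a - a' + (b - b')) / P"
      by (simp add: diff_divide_distrib add_divide_distrib)
    then show ?thesis using that by (simp add: abs_divide divide_less_cancel)
  qed
  have "\<bar>fst x - fst y + of_int d1\<bar> < 1" "\<bar>snd x - snd y + of_int d2\<bar> < 1"
    using d unfolding word_map_offset len d1_d2_def by (simp_all add: aux)
  then have "\<bar>real_of_int d1\<bar> < 2" "\<bar>real_of_int d2\<bar> < 2"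
    using x unfolding square_def by auto
  then have "\<bar>d1\<bar> \<le> 1" "\<bar>d2\<bar> \<le> 1" by linarith+
  moreover have "even (d1 + d2)"
    using offset_even w unfolding d1_d2_def words_def by (auto simp: algebra_simps)
  ultimately have dd: "(d1 = 0 \<and> d2 = 0) \<or> (\<bar>d1\<bar> = 1 \<and> \<bar>d2\<bar> = 1)"
    by (auto simp: abs_if split: if_splits) presburger+
  show ?thesis
  proof (cases "d1 = 0 \<and> d2 = 0")
    case True
    then have "word_map w = word_map w'"
      by (auto simp: fun_eq_iff prod_eq_iff word_map_offset len d1_d2_def)
    then show ?thesis by (auto simp: corners_def)
  next
    case False
    with dd have a: "\<bar>d1\<bar> = 1" "\<bar>d2\<bar> = 1" by auto
    let ?p = "(- of_int d1 / 2, - of_int d2 / 2) :: point"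
    let ?q = "(of_int d1 / 2, of_int d2 / 2) :: point"
    have "?p \<in> corners" "?q \<in> corners" using a by (auto simp: corners_iff)
    moreover have "word_map w ?p = word_map w' ?q"
      by (auto simp: prod_eq_iff word_map_offset len d1_d2_def field_simps)
    ultimately show ?thesis by blast
  qed
qed

lemma distinct_cells_meet_in_corners:
  assumes w: "w \<in> words I n" "w' \<in> words I n" "w \<noteq> w'" and x: "x \<in> square" "y \<in> square"
    and eq: "word_map w x = word_map w' y"
  shows "x \<in> corners"
proof -
  define d1 d2 where "d1 = fst (offset w) - fst (offset w')" "d2 = snd (offset w) - snd (offset w')"
  have len: "length w = n" "length w' = n" using w by (auto simp: words_def)
  have e: "fst x - fst y + of_int d1 = 0" "snd x - snd y + of_int d2 = 0"
    using eq by (auto simp: prod_eq_iff word_map_offset len d1_d2_def)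
  then have "\<bar>real_of_int d1\<bar> < 2" "\<bar>real_of_int d2\<bar> < 2"
    using x unfolding square_def by auto
  then have "\<bar>d1\<bar> \<le> 1" "\<bar>d2\<bar> \<le> 1" by linarith+
  moreover have "even (d1 + d2)"
    using offset_even w unfolding d1_d2_def words_def by (auto simp: algebra_simps)
  moreover have "d1 \<noteq> 0 \<or> d2 \<noteq> 0"
    using offset_inj[of w w'] w len unfolding d1_d2_def words_def by (auto simp: prod_eq_iff)
  ultimately have "\<bar>d1\<bar> = 1 \<and> \<bar>d2\<bar> = 1"
    by (auto simp: abs_if split: if_splits) presburger+
  then have "(d1 = 1 \<or> d1 = -1) \<and> (d2 = 1 \<or> d2 = -1)" by auto
  then show ?thesis using e x unfolding corners_iff square_def by auto
qed

lemma contraction_square: "i \<in> I \<Longrightarrow> x \<in> square \<Longrightarrow> contraction i x \<in> square"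
proof -
  assume "i \<in> I" "x \<in> square"
  moreover have "\<bar>a / 9 + of_int k / 9\<bar> \<le> 1/2" if "\<bar>a\<bar> \<le> 1/2" "\<bar>k\<bar> \<le> 4" for a :: real and k :: int
  proof -
    have "\<bar>real_of_int k\<bar> \<le> 4" using that by linarith
    then show ?thesis using that by linarith
  qed
  ultimately show ?thesis using index_bounds[of i] by (auto simp: square_def contraction_def)
qed

lemma vertices_subset_square: "vertices I n \<subseteq> square"
  by (induction n) (use corners_subset_square contraction_square in auto)

lemma corner_cells: "(-4,-4) \<in> I" "(4,-4) \<in> I" "(4,4) \<in> I" "(-4,4) \<in> I" "(0,0) \<in> I" "(3,3) \<in> I"
  unfolding cells_eq diagonal_cells_def lower_right_cells_def upper_left_cells_def by auto

lemma corner_fixed: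
  assumes "p \<in> corners" shows "\<exists>i\<in>I. contraction i p = p"
proof -
  from assms consider "p = (-1/2,-1/2)" | "p = (1/2,-1/2)" | "p = (1/2,1/2)" | "p = (-1/2,1/2)"
    by (auto simp: corners_def)
  then show ?thesis
  proof cases
    case 1 then show ?thesis by (intro bexI[of _ "(-4,-4)"]) (auto simp: contraction_def corner_cells)
  next
    case 2 then show ?thesis by (intro bexI[of _ "(4,-4)"]) (auto simp: contraction_def corner_cells)
  next
    case 3 then show ?thesis by (intro bexI[of _ "(4,4)"]) (auto simp: contraction_def corner_cells)
  next
    case 4 then show ?thesis by (intro bexI[of _ "(-4,4)"]) (auto simp: contraction_def corner_cells)
  qed
qed

text \<open>Each corner of the big square is the fixed point of one of the contractions.\<close>

lemma vertices_Suc_mono: "vertices I n \<subseteq> vertices I (Suc n)"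
proof (induction n)
  case 0 show ?case using corner_fixed by (auto simp: image_iff) metis
next
  case (Suc n)
  have "(\<Union>i\<in>I. contraction i ` vertices I n) \<subseteq> (\<Union>i\<in>I. contraction i ` vertices I (Suc n))"
    by (rule UN_mono[OF order_refl image_mono[OF Suc]])
  then show ?case by (simp only: vertices.simps(2))
qed

lemma vertices_mono: "m \<le> n \<Longrightarrow> vertices I m \<subseteq> vertices I n"
  using vertices_Suc_mono by (rule lift_Suc_mono_le)

end

section \<open>Star networks\<close>

definition star_energy :: "real \<Rightarrow> real \<Rightarrow> real \<Rightarrow> real \<Rightarrow> real \<Rightarrow> real \<Rightarrow> real" where
  "star_energy r s u1 u2 u3 u4 =
     (s / r * (u1 - u3)\<^sup>2 + r / s * (u2 - u4)\<^sup>2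
      + (u1 - u2)\<^sup>2 + (u2 - u3)\<^sup>2 + (u3 - u4)\<^sup>2 + (u4 - u1)\<^sup>2) / (2 * (r + s))"

text \<open>The star with the potential \<open>m\<close> at its central node has the energy on the left-hand side. It is
  minimal at the weighted mean of the corner values, and the minimum is \<open>star_energy\<close>. All
  estimates below use \<open>star_energy\<close> through this variational description.\<close>

lemma star_energy_completion:
  assumes "r > 0" "s > 0"
  shows "((u1 - m)\<^sup>2 + (u3 - m)\<^sup>2) / r + ((u2 - m)\<^sup>2 + (u4 - m)\<^sup>2) / s
    = star_energy r s u1 u2 u3 u4
      + 2 * (r + s) / (r * s) * (m - (s * (u1 + u3) + r * (u2 + u4)) / (2 * (r + s)))\<^sup>2"
proof -
  have "r + s \<noteq> 0" using assms by simp
  then show ?thesis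
    using assms unfolding star_energy_def
    by (simp add: divide_simps power2_eq_square) (simp add: algebra_simps)
qed

lemma star_energy_le:
  assumes "r > 0" "s > 0"
  shows "star_energy r s u1 u2 u3 u4
    \<le> ((u1 - m)\<^sup>2 + (u3 - m)\<^sup>2) / r + ((u2 - m)\<^sup>2 + (u4 - m)\<^sup>2) / s"
  unfolding star_energy_completion[OF assms] using assms by simp

lemma star_energy_center:
  assumes "r > 0" "s > 0"
  obtains m where "star_energy r s u1 u2 u3 u4
    = ((u1 - m)\<^sup>2 + (u3 - m)\<^sup>2) / r + ((u2 - m)\<^sup>2 + (u4 - m)\<^sup>2) / s"
  using star_energy_completion[OF assms, of u1 "(s * (u1 + u3) + r * (u2 + u4)) / (2 * (r + s))"]
  by (metis cancel_comm_monoid_add_class.diff_cancel mult_zero_right power_zero_numeral add.right_neutral)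

lemma star_energy_nonneg: "r > 0 \<Longrightarrow> s > 0 \<Longrightarrow> star_energy r s u1 u2 u3 u4 \<ge> 0"
  unfolding star_energy_def by simp

lemma star_energy_reflect: "star_energy r s u3 u2 u1 u4 = star_energy r s u1 u2 u3 u4"
  "star_energy r s u1 u4 u3 u2 = star_energy r s u1 u2 u3 u4"
  unfolding star_energy_def by (simp_all add: power2_commute add_ac)

text \<open>The energy of two resistors in series is at least that of their sum, by the Cauchy-Schwarz
  inequality.\<close>

lemma series_law:
  fixes r s x y :: real
  assumes "r > 0" "s > 0"
  shows "(x + y)\<^sup>2 / (r + s) \<le> x\<^sup>2 / r + y\<^sup>2 / s"
proof -
  have "r + s > 0" using assms by simp
  then have "x\<^sup>2 / r + y\<^sup>2 / s - (x + y)\<^sup>2 / (r + s) = (s * x - r * y)\<^sup>2 / (r * s * (r + s))"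
    using assms by (simp add: divide_simps power2_eq_square) (simp add: algebra_simps)
  also have "\<dots> \<ge> 0" using assms by simp
  finally show ?thesis by simp
qed

lemma series_law_diff:
  fixes r s x y z :: real
  assumes "r > 0" "s > 0"
  shows "(x - z)\<^sup>2 / (r + s) \<le> (x - y)\<^sup>2 / r + (y - z)\<^sup>2 / s"
  using series_law[OF assms, of "x - y" "y - z"] by simp

text \<open>Cutting off two of the legs lowers the energy and leaves two resistors in series.\<close>

lemma star_energy_two_terminal:
  assumes "r > 0" "s > 0"
  shows "(u1 - u3)\<^sup>2 / (2 * r) \<le> star_energy r s u1 u2 u3 u4"
    and "(u2 - u4)\<^sup>2 / (2 * s) \<le> star_energy r s u1 u2 u3 u4"
    and "(u1 - u2)\<^sup>2 / (r + s) \<le> star_energy r s u1 u2 u3 u4"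
    and "(u1 - u4)\<^sup>2 / (r + s) \<le> star_energy r s u1 u2 u3 u4"
    and "(u3 - u2)\<^sup>2 / (r + s) \<le> star_energy r s u1 u2 u3 u4"
    and "(u3 - u4)\<^sup>2 / (r + s) \<le> star_energy r s u1 u2 u3 u4"
proof -
  obtain m where m: "star_energy r s u1 u2 u3 u4
    = ((u1 - m)\<^sup>2 + (u3 - m)\<^sup>2) / r + ((u2 - m)\<^sup>2 + (u4 - m)\<^sup>2) / s"
    using star_energy_center[OF assms] by blast
  have nn: "(u1 - m)\<^sup>2 / r \<ge> 0" "(u3 - m)\<^sup>2 / r \<ge> 0" "(u2 - m)\<^sup>2 / s \<ge> 0" "(u4 - m)\<^sup>2 / s \<ge> 0"
    using assms by auto
  note sl = series_law_diff[of _ _ _ _ m]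
  show "(u1 - u3)\<^sup>2 / (2 * r) \<le> star_energy r s u1 u2 u3 u4"
    "(u2 - u4)\<^sup>2 / (2 * s) \<le> star_energy r s u1 u2 u3 u4"
    "(u1 - u2)\<^sup>2 / (r + s) \<le> star_energy r s u1 u2 u3 u4"
    "(u1 - u4)\<^sup>2 / (r + s) \<le> star_energy r s u1 u2 u3 u4"
    "(u3 - u2)\<^sup>2 / (r + s) \<le> star_energy r s u1 u2 u3 u4"
    "(u3 - u4)\<^sup>2 / (r + s) \<le> star_energy r s u1 u2 u3 u4"
    using sl[of r r u1 u3] sl[of s s u2 u4] sl[of r s u1 u2] sl[of r s u1 u4] sl[of r s u3 u2] sl[of r s u3 u4] nn assms
    unfolding m add_divide_distrib mult_2 power2_commute[of m] by linarith+
qed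

lemma star_energy_osc:
  assumes "r > 0" "s > 0" and "x \<in> {u1,u2,u3,u4}" "y \<in> {u1,u2,u3,u4}"
  shows "(x - y)\<^sup>2 \<le> 2 * (r + s) * star_energy r s u1 u2 u3 u4"
proof -
  let ?Q = "star_energy r s u1 u2 u3 u4"
  have Q: "?Q \<ge> 0" using star_energy_nonneg assms by blast
  have k: "z \<le> 2 * (r + s) * ?Q" if "z / c \<le> ?Q" "c > 0" "c \<le> 2 * (r + s)" for z c
  proof -
    have "z \<le> c * ?Q" using that by (simp add: divide_le_eq mult.commute)
    also have "\<dots> \<le> 2 * (r + s) * ?Q" using that Q by (intro mult_right_mono)
    finally show ?thesis .
  qed
  have "(u1 - u3)\<^sup>2 \<le> 2 * (r + s) * ?Q" "(u2 - u4)\<^sup>2 \<le> 2 * (r + s) * ?Q"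
    "(u1 - u2)\<^sup>2 \<le> 2 * (r + s) * ?Q" "(u1 - u4)\<^sup>2 \<le> 2 * (r + s) * ?Q"
    "(u3 - u2)\<^sup>2 \<le> 2 * (r + s) * ?Q" "(u3 - u4)\<^sup>2 \<le> 2 * (r + s) * ?Q"
    by (rule k, rule star_energy_two_terminal[OF assms(1,2)], use assms in simp, use assms in simp)+
  moreover have "0 \<le> 2 * (r + s) * ?Q" using Q assms by simp
  ultimately show ?thesis using assms(3,4) by (auto simp: power2_commute)
qed

section \<open>An arm with an eyebolt\<close>

text \<open>The resistance of an arm of six cells with legs \<open>r, s\<close>, measured from the centre cell to the outer
  corner. Without the eyebolt it would be \<open>8 * s\<close>.\<close>

definition arm_resistance :: "real \<Rightarrow> real \<Rightarrow> real" where
  "arm_resistance r s = 8 * s - s\<^sup>2 / (r + s)"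

lemma arm_resistance_pos: "r > 0 \<Longrightarrow> s > 0 \<Longrightarrow> arm_resistance r s > 0"
proof -
  assume a: "r > 0" "s > 0"
  have "s\<^sup>2 / (r + s) \<le> s" using a by (simp add: divide_simps power2_eq_square algebra_simps)
  then show ?thesis unfolding arm_resistance_def using a by linarith
qed

text \<open>The corner values of the six cells of an arm are named so that shared corners have the same name:
  \<open>z0\<close> to \<open>z4\<close> lie along the arm, \<open>y1\<close> to \<open>y3\<close> on the eyebolt, and the others are dangling. Omitting
  the dangling legs leaves resistors in series, except between the centres \<open>x\<close> and \<open>y\<close> of the two
  cells to which the eyebolt is fastened. There two branches of resistance \<open>2 * s\<close> and
  \<open>4 * r + 2 * s\<close> are parallel, which together have the resistance \<open>P\<close>.\<close>

lemma arm_lower: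
  fixes r s :: real
  assumes "r > 0" "s > 0"
  shows "(z4 - z0)\<^sup>2 / arm_resistance r s
    \<le> star_energy r s c1 z1 c3 z0 + star_energy r s d1 z2 y1 z1 + star_energy r s d3 z3 y3 z2
      + star_energy r s y1 y2 e1 e2 + star_energy r s y3 e3 e4 y2 + star_energy r s f1 z4 f3 z3"
proof -
  obtain x where x: "star_energy r s d1 z2 y1 z1
    = ((d1 - x)\<^sup>2 + (y1 - x)\<^sup>2) / r + ((z2 - x)\<^sup>2 + (z1 - x)\<^sup>2) / s"
    using star_energy_center[OF assms] by blast
  obtain y where y: "star_energy r s d3 z3 y3 z2
    = ((d3 - y)\<^sup>2 + (y3 - y)\<^sup>2) / r + ((z3 - y)\<^sup>2 + (z2 - y)\<^sup>2) / s"
    using star_energy_center[OF assms] by blast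
  define P where "P = s * (2 * r + s) / (r + s)"
  have rs: "r + s > 0" using assms by simp
  have P: "P > 0" unfolding P_def using assms by simp
  have "(z1 - z0)\<^sup>2 / (2 * s) \<le> star_energy r s c1 z1 c3 z0"
    by (rule star_energy_two_terminal[OF assms])
  moreover have "(y1 - y2)\<^sup>2 / (r + s) \<le> star_energy r s y1 y2 e1 e2"
    by (rule star_energy_two_terminal[OF assms])
  moreover have "(y3 - y2)\<^sup>2 / (r + s) \<le> star_energy r s y3 e3 e4 y2"
    by (rule star_energy_two_terminal[OF assms])
  moreover have "(z4 - z3)\<^sup>2 / (2 * s) \<le> star_energy r s f1 z4 f3 z3"
    by (rule star_energy_two_terminal[OF assms])
  moreover have "star_energy r s d1 z2 y1 z1 \<ge> (x - y1)\<^sup>2 / r + (x - z2)\<^sup>2 / s + (x - z1)\<^sup>2 / s"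
    unfolding x using assms by (simp add: add_divide_distrib power2_commute)
  moreover have "star_energy r s d3 z3 y3 z2 \<ge> (y3 - y)\<^sup>2 / r + (y - z3)\<^sup>2 / s + (z2 - y)\<^sup>2 / s"
    unfolding y using assms by (simp add: add_divide_distrib power2_commute)
  moreover have "(x - y)\<^sup>2 / (s + s) \<le> (x - z2)\<^sup>2 / s + (z2 - y)\<^sup>2 / s"
    by (rule series_law_diff[OF assms(2,2)])
  moreover have "(x - y2)\<^sup>2 / (r + (r + s)) \<le> (x - y1)\<^sup>2 / r + (y1 - y2)\<^sup>2 / (r + s)"
    by (rule series_law_diff[OF assms(1) rs])
  moreover have "(y2 - y)\<^sup>2 / ((r + s) + r) \<le> (y2 - y3)\<^sup>2 / (r + s) + (y3 - y)\<^sup>2 / r"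
    by (rule series_law_diff[OF rs assms(1)])
  moreover have "(x - y)\<^sup>2 / ((r + (r + s)) + ((r + s) + r))
      \<le> (x - y2)\<^sup>2 / (r + (r + s)) + (y2 - y)\<^sup>2 / ((r + s) + r)"
    by (rule series_law_diff) (use assms in auto)
  moreover have "(x - y)\<^sup>2 / P = (x - y)\<^sup>2 / (s + s) + (x - y)\<^sup>2 / ((r + (r + s)) + ((r + s) + r))"
  proof -
    have "1 / P = 1 / (s + s) + 1 / ((r + (r + s)) + ((r + s) + r))"
    proof -
      have "2 * r + s \<noteq> 0" "r + s \<noteq> 0" "(r + (r + s)) + ((r + s) + r) = 2 * (2 * r + s)"
        using assms by auto
      then show ?thesis unfolding P_def using assms by (simp add: divide_simps) (simp add: algebra_simps)
    qed
    from arg_cong[OF this, of "\<lambda>k. (x - y)\<^sup>2 * k"] show ?thesis by (simp add: distrib_left)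
  qed
  moreover have "(z1 - y)\<^sup>2 / (s + P) \<le> (z1 - x)\<^sup>2 / s + (x - y)\<^sup>2 / P"
    by (rule series_law_diff[OF assms(2) P])
  moreover have "(z0 - y)\<^sup>2 / (2 * s + (s + P)) \<le> (z0 - z1)\<^sup>2 / (2 * s) + (z1 - y)\<^sup>2 / (s + P)"
    by (rule series_law_diff) (use assms P in auto)
  moreover have "(y - z4)\<^sup>2 / (s + 2 * s) \<le> (y - z3)\<^sup>2 / s + (z3 - z4)\<^sup>2 / (2 * s)"
    by (rule series_law_diff) (use assms P in auto)
  moreover have "(z0 - z4)\<^sup>2 / ((2 * s + (s + P)) + (s + 2 * s))
      \<le> (z0 - y)\<^sup>2 / (2 * s + (s + P)) + (y - z4)\<^sup>2 / (s + 2 * s)"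
    by (rule series_law_diff) (use assms P in auto)
  moreover have "(2 * s + (s + P)) + (s + 2 * s) = arm_resistance r s"
    unfolding P_def arm_resistance_def using rs by (simp add: field_simps power2_eq_square)
  moreover have "(z0 - z4)\<^sup>2 = (z4 - z0)\<^sup>2" "(z0 - z1)\<^sup>2 = (z1 - z0)\<^sup>2" "(z3 - z4)\<^sup>2 = (z4 - z3)\<^sup>2"
    "(y2 - y3)\<^sup>2 = (y3 - y2)\<^sup>2" "(z1 - x)\<^sup>2 = (x - z1)\<^sup>2"
    by (simp_all add: power2_commute)
  ultimately show ?thesis by simp
qed

text \<open>The fraction of the current through an arm that takes the detour over the eyebolt, that is,
  \<open>2 * s / (2 * s + (4 * r + 2 * s))\<close>.\<close>

definition loop_share :: "real \<Rightarrow> real \<Rightarrow> real" where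
  "loop_share r s = s / (2 * (r + s))"

text \<open>The bound of \<open>arm_lower\<close> is attained by the potential of a current \<open>J\<close> through the arm. The values
  at the corners are obtained by adding up resistances from the centre outwards, a part \<open>g\<close> of the
  current going through the eyebolt; no current flows into dangling corners, which get the potential
  of the centre of their cell. As the energy of a star is at most the one with any chosen central
  potential, an upper bound for each cell suffices.\<close>

lemma arm_upper:
  fixes r s J :: real
  assumes "r > 0" "s > 0"
  defines "g \<equiv> loop_share r s"
  shows "star_energy r s (z + J * s) (z + J * (2 * s)) (z + J * s) z
      + star_energy r s (z + J * (3 * s)) (z + J * (3 * s + (1 - g) * s)) (z + J * (3 * s + g * r)) (z + J * (2 * s))
      + star_energy r s (z + J * (3 * s + (1 - g) * (2 * s))) (z + J * (4 * s + (1 - g) * (2 * s)))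
          (z + J * (3 * s + g * (3 * r + 2 * s))) (z + J * (3 * s + (1 - g) * s))
      + star_energy r s (z + J * (3 * s + g * r)) (z + J * (3 * s + g * (2 * r + s)))
          (z + J * (3 * s + g * (2 * r))) (z + J * (3 * s + g * (2 * r)))
      + star_energy r s (z + J * (3 * s + g * (3 * r + 2 * s))) (z + J * (3 * s + g * (2 * r + 2 * s)))
          (z + J * (3 * s + g * (2 * r + 2 * s))) (z + J * (3 * s + g * (2 * r + s)))
      + star_energy r s (z + J * (5 * s + (1 - g) * (2 * s))) (z + J * (6 * s + (1 - g) * (2 * s)))
          (z + J * (5 * s + (1 - g) * (2 * s))) (z + J * (4 * s + (1 - g) * (2 * s)))
    \<le> J\<^sup>2 * arm_resistance r s" (is ?energy)
    and "6 * s + (1 - g) * (2 * s) = arm_resistance r s"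
proof -
  have rs: "r + s > 0" using assms by simp
  \<comment> \<open>the voltage drop is the same on both branches of the loop\<close>
  have loop: "(1 - g) * (2 * s) = g * (4 * r + 2 * s)"
    unfolding g_def loop_share_def using rs by (simp add: field_simps)
  show R: "6 * s + (1 - g) * (2 * s) = arm_resistance r s"
    unfolding g_def loop_share_def arm_resistance_def using rs by (simp add: field_simps power2_eq_square)
  have sq: "(J * a)\<^sup>2 / a = J\<^sup>2 * a" "(J * (h * a))\<^sup>2 / a = J\<^sup>2 * (h\<^sup>2 * a)" if "a > 0" for a h
    using that by (simp_all add: power2_eq_square)
  have A: "star_energy r s (z + J * a) (z + J * b) (z + J * c) (z + J * d)
     \<le> J\<^sup>2 * (((a - m)\<^sup>2 + (c - m)\<^sup>2) / r + ((b - m)\<^sup>2 + (d - m)\<^sup>2) / s)" for a b c d m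
    using star_energy_le[OF assms(1,2), of "z + J * a" "z + J * b" "z + J * c" "z + J * d" "z + J * m"]
    by (simp add: power_mult_distrib right_diff_distrib[symmetric] add_divide_distrib distrib_left)
  have t1: "star_energy r s (z + J * s) (z + J * (2 * s)) (z + J * s) (z + J * 0) \<le> J\<^sup>2 * (2 * s)"
    by (rule order_trans[OF A[of _ _ _ _ s]]) (use assms in \<open>simp add: power2_eq_square\<close>)
  have t2: "star_energy r s (z + J * (3 * s)) (z + J * (3 * s + (1 - g) * s)) (z + J * (3 * s + g * r)) (z + J * (2 * s))
      \<le> J\<^sup>2 * (g\<^sup>2 * r + (1 - g)\<^sup>2 * s + s)"
    by (rule order_trans[OF A[of _ _ _ _ "3 * s"]]) (use assms in \<open>simp add: power2_eq_square field_simps\<close>)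
  have e1: "(3 * s + g * (3 * r + 2 * s)) - (3 * s + (1 - g) * (2 * s)) = - (g * r)"
    unfolding loop by (simp add: algebra_simps)
  have e2: "(4 * s + (1 - g) * (2 * s)) - (3 * s + (1 - g) * (2 * s)) = s" by simp
  have e3: "(3 * s + (1 - g) * s) - (3 * s + (1 - g) * (2 * s)) = - ((1 - g) * s)"
    by (simp add: algebra_simps)
  have t3: "star_energy r s (z + J * (3 * s + (1 - g) * (2 * s))) (z + J * (4 * s + (1 - g) * (2 * s)))
          (z + J * (3 * s + g * (3 * r + 2 * s))) (z + J * (3 * s + (1 - g) * s))
      \<le> J\<^sup>2 * (g\<^sup>2 * r + s + (1 - g)\<^sup>2 * s)"
    by (rule order_trans[OF A[of _ _ _ _ "3 * s + (1 - g) * (2 * s)"]], unfold e1 e2 e3)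
      (use assms(1,2) in \<open>simp add: power2_eq_square add_divide_distrib mult_ac add_ac\<close>)
  have t4: "star_energy r s (z + J * (3 * s + g * r)) (z + J * (3 * s + g * (2 * r + s)))
          (z + J * (3 * s + g * (2 * r))) (z + J * (3 * s + g * (2 * r)))
      \<le> J\<^sup>2 * (g\<^sup>2 * (r + s))"
    by (rule order_trans[OF A[of _ _ _ _ "3 * s + g * (2 * r)"]])
      (use assms in \<open>simp add: power2_eq_square field_simps\<close>)
  have t5: "star_energy r s (z + J * (3 * s + g * (3 * r + 2 * s))) (z + J * (3 * s + g * (2 * r + 2 * s)))
          (z + J * (3 * s + g * (2 * r + 2 * s))) (z + J * (3 * s + g * (2 * r + s)))
      \<le> J\<^sup>2 * (g\<^sup>2 * (r + s))"
    by (rule order_trans[OF A[of _ _ _ _ "3 * s + g * (2 * r + 2 * s)"]])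
      (use assms in \<open>simp add: power2_eq_square field_simps\<close>)
  have t6: "star_energy r s (z + J * (5 * s + (1 - g) * (2 * s))) (z + J * (6 * s + (1 - g) * (2 * s)))
          (z + J * (5 * s + (1 - g) * (2 * s))) (z + J * (4 * s + (1 - g) * (2 * s)))
      \<le> J\<^sup>2 * (2 * s)"
    by (rule order_trans[OF A[of _ _ _ _ "5 * s + (1 - g) * (2 * s)"]])
      (use assms in \<open>simp add: power2_eq_square\<close>)
  have "2 * s + (g\<^sup>2 * r + (1 - g)\<^sup>2 * s + s) + (g\<^sup>2 * r + s + (1 - g)\<^sup>2 * s)
      + g\<^sup>2 * (r + s) + g\<^sup>2 * (r + s) + 2 * s
    = 6 * s + (1 - g) * ((1 - g) * (2 * s)) + g * (g * (4 * r + 2 * s))"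
    by (simp add: power2_eq_square algebra_simps)
  also have "\<dots> = 6 * s + (1 - g) * (2 * s)"
    unfolding loop[symmetric] by (simp add: algebra_simps)
  finally have tot: "J\<^sup>2 * (2 * s) + J\<^sup>2 * (g\<^sup>2 * r + (1 - g)\<^sup>2 * s + s) + J\<^sup>2 * (g\<^sup>2 * r + s + (1 - g)\<^sup>2 * s)
      + J\<^sup>2 * (g\<^sup>2 * (r + s)) + J\<^sup>2 * (g\<^sup>2 * (r + s)) + J\<^sup>2 * (2 * s) = J\<^sup>2 * arm_resistance r s"
    unfolding R by (metis distrib_left)
  show ?energy
    using add_mono[OF add_mono[OF add_mono[OF add_mono[OF add_mono[OF t1 t2] t3] t4] t5] t6]
    unfolding tot by simp
qed

section \<open>The one-step trace\<close>

definition cell_energy :: "real \<Rightarrow> real \<Rightarrow> (point \<Rightarrow> real) \<Rightarrow> real" where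
  "cell_energy r s u =
     star_energy r s (u (-1/2, -1/2)) (u (1/2, -1/2)) (u (1/2, 1/2)) (u (-1/2, 1/2))"

text \<open>The symmetries of the star under reflection in the two diagonals reduce the two positions of each
  eyebolt, and the upper left arm, to the lower right arm with its eyebolt above the diagonal.\<close>

lemma cell_energy_reflections:
  "cell_energy r s u = star_energy r s (u (1/2, 1/2)) (u (1/2, -1/2)) (u (-1/2, -1/2)) (u (-1/2, 1/2))"
  "cell_energy r s u = star_energy r s (u (-1/2, -1/2)) (u (-1/2, 1/2)) (u (1/2, 1/2)) (u (1/2, -1/2))"
  "cell_energy r s u = star_energy r s (u (1/2, 1/2)) (u (-1/2, 1/2)) (u (-1/2, -1/2)) (u (1/2, -1/2))"
  unfolding cell_energy_def by (simp_all add: star_energy_reflect)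

lemma cell_energy_nonneg: "r > 0 \<Longrightarrow> s > 0 \<Longrightarrow> cell_energy r s u \<ge> 0"
  unfolding cell_energy_def by (rule star_energy_nonneg)

lemma cell_energy_osc:
  assumes "r > 0" "s > 0" "p \<in> corners" "q \<in> corners"
  shows "(u p - u q)\<^sup>2 \<le> 2 * (r + s) * cell_energy r s u"
  unfolding cell_energy_def
  by (rule star_energy_osc[OF assms(1,2)]) (use assms(3,4) in \<open>auto simp: corners_def\<close>)

lemma cell_energy_cong: "(\<And>p. p \<in> corners \<Longrightarrow> u p = v p) \<Longrightarrow> cell_energy r s u = cell_energy r s v"
  by (simp add: cell_energy_def corners_def)

lemma cell_energy_const: "(\<And>p. p \<in> corners \<Longrightarrow> u p = k) \<Longrightarrow> cell_energy r s u = 0"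
  by (simp add: cell_energy_def corners_def star_energy_def)

lemma cell_energy_mono:
  assumes "r > 0" "s > 0"
    and "\<And>p q. p \<in> corners \<Longrightarrow> q \<in> corners \<Longrightarrow> (u p - u q)\<^sup>2 \<le> a * (v p - v q)\<^sup>2 + b * (w p - w q)\<^sup>2"
  shows "cell_energy r s u \<le> a * cell_energy r s v + b * cell_energy r s w"
proof -
  have m: "c * (u p - u q)\<^sup>2 \<le> a * (c * (v p - v q)\<^sup>2) + b * (c * (w p - w q)\<^sup>2)"
    if "c \<ge> 0" "p \<in> corners" "q \<in> corners" for c p q
    using mult_left_mono[OF assms(3)[OF that(2,3)] that(1)] by (simp add: algebra_simps)
  have c: "s / r \<ge> 0" "r / s \<ge> 0" "2 * (r + s) > 0" using assms by auto
  have p: "(-1/2, -1/2) \<in> corners" "(1/2, -1/2) \<in> corners" "(1/2, 1/2) \<in> corners" "(-1/2, 1/2) \<in> corners"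
    by (auto simp: corners_def)
  note mm = m[OF c(1) p(1,3)] m[OF c(2) p(2,4)]
    assms(3)[OF p(1,2)] assms(3)[OF p(2,3)] assms(3)[OF p(3,4)] assms(3)[OF p(4,1)]
  have d: "a * (x / k) + b * (y / k) = (a * x + b * y) / k" for x y k :: real
    by (simp add: add_divide_distrib)
  show ?thesis
    unfolding cell_energy_def star_energy_def d
    by (rule divide_right_mono) (use c(3) mm in \<open>unfold distrib_left, linarith+\<close>)
qed

text \<open>The potential of \<open>arm_upper\<close> as a function of the position: in units of \<open>1/18\<close> all vertices have odd
  integer coordinates \<open>X, Y\<close>; for the lower right arm \<open>t = X - Y\<close> is the position along the arm and
  \<open>q = X + Y\<close> the one across it, positive on the side of the eyebolt.\<close>

definition arm_potential :: "real \<Rightarrow> real \<Rightarrow> real \<Rightarrow> real \<Rightarrow> real" where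
  "arm_potential r s t q = (let g = loop_share r s in
     if t = 2 then 0
     else if t = 4 then s
     else if t = 6 then (if q = 0 then 2 * s else 3 * s + g * (2 * r))
     else if t = 8 then (if q = 2 then 3 * s + g * r else if q = 6 then 3 * s + g * (2 * r) else 3 * s)
     else if t = 10 then (if q = 0 then 3 * s + (1 - g) * s else 3 * s + g * (2 * r + s))
     else if t = 12 then (if q = 2 then 3 * s + g * (3 * r + 2 * s)
            else if q = 6 then 3 * s + g * (2 * r + 2 * s) else 3 * s + (1 - g) * (2 * s))
     else if t = 14 then (if q = 0 then 4 * s + (1 - g) * (2 * s) else 3 * s + g * (2 * r + 2 * s))
     else if t = 16 then 5 * s + (1 - g) * (2 * s)
     else 6 * s + (1 - g) * (2 * s))"

context eyebolted_cross
begin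

lemma lower_right_sum:
  fixes F :: "index \<Rightarrow> real"
  shows "L = {(3,-1),(4,-2)} \<Longrightarrow> (\<Sum>i\<in>lower_right_cells. F i)
    = F (1,-1) + F (2,-2) + F (3,-3) + F (3,-1) + F (4,-2) + F (4,-4)"
   and "L = {(1,-3),(2,-4)} \<Longrightarrow> (\<Sum>i\<in>lower_right_cells. F i)
    = F (1,-1) + F (2,-2) + F (3,-3) + F (1,-3) + F (2,-4) + F (4,-4)"
  unfolding lower_right_cells_def by simp_all

lemma upper_left_sum:
  fixes F :: "index \<Rightarrow> real"
  shows "U = {(-3,1),(-4,2)} \<Longrightarrow> (\<Sum>i\<in>upper_left_cells. F i)
    = F (-1,1) + F (-2,2) + F (-3,3) + F (-3,1) + F (-4,2) + F (-4,4)"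
   and "U = {(-1,3),(-2,4)} \<Longrightarrow> (\<Sum>i\<in>upper_left_cells. F i)
    = F (-1,1) + F (-2,2) + F (-3,3) + F (-1,3) + F (-2,4) + F (-4,4)"
  unfolding upper_left_cells_def by simp_all

lemma diagonal_sum:
  fixes F :: "index \<Rightarrow> real"
  shows "(\<Sum>i\<in>diagonal_cells. F i)
    = F (0,0) + (F (1,1) + F (2,2) + F (3,3) + F (4,4)) + (F (-1,-1) + F (-2,-2) + F (-3,-3) + F (-4,-4))"
  by (simp add: diagonal_cells_def)

lemma lower_right_arm_lower:
  assumes "r > 0" "s > 0"
  shows "(v (1/2, -1/2) - v (1/18, -1/18))\<^sup>2 / arm_resistance r s
    \<le> (\<Sum>i\<in>lower_right_cells. cell_energy r s (v \<circ> contraction i))"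
  using L_cases
proof
  assume L: "L = {(3,-1),(4,-2)}"
  show ?thesis
    unfolding lower_right_sum(1)[OF L] cell_energy_def
    by (simp add: contraction_def) (rule arm_lower[OF assms])
next
  assume L: "L = {(1,-3),(2,-4)}"
  show ?thesis
    unfolding lower_right_sum(2)[OF L] cell_energy_reflections(1)
    by (simp add: contraction_def) (rule arm_lower[OF assms])
qed

lemma upper_left_arm_lower:
  assumes "r > 0" "s > 0"
  shows "(v (-1/2, 1/2) - v (-1/18, 1/18))\<^sup>2 / arm_resistance r s
    \<le> (\<Sum>i\<in>upper_left_cells. cell_energy r s (v \<circ> contraction i))"
  using U_cases
proof
  assume U: "U = {(-3,1),(-4,2)}"
  show ?thesis
    unfolding upper_left_sum(1)[OF U] cell_energy_reflections(3)
    by (simp add: contraction_def) (rule arm_lower[OF assms])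
next
  assume U: "U = {(-1,3),(-2,4)}"
  show ?thesis
    unfolding upper_left_sum(2)[OF U] cell_energy_reflections(2)
    by (simp add: contraction_def) (rule arm_lower[OF assms])
qed

lemma arm_current:
  assumes "r > 0" "s > 0"
  shows "((z' - z) / arm_resistance r s)\<^sup>2 * arm_resistance r s = (z' - z)\<^sup>2 / arm_resistance r s"
    and "z + (z' - z) / arm_resistance r s * arm_resistance r s = z'"
  using arm_resistance_pos[OF assms] by (simp_all add: power2_eq_square)

lemma lower_right_arm_upper:
  assumes rs: "r > 0" "s > 0"
  obtains A :: "point \<Rightarrow> real" where "A (1/18, -1/18) = z" "A (1/2, -1/2) = z'"
    "(\<Sum>i\<in>lower_right_cells. cell_energy r s (A \<circ> contraction i)) \<le> (z' - z)\<^sup>2 / arm_resistance r s"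
proof -
  define J where "J = (z' - z) / arm_resistance r s"
  \<comment> \<open>the sign \<open>\<epsilon>\<close> selects the side on which the eyebolt lies\<close>
  define A :: "real \<Rightarrow> point \<Rightarrow> real" where
    "A \<epsilon> x = z + J * arm_potential r s (18 * (fst x - snd x)) (\<epsilon> * (18 * (fst x + snd x)))" for \<epsilon> x
  have ends: "A \<epsilon> (1/18, -1/18) = z" "A \<epsilon> (1/2, -1/2) = z'" for \<epsilon>
    unfolding A_def J_def using arm_current(2)[OF rs, of z z'] arm_upper(2)[OF rs]
    by (simp_all add: arm_potential_def Let_def)
  note up = arm_upper(1)[OF rs, of z J, unfolded J_def arm_current(1)[OF rs]]
  from L_cases show ?thesis
  proof
    assume L: "L = {(3,-1),(4,-2)}"
    have "(\<Sum>i\<in>lower_right_cells. cell_energy r s (A 1 \<circ> contraction i)) \<le> (z' - z)\<^sup>2 / arm_resistance r s"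
      unfolding lower_right_sum(1)[OF L] cell_energy_def
      using up by (simp add: contraction_def A_def arm_potential_def Let_def J_def)
    then show ?thesis using ends that by blast
  next
    assume L: "L = {(1,-3),(2,-4)}"
    have "(\<Sum>i\<in>lower_right_cells. cell_energy r s (A (-1) \<circ> contraction i)) \<le> (z' - z)\<^sup>2 / arm_resistance r s"
      unfolding lower_right_sum(2)[OF L] cell_energy_reflections(1)
      using up by (simp add: contraction_def A_def arm_potential_def Let_def J_def)
    then show ?thesis using ends that by blast
  qed
qed

lemma upper_left_arm_upper:
  assumes rs: "r > 0" "s > 0"
  obtains A :: "point \<Rightarrow> real" where "A (-1/18, 1/18) = z" "A (-1/2, 1/2) = z'"
    "(\<Sum>i\<in>upper_left_cells. cell_energy r s (A \<circ> contraction i)) \<le> (z' - z)\<^sup>2 / arm_resistance r s"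
proof -
  define J where "J = (z' - z) / arm_resistance r s"
  \<comment> \<open>the sign \<open>\<epsilon>\<close> selects the side on which the eyebolt lies\<close>
  define A :: "real \<Rightarrow> point \<Rightarrow> real" where
    "A \<epsilon> x = z + J * arm_potential r s (18 * (snd x - fst x)) (\<epsilon> * (18 * (fst x + snd x)))" for \<epsilon> x
  have ends: "A \<epsilon> (-1/18, 1/18) = z" "A \<epsilon> (-1/2, 1/2) = z'" for \<epsilon>
    unfolding A_def J_def using arm_current(2)[OF rs, of z z'] arm_upper(2)[OF rs]
    by (simp_all add: arm_potential_def Let_def)
  note up = arm_upper(1)[OF rs, of z J, unfolded J_def arm_current(1)[OF rs]]
  from U_cases show ?thesis
  proof
    assume U: "U = {(-3,1),(-4,2)}"
    have "(\<Sum>i\<in>upper_left_cells. cell_energy r s (A (-1) \<circ> contraction i)) \<le> (z' - z)\<^sup>2 / arm_resistance r s"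
      unfolding upper_left_sum(1)[OF U] cell_energy_reflections(3)
      using up by (simp add: contraction_def A_def arm_potential_def Let_def J_def)
    then show ?thesis using ends that by blast
  next
    assume U: "U = {(-1,3),(-2,4)}"
    have "(\<Sum>i\<in>upper_left_cells. cell_energy r s (A 1 \<circ> contraction i)) \<le> (z' - z)\<^sup>2 / arm_resistance r s"
      unfolding upper_left_sum(2)[OF U] cell_energy_reflections(2)
      using up by (simp add: contraction_def A_def arm_potential_def Let_def J_def)
    then show ?thesis using ends that by blast
  qed
qed

lemma sum_two_types:
  fixes F :: "real \<Rightarrow> real \<Rightarrow> index \<Rightarrow> real"
  assumes "\<And>i. i \<in> I \<Longrightarrow> R i = (if fst i = snd i then \<rho> else \<rho>')"
    and "\<And>i. i \<in> I \<Longrightarrow> S i = (if fst i = snd i then \<sigma> else \<sigma>')"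
  shows "(\<Sum>i\<in>I. F (R i) (S i) i) = (\<Sum>i\<in>diagonal_cells. F \<rho> \<sigma> i)
     + (\<Sum>i\<in>lower_right_cells. F \<rho>' \<sigma>' i) + (\<Sum>i\<in>upper_left_cells. F \<rho>' \<sigma>' i)"
proof -
  have "(\<Sum>i\<in>diagonal_cells. F (R i) (S i) i) = (\<Sum>i\<in>diagonal_cells. F \<rho> \<sigma> i)"
    by (rule sum.cong) (auto simp: assms cells_eq dest: diagonal_cellsD)
  moreover have "(\<Sum>i\<in>lower_right_cells. F (R i) (S i) i) = (\<Sum>i\<in>lower_right_cells. F \<rho>' \<sigma>' i)"
    by (rule sum.cong) (auto simp: assms cells_eq dest: lower_right_cellsD)
  moreover have "(\<Sum>i\<in>upper_left_cells. F (R i) (S i) i) = (\<Sum>i\<in>upper_left_cells. F \<rho>' \<sigma>' i)"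
    by (rule sum.cong) (auto simp: assms cells_eq dest: upper_left_cellsD)
  ultimately show ?thesis unfolding sum_cells by simp
qed

text \<open>Choose the potential \<open>m\<close> of the central node of the centre cell. By the series law the four arms
  that leave this node have at least the energy of the four legs of a star with centre \<open>m\<close>, which
  is at least the energy of the big star.\<close>

lemma one_step_lower:
  assumes pos: "\<rho> > 0" "\<sigma> > 0" "\<rho>' > 0" "\<sigma>' > 0"
    and R: "\<And>i. i \<in> I \<Longrightarrow> R i = (if fst i = snd i then \<rho> else \<rho>')"
    and S: "\<And>i. i \<in> I \<Longrightarrow> S i = (if fst i = snd i then \<sigma> else \<sigma>')"
    and r: "r = 9 * \<rho>" and s: "s = \<sigma> + arm_resistance \<rho>' \<sigma>'"
  shows "cell_energy r s v \<le> (\<Sum>i\<in>I. cell_energy (R i) (S i) (v \<circ> contraction i))"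
proof -
  let ?E = "arm_resistance \<rho>' \<sigma>'"
  have E: "?E > 0" using arm_resistance_pos pos by blast
  have c0: "contraction (0,0) (x, y) = (x / 9, y / 9)" for x y
    by (simp add: contraction_def)
  obtain m where m: "cell_energy \<rho> \<sigma> (v \<circ> contraction (0,0))
    = ((v (-1/18, -1/18) - m)\<^sup>2 + (v (1/18, 1/18) - m)\<^sup>2) / \<rho>
      + ((v (1/18, -1/18) - m)\<^sup>2 + (v (-1/18, 1/18) - m)\<^sup>2) / \<sigma>"
    using star_energy_center[OF pos(1,2), of "v (-1/18, -1/18)" "v (1/18, -1/18)" "v (1/18, 1/18)" "v (-1/18, 1/18)"]
    unfolding cell_energy_def by (auto simp: c0)
  have chain: "(z4 - z0)\<^sup>2 / (8 * \<rho>)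
      \<le> (z1 - z0)\<^sup>2 / (2 * \<rho>) + (z2 - z1)\<^sup>2 / (2 * \<rho>) + (z3 - z2)\<^sup>2 / (2 * \<rho>) + (z4 - z3)\<^sup>2 / (2 * \<rho>)"
    for z0 z1 z2 z3 z4 :: real
  proof -
    have "(z4 - z0)\<^sup>2 / (4 * \<rho> + 4 * \<rho>) \<le> (z4 - z2)\<^sup>2 / (4 * \<rho>) + (z2 - z0)\<^sup>2 / (4 * \<rho>)"
      "(z4 - z2)\<^sup>2 / (2 * \<rho> + 2 * \<rho>) \<le> (z4 - z3)\<^sup>2 / (2 * \<rho>) + (z3 - z2)\<^sup>2 / (2 * \<rho>)"
      "(z2 - z0)\<^sup>2 / (2 * \<rho> + 2 * \<rho>) \<le> (z2 - z1)\<^sup>2 / (2 * \<rho>) + (z1 - z0)\<^sup>2 / (2 * \<rho>)"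
      by (rule series_law_diff; use pos in simp)+
    then show ?thesis by simp
  qed
  have two: "(u (1/2,1/2) - u (-1/2,-1/2))\<^sup>2 / (2 * \<rho>) \<le> cell_energy \<rho> \<sigma> u" for u
    unfolding cell_energy_def power2_commute[of "u (1/2,1/2)"]
    by (rule star_energy_two_terminal(1)[OF pos(1,2)])
  note t = two[of "v \<circ> contraction i" for i]
  have up: "(v (1/2, 1/2) - v (1/18, 1/18))\<^sup>2 / (8 * \<rho>)
    \<le> cell_energy \<rho> \<sigma> (v \<circ> contraction (1,1)) + cell_energy \<rho> \<sigma> (v \<circ> contraction (2,2))
     + cell_energy \<rho> \<sigma> (v \<circ> contraction (3,3)) + cell_energy \<rho> \<sigma> (v \<circ> contraction (4,4))"
    using t[of "(1,1)"] t[of "(2,2)"] t[of "(3,3)"] t[of "(4,4)"]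
      chain[of "v (1/2,1/2)" "v (1/18,1/18)" "v (1/6,1/6)" "v (5/18,5/18)" "v (7/18,7/18)"]
    by (simp add: contraction_def)
  have down: "(v (-1/2, -1/2) - v (-1/18, -1/18))\<^sup>2 / (8 * \<rho>)
    \<le> cell_energy \<rho> \<sigma> (v \<circ> contraction (-1,-1)) + cell_energy \<rho> \<sigma> (v \<circ> contraction (-2,-2))
     + cell_energy \<rho> \<sigma> (v \<circ> contraction (-3,-3)) + cell_energy \<rho> \<sigma> (v \<circ> contraction (-4,-4))"
    using t[of "(-1,-1)"] t[of "(-2,-2)"] t[of "(-3,-3)"] t[of "(-4,-4)"]
      chain[of "v (-1/2,-1/2)" "v (-1/18,-1/18)" "v (-1/6,-1/6)" "v (-5/18,-5/18)" "v (-7/18,-7/18)"]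
    by (simp add: contraction_def power2_commute)
  have "(v (1/2, 1/2) - m)\<^sup>2 / (8 * \<rho> + \<rho>) \<le> (v (1/2, 1/2) - v (1/18, 1/18))\<^sup>2 / (8 * \<rho>) + (v (1/18, 1/18) - m)\<^sup>2 / \<rho>"
    "(v (-1/2, -1/2) - m)\<^sup>2 / (8 * \<rho> + \<rho>) \<le> (v (-1/2, -1/2) - v (-1/18, -1/18))\<^sup>2 / (8 * \<rho>) + (v (-1/18, -1/18) - m)\<^sup>2 / \<rho>"
    "(v (1/2, -1/2) - m)\<^sup>2 / (?E + \<sigma>) \<le> (v (1/2, -1/2) - v (1/18, -1/18))\<^sup>2 / ?E + (v (1/18, -1/18) - m)\<^sup>2 / \<sigma>"
    "(v (-1/2, 1/2) - m)\<^sup>2 / (?E + \<sigma>) \<le> (v (-1/2, 1/2) - v (-1/18, 1/18))\<^sup>2 / ?E + (v (-1/18, 1/18) - m)\<^sup>2 / \<sigma>"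
    by (rule series_law_diff; use pos E in simp)+
  moreover have "cell_energy r s v \<le> ((v (-1/2, -1/2) - m)\<^sup>2 + (v (1/2, 1/2) - m)\<^sup>2) / r
     + ((v (1/2, -1/2) - m)\<^sup>2 + (v (-1/2, 1/2) - m)\<^sup>2) / s"
    unfolding cell_energy_def by (rule star_energy_le) (use r s pos E in auto)
  moreover note up down lower_right_arm_lower[OF pos(3,4), of v] upper_left_arm_lower[OF pos(3,4), of v]
  moreover have "8 * \<rho> + \<rho> = r" "?E + \<sigma> = s" using r s by auto
  moreover have "(\<Sum>i\<in>I. cell_energy (R i) (S i) (v \<circ> contraction i))
    = (\<Sum>i\<in>diagonal_cells. cell_energy \<rho> \<sigma> (v \<circ> contraction i))
     + (\<Sum>i\<in>lower_right_cells. cell_energy \<rho>' \<sigma>' (v \<circ> contraction i))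
     + (\<Sum>i\<in>upper_left_cells. cell_energy \<rho>' \<sigma>' (v \<circ> contraction i))"
    using R S by (rule sum_two_types)
  ultimately show ?thesis
    unfolding diagonal_sum m add_divide_distrib by simp
qed

text \<open>The minimiser. The centre of the star with the given corner values becomes the centre of the centre
  cell, with potential \<open>m\<close>. On the main diagonal the potential is piecewise linear, on the two other
  arms it is taken from \<open>arm_upper\<close>.\<close>

lemma one_step_extension:
  assumes pos: "\<rho> > 0" "\<sigma> > 0" "\<rho>' > 0" "\<sigma>' > 0"
    and R: "\<And>i. i \<in> I \<Longrightarrow> R i = (if fst i = snd i then \<rho> else \<rho>')"
    and S: "\<And>i. i \<in> I \<Longrightarrow> S i = (if fst i = snd i then \<sigma> else \<sigma>')"
    and r: "r = 9 * \<rho>" and s: "s = \<sigma> + arm_resistance \<rho>' \<sigma>'"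
  obtains v where "\<And>p. p \<in> corners \<Longrightarrow> v p = u p"
    "(\<Sum>i\<in>I. cell_energy (R i) (S i) (v \<circ> contraction i)) \<le> cell_energy r s u"
proof -
  let ?E = "arm_resistance \<rho>' \<sigma>'"
  have E: "?E > 0" using arm_resistance_pos pos by blast
  have rs: "r > 0" "s > 0" using pos E r s by auto
  define u1 u2 u3 u4 where "u1 = u (-1/2, -1/2)" "u2 = u (1/2, -1/2)" "u3 = u (1/2, 1/2)" "u4 = u (-1/2, 1/2)"
  obtain m where m: "cell_energy r s u = ((u1 - m)\<^sup>2 + (u3 - m)\<^sup>2) / r + ((u2 - m)\<^sup>2 + (u4 - m)\<^sup>2) / s"
    using star_energy_center[OF rs] unfolding cell_energy_def u1_u2_u3_u4_def by blast
  define c2 c4 where "c2 = m + (u2 - m) * (\<sigma> / s)" "c4 = m + (u4 - m) * (\<sigma> / s)"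
  obtain A2 where A2: "A2 (1/18, -1/18) = c2" "A2 (1/2, -1/2) = u2"
    "(\<Sum>i\<in>lower_right_cells. cell_energy \<rho>' \<sigma>' (A2 \<circ> contraction i)) \<le> (u2 - c2)\<^sup>2 / ?E"
    using lower_right_arm_upper[OF pos(3,4)] by blast
  obtain A4 where A4: "A4 (-1/18, 1/18) = c4" "A4 (-1/2, 1/2) = u4"
    "(\<Sum>i\<in>upper_left_cells. cell_energy \<rho>' \<sigma>' (A4 \<circ> contraction i)) \<le> (u4 - c4)\<^sup>2 / ?E"
    using upper_left_arm_upper[OF pos(3,4)] by blast
  \<comment> \<open>the condition \<open>fst x - snd x \<ge> 2/9\<close> holds at all vertices of the lower right arm apart from the one
    that it shares with the centre cell\<close>
  define v where "v x = (if fst x - snd x \<ge> 2/9 \<or> x = (1/18, -1/18) then A2 x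
      else if snd x - fst x \<ge> 2/9 \<or> x = (-1/18, 1/18) then A4 x
      else if fst x + snd x \<ge> 0 then m + (u3 - m) * (fst x + snd x)
      else m - (u1 - m) * (fst x + snd x))" for x
  have corn: "v p = u p" if "p \<in> corners" for p
    using that A2 A4 unfolding corners_def v_def u1_u2_u3_u4_def by auto
  have corner_diff: "fst p - snd p \<ge> 0 \<or> p = (-1/2, 1/2)" "snd p - fst p \<ge> 0 \<or> p = (1/2, -1/2)"
    "\<bar>fst p - snd p\<bar> \<le> 1" if "p \<in> corners" for p
    using that by (auto simp: corners_def)
  have lr: "cell_energy \<rho>' \<sigma>' (v \<circ> contraction i) = cell_energy \<rho>' \<sigma>' (A2 \<circ> contraction i)"
    if i: "i \<in> lower_right_cells" for i
  proof (rule cell_energy_cong)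
    fix p assume p: "p \<in> corners"
    have "i = (1, -1) \<or> fst i - snd i \<ge> 4"
      using i L_cases unfolding lower_right_cells_def by auto
    then have "fst (contraction i p) - snd (contraction i p) \<ge> 2/9 \<or> contraction i p = (1/18, -1/18)"
    proof
      assume "i = (1, -1)"
      then show ?thesis using corner_diff(1)[OF p] by (auto simp: contraction_def)
    next
      assume "fst i - snd i \<ge> 4"
      then have "real_of_int (fst i) - real_of_int (snd i) \<ge> 4" by linarith
      then show ?thesis using corner_diff(3)[OF p]
        by (intro disjI1) (simp add: contraction_def abs_le_iff)
    qed
    then show "(v \<circ> contraction i) p = (A2 \<circ> contraction i) p" unfolding v_def comp_def by (rule if_P)
  qed
  have ul: "cell_energy \<rho>' \<sigma>' (v \<circ> contraction i) = cell_energy \<rho>' \<sigma>' (A4 \<circ> contraction i)"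
    if i: "i \<in> upper_left_cells" for i
  proof (rule cell_energy_cong)
    fix p assume p: "p \<in> corners"
    have "i = (-1, 1) \<or> snd i - fst i \<ge> 4"
      using i U_cases unfolding upper_left_cells_def by auto
    then have "snd (contraction i p) - fst (contraction i p) \<ge> 2/9 \<or> contraction i p = (-1/18, 1/18)"
    proof
      assume "i = (-1, 1)"
      then show ?thesis using corner_diff(2)[OF p] by (auto simp: contraction_def)
    next
      assume "snd i - fst i \<ge> 4"
      then have "real_of_int (snd i) - real_of_int (fst i) \<ge> 4" by linarith
      then show ?thesis using corner_diff(3)[OF p]
        by (intro disjI1) (simp add: contraction_def abs_le_iff)
    qed
    then show "(v \<circ> contraction i) p = (A4 \<circ> contraction i) p" unfolding v_def comp_def by auto
  qed
  note le = star_energy_le[OF pos(1,2)]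
  have lin: "star_energy \<rho> \<sigma> (m + d * (a - 1/9)) (m + d * a) (m + d * (a + 1/9)) (m + d * a)
      \<le> 2 * d\<^sup>2 / (81 * \<rho>)"
    "star_energy \<rho> \<sigma> (m + d * (a + 1/9)) (m + d * a) (m + d * (a - 1/9)) (m + d * a)
      \<le> 2 * d\<^sup>2 / (81 * \<rho>)" for d a
    using le[of "m + d * (a - 1/9)" "m + d * a" "m + d * (a + 1/9)" "m + d * a" "m + d * a"]
      le[of "m + d * (a + 1/9)" "m + d * a" "m + d * (a - 1/9)" "m + d * a" "m + d * a"]
    by (simp_all add: right_diff_distrib[symmetric] power2_eq_square)
  have dU: "cell_energy \<rho> \<sigma> (v \<circ> contraction (k, k)) \<le> 2 * (u3 - m)\<^sup>2 / (81 * \<rho>)"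
    if "k \<in> {1,2,3,4}" for k
    using that lin(1)[of "u3 - m" "2 * of_int k / 9"] unfolding cell_energy_def
    by (elim insertE emptyE) (simp_all add: v_def contraction_def)
  have dD: "cell_energy \<rho> \<sigma> (v \<circ> contraction (- k, - k)) \<le> 2 * (u1 - m)\<^sup>2 / (81 * \<rho>)"
    if "k \<in> {1,2,3,4}" for k
    using that lin(2)[of "u1 - m" "2 * of_int k / 9"] unfolding cell_energy_def
    by (elim insertE emptyE) (simp_all add: v_def contraction_def)
  have d0: "cell_energy \<rho> \<sigma> (v \<circ> contraction (0, 0)) \<le> ((u1 - m)\<^sup>2 + (u3 - m)\<^sup>2) / (81 * \<rho>)
      + ((c2 - m)\<^sup>2 + (c4 - m)\<^sup>2) / \<sigma>"
    unfolding cell_energy_def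
    by (rule order_trans[OF le[of _ _ _ _ m]])
      (use A2(1) A4(1) in \<open>simp add: v_def contraction_def power2_eq_square add_divide_distrib\<close>)
  \<comment> \<open>along an arm the voltage splits in proportion to the resistances \<open>\<sigma>\<close> and \<open>?E\<close>\<close>
  have arm: "(c - m)\<^sup>2 / \<sigma> + (z - c)\<^sup>2 / ?E = (z - m)\<^sup>2 / s" if "c = m + (z - m) * (\<sigma> / s)" for c z
  proof -
    have zc: "z - c = (z - m) * (?E / s)"
      unfolding that using rs by (simp add: field_simps s)
    have "(c - m)\<^sup>2 / \<sigma> = (z - m)\<^sup>2 * \<sigma> / s\<^sup>2" "(z - c)\<^sup>2 / ?E = (z - m)\<^sup>2 * ?E / s\<^sup>2"
      unfolding zc unfolding that using pos E by (simp_all add: power2_eq_square)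
    then have "(c - m)\<^sup>2 / \<sigma> + (z - c)\<^sup>2 / ?E = (z - m)\<^sup>2 * (\<sigma> + ?E) / s\<^sup>2"
      by (simp add: distrib_left add_divide_distrib)
    then show ?thesis unfolding s[symmetric] using rs by (simp add: power2_eq_square)
  qed
  have "(\<Sum>i\<in>I. cell_energy (R i) (S i) (v \<circ> contraction i))
    = (\<Sum>i\<in>diagonal_cells. cell_energy \<rho> \<sigma> (v \<circ> contraction i))
     + (\<Sum>i\<in>lower_right_cells. cell_energy \<rho>' \<sigma>' (A2 \<circ> contraction i))
     + (\<Sum>i\<in>upper_left_cells. cell_energy \<rho>' \<sigma>' (A4 \<circ> contraction i))"
    using sum_two_types[OF R S, where F = "\<lambda>a b i. cell_energy a b (v \<circ> contraction i)"]
    by (simp add: lr ul)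
  also have "\<dots> \<le> 9 * (u1 - m)\<^sup>2 / (81 * \<rho>) + 9 * (u3 - m)\<^sup>2 / (81 * \<rho>)
     + ((c2 - m)\<^sup>2 / \<sigma> + (u2 - c2)\<^sup>2 / ?E) + ((c4 - m)\<^sup>2 / \<sigma> + (u4 - c4)\<^sup>2 / ?E)"
    using d0 dU[of 1] dU[of 2] dU[of 3] dU[of 4] dD[of 1] dD[of 2] dD[of 3] dD[of 4] A2(3) A4(3)
    unfolding diagonal_sum add_divide_distrib by simp
  also have "\<dots> = cell_energy r s u"
  proof -
    have "9 * (u1 - m)\<^sup>2 / (81 * \<rho>) = (u1 - m)\<^sup>2 / r" "9 * (u3 - m)\<^sup>2 / (81 * \<rho>) = (u3 - m)\<^sup>2 / r"
      unfolding r using pos by (simp_all add: field_simps)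
    then show ?thesis
      unfolding arm[OF c2_c4_def(1)] arm[OF c2_c4_def(2)] m add_divide_distrib by linarith
  qed
  finally show ?thesis using that corn by blast
qed

end

section \<open>Compatible energies from systems of legs\<close>

text \<open>The last two equations are the one-step trace. Prefixing a fixed word gives a leg system again
  (\<open>leg_system_shift\<close>), which restricts attention to one cell; this is what makes inductions over the
  level possible. The rate \<open>1/8\<close> suits both systems constructed below.\<close>

definition leg_system :: "(index list \<Rightarrow> real) \<Rightarrow> (index list \<Rightarrow> real) \<Rightarrow> real \<Rightarrow> bool" where
  "leg_system r s M \<longleftrightarrow> (\<forall>w. 0 < r w \<and> 0 < s w \<and> r w + s w \<le> M / 8 ^ length w \<and>
     (\<exists>\<rho> \<sigma> \<rho>' \<sigma>'. (\<forall>i. r (w @ [i]) = (if fst i = snd i then \<rho> else \<rho>')) \<and>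
        (\<forall>i. s (w @ [i]) = (if fst i = snd i then \<sigma> else \<sigma>')) \<and>
        r w = 9 * \<rho> \<and> s w = \<sigma> + arm_resistance \<rho>' \<sigma>'))"

definition net_energy ::
  "index set \<Rightarrow> (index list \<Rightarrow> real) \<Rightarrow> (index list \<Rightarrow> real) \<Rightarrow> nat \<Rightarrow> (point \<Rightarrow> real) \<Rightarrow> real" where
  "net_energy I r s n u = (\<Sum>w\<in>words I n. cell_energy (r w) (s w) (u \<circ> word_map w))"

lemma leg_systemD:
  assumes "leg_system r s M"
  shows "r w > 0" "s w > 0" "r w + s w \<le> M / 8 ^ length w"
  using assms unfolding leg_system_def by auto

lemma leg_system_bound_pos: "leg_system r s M \<Longrightarrow> M > 0"
  using leg_systemD[of r s M "[]"] by simp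

lemma leg_system_step:
  assumes "leg_system r s M"
  obtains \<rho> \<sigma> \<rho>' \<sigma>' where "\<rho> > 0" "\<sigma> > 0" "\<rho>' > 0" "\<sigma>' > 0"
    "\<And>i. r (w @ [i]) = (if fst i = snd i then \<rho> else \<rho>')"
    "\<And>i. s (w @ [i]) = (if fst i = snd i then \<sigma> else \<sigma>')"
    "r w = 9 * \<rho>" "s w = \<sigma> + arm_resistance \<rho>' \<sigma>'"
proof -
  obtain \<rho> \<sigma> \<rho>' \<sigma>' where *:
    "\<And>i. r (w @ [i]) = (if fst i = snd i then \<rho> else \<rho>')"
    "\<And>i. s (w @ [i]) = (if fst i = snd i then \<sigma> else \<sigma>')"
    "r w = 9 * \<rho>" "s w = \<sigma> + arm_resistance \<rho>' \<sigma>'"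
    using assms unfolding leg_system_def by metis
  have "\<rho> > 0" "\<sigma> > 0" "\<rho>' > 0" "\<sigma>' > 0"
    using leg_systemD(1,2)[OF assms, of "w @ [(0,0)]"] leg_systemD(1,2)[OF assms, of "w @ [(1,0)]"]
    unfolding * by simp_all
  with * show ?thesis using that by blast
qed

lemma leg_system_shift:
  assumes "leg_system r s M"
  shows "leg_system (\<lambda>w. r (v @ w)) (\<lambda>w. s (v @ w)) (M / 8 ^ length v)"
  unfolding leg_system_def
proof (intro allI conjI)
  fix w
  show "0 < r (v @ w)" "0 < s (v @ w)" using leg_systemD[OF assms] by auto
  show "r (v @ w) + s (v @ w) \<le> M / 8 ^ length v / 8 ^ length w"
    using leg_systemD(3)[OF assms, of "v @ w"] by (simp add: power_add)
  show "\<exists>\<rho> \<sigma> \<rho>' \<sigma>'. (\<forall>i. r (v @ w @ [i]) = (if fst i = snd i then \<rho> else \<rho>')) \<and>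
        (\<forall>i. s (v @ w @ [i]) = (if fst i = snd i then \<sigma> else \<sigma>')) \<and>
        r (v @ w) = 9 * \<rho> \<and> s (v @ w) = \<sigma> + arm_resistance \<rho>' \<sigma>'"
    using assms unfolding leg_system_def append_assoc[symmetric] by blast
qed

lemma net_energy_0 [simp]: "net_energy I r s 0 u = cell_energy (r []) (s []) u"
  by (simp add: net_energy_def)

lemma net_energy_1:
  "net_energy I r s (Suc 0) u = (\<Sum>i\<in>I. cell_energy (r [i]) (s [i]) (u \<circ> contraction i))"
  unfolding net_energy_def sum_words_Suc by simp

lemma net_energy_add:
  "net_energy I r s (m + n) u
    = (\<Sum>v\<in>words I m. net_energy I (\<lambda>w. r (v @ w)) (\<lambda>w. s (v @ w)) n (u \<circ> word_map v))"
  unfolding net_energy_def sum_words_add by (simp add: word_map_append comp_assoc)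

lemma net_energy_nonneg:
  assumes "leg_system r s M" shows "net_energy I r s n u \<ge> 0"
  unfolding net_energy_def
  by (intro sum_nonneg cell_energy_nonneg leg_systemD[OF assms])

lemma cell_corner_vertex: "w \<in> words I n \<Longrightarrow> p \<in> corners \<Longrightarrow> word_map w p \<in> vertices I n"
  unfolding vertices_words by blast

lemma net_energy_cong:
  assumes "\<And>x. x \<in> vertices I n \<Longrightarrow> u x = v x"
  shows "net_energy I r s n u = net_energy I r s n v"
  unfolding net_energy_def
  by (intro sum.cong cell_energy_cong refl) (simp add: assms cell_corner_vertex)

lemma net_energy_mono:
  assumes sys: "leg_system r s M"
    and "\<And>x y. x \<in> vertices I n \<Longrightarrow> y \<in> vertices I n \<Longrightarrow> (u x - u y)\<^sup>2 \<le> a * (v x - v y)\<^sup>2 + b * (w x - w y)\<^sup>2"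
  shows "net_energy I r s n u \<le> a * net_energy I r s n v + b * net_energy I r s n w"
  unfolding net_energy_def sum_distrib_left sum.distrib[symmetric]
  by (intro sum_mono cell_energy_mono leg_systemD[OF sys])
    (simp add: assms(2) cell_corner_vertex)

definition star_conductance :: "real \<Rightarrow> real \<Rightarrow> point \<Rightarrow> point \<Rightarrow> real" where
  "star_conductance r s p q =
     (if p = - q then if fst p = snd p then s / r else r / s else 1) / (2 * (r + s))"

definition network_conductance ::
  "(index list \<Rightarrow> real) \<Rightarrow> (index list \<Rightarrow> real) \<Rightarrow> conductance" where
  "network_conductance r s w x y =
     star_conductance (r w) (s w) (inv (word_map w) x) (inv (word_map w) y)"

lemma inv_word_map [simp]: "inv (word_map w) (word_map w x) = x"
  by (rule inv_f_f) (rule inj_word_map)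

lemma cell_energy_conductance:
  "(1 / 2) * (\<Sum>x\<in>corners. \<Sum>y\<in>corners. star_conductance r s x y * \<bar>u x - u y\<bar>\<^sup>2) = cell_energy r s u"
proof -
  define a b k where "a = s / r / (2 * (r + s))" "b = r / s / (2 * (r + s))" "k = 1 / (2 * (r + s))"
  have sc: "star_conductance r s p q = (if p = - q then if fst p = snd p then a else b else k)" for p q
    unfolding star_conductance_def a_b_k_def by simp
  define u1 u2 u3 u4 where "u1 = u (-1/2, -1/2)" "u2 = u (1/2, -1/2)" "u3 = u (1/2, 1/2)" "u4 = u (-1/2, 1/2)"
  have corner_sum: "(\<Sum>x\<in>corners. f x) = f (-1/2, -1/2) + f (1/2, -1/2) + f (1/2, 1/2) + f (-1/2, 1/2)"
    for f :: "point \<Rightarrow> real"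
    unfolding corners_def by simp
  have "(1 / 2) * (\<Sum>x\<in>corners. \<Sum>y\<in>corners. star_conductance r s x y * \<bar>u x - u y\<bar>\<^sup>2)
    = (1 / 2) * ((k * (u1 - u2)\<^sup>2 + a * (u1 - u3)\<^sup>2 + k * (u1 - u4)\<^sup>2)
      + (k * (u2 - u1)\<^sup>2 + k * (u2 - u3)\<^sup>2 + b * (u2 - u4)\<^sup>2)
      + (a * (u3 - u1)\<^sup>2 + k * (u3 - u2)\<^sup>2 + k * (u3 - u4)\<^sup>2)
      + (k * (u4 - u1)\<^sup>2 + b * (u4 - u2)\<^sup>2 + k * (u4 - u3)\<^sup>2))"
    unfolding corner_sum sc u1_u2_u3_u4_def[symmetric] by simp
  also have "\<dots> = a * (u1 - u3)\<^sup>2 + b * (u2 - u4)\<^sup>2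
      + k * (u1 - u2)\<^sup>2 + k * (u2 - u3)\<^sup>2 + k * (u3 - u4)\<^sup>2 + k * (u4 - u1)\<^sup>2"
    unfolding power2_commute[of u2 u1] power2_commute[of u3 u1] power2_commute[of u1 u4]
      power2_commute[of u3 u2] power2_commute[of u4 u2] power2_commute[of u4 u3]
    by simp
  also have "\<dots> = cell_energy r s u"
    unfolding cell_energy_def star_energy_def u1_u2_u3_u4_def[symmetric] a_b_k_def
    by (simp add: add_divide_distrib)
  finally show ?thesis .
qed

lemma energy_net: "energy I (network_conductance r s) n u = net_energy I r s n u"
proof -
  have "(\<Sum>x\<in>cell_vertices w. \<Sum>y\<in>cell_vertices w. network_conductance r s w x y * \<bar>u x - u y\<bar>\<^sup>2)
    = (\<Sum>p\<in>corners. \<Sum>q\<in>corners. star_conductance (r w) (s w) p q * \<bar>(u \<circ> word_map w) p - (u \<circ> word_map w) q\<bar>\<^sup>2)" for w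
    unfolding cell_vertices_def
    by (simp add: sum.reindex inj_on_subset[OF inj_word_map] network_conductance_def)
  then show ?thesis
    unfolding energy_def net_energy_def cell_energy_conductance[symmetric] by simp
qed

lemma positive_network_conductance:
  assumes "leg_system r s M" shows "positive_conductance I (network_conductance r s)"
proof -
  have "star_conductance a b p q > 0" "star_conductance a b p q = star_conductance a b q p"
    if "a > 0" "b > 0" for a b p q
    using that by (auto simp: star_conductance_def)
  then show ?thesis
    unfolding positive_conductance_def network_conductance_def using leg_systemD[OF assms] by metis
qed

context eyebolted_cross
begin

lemma net_energy_Suc:
  assumes sys: "leg_system r s M"
  shows "net_energy I r s n u \<le> net_energy I r s (Suc n) u"
proof -
  have one: "net_energy I r s 0 u \<le> net_energy I r s (Suc 0) u" if sys: "leg_system r s M" for r s M u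
  proof -
    obtain \<rho> \<sigma> \<rho>' \<sigma>' where *: "\<rho> > 0" "\<sigma> > 0" "\<rho>' > 0" "\<sigma>' > 0"
      "\<And>i. r ([] @ [i]) = (if fst i = snd i then \<rho> else \<rho>')"
      "\<And>i. s ([] @ [i]) = (if fst i = snd i then \<sigma> else \<sigma>')"
      "r [] = 9 * \<rho>" "s [] = \<sigma> + arm_resistance \<rho>' \<sigma>'"
      using leg_system_step[OF sys, of "[]"] by blast
    show ?thesis
      unfolding net_energy_1 net_energy_0
      by (rule one_step_lower[OF *(1-4) _ _ *(7,8)]) (use *(5,6) in auto)
  qed
  have "net_energy I r s (n + 0) u \<le> net_energy I r s (n + Suc 0) u"
    unfolding net_energy_add by (intro sum_mono one) (rule leg_system_shift[OF sys])
  then show ?thesis by simp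
qed

lemma net_energy_level_mono:
  "leg_system r s M \<Longrightarrow> m \<le> n \<Longrightarrow> net_energy I r s m u \<le> net_energy I r s n u"
  by (rule lift_Suc_mono_le[where f = "\<lambda>n. net_energy I r s n u"]) (rule net_energy_Suc)

text \<open>The minimisers \<open>h w\<close> of the separate cells fit together: a vertex of the next level that lies in two
  cells is a corner of both, where the values are prescribed.\<close>

lemma harmonic_step:
  assumes sys: "leg_system r s M"
  obtains v where "\<And>x. x \<in> vertices I n \<Longrightarrow> v x = u x"
    "net_energy I r s (Suc n) v = net_energy I r s n u"
proof -
  let ?P = "\<lambda>w v. (\<forall>p\<in>corners. v p = u (word_map w p)) \<and>
      (\<Sum>i\<in>I. cell_energy (r (w @ [i])) (s (w @ [i])) (v \<circ> contraction i)) \<le> cell_energy (r w) (s w) (u \<circ> word_map w)"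
  have "\<forall>w. \<exists>v. ?P w v"
  proof
    fix w
    obtain \<rho> \<sigma> \<rho>' \<sigma>' where *: "\<rho> > 0" "\<sigma> > 0" "\<rho>' > 0" "\<sigma>' > 0"
      "\<And>i. r (w @ [i]) = (if fst i = snd i then \<rho> else \<rho>')"
      "\<And>i. s (w @ [i]) = (if fst i = snd i then \<sigma> else \<sigma>')"
      "r w = 9 * \<rho>" "s w = \<sigma> + arm_resistance \<rho>' \<sigma>'"
      using leg_system_step[OF sys, of w] by blast
    obtain v where "\<And>p. p \<in> corners \<Longrightarrow> v p = (u \<circ> word_map w) p"
      "(\<Sum>i\<in>I. cell_energy (r (w @ [i])) (s (w @ [i])) (v \<circ> contraction i)) \<le> cell_energy (r w) (s w) (u \<circ> word_map w)"
      using one_step_extension[OF *(1-6) *(7,8)] by blast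
    then show "\<exists>v. ?P w v"
      by (intro exI[of _ v]) simp
  qed
  from choice[OF this] obtain h where h: "\<And>w p. p \<in> corners \<Longrightarrow> h w p = u (word_map w p)"
    "\<And>w. (\<Sum>i\<in>I. cell_energy (r (w @ [i])) (s (w @ [i])) (h w \<circ> contraction i)) \<le> cell_energy (r w) (s w) (u \<circ> word_map w)"
    by blast
  \<comment> \<open>a cell that contains \<open>x\<close>; it is unique unless \<open>x\<close> is a vertex of level \<open>n\<close>\<close>
  define W where "W x = (SOME w. w \<in> words I n \<and> x \<in> word_map w ` vertices I 1)" for x
  define v where "v x = (if x \<in> vertices I n then u x else h (W x) (inv (word_map (W x)) x))" for x
  have v: "v (word_map w y) = h w y" if w: "w \<in> words I n" and y: "y \<in> vertices I 1" for w y
  proof (cases "word_map w y \<in> vertices I n")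
    case True
    have y_sq: "y \<in> square" using y vertices_subset_square by (rule subsetD[rotated])
    have "y \<in> corners"
    proof -
      from True obtain w' p where wp: "w' \<in> words I n" "p \<in> corners" "word_map w y = word_map w' p"
        unfolding vertices_words by (elim UN_E imageE)
      have p_sq: "p \<in> square" by (rule subsetD[OF corners_subset_square wp(2)])
      show ?thesis
      proof (cases "w = w'")
        case True
        then have "y = p" using wp(3) by simp
        then show ?thesis using wp(2) by simp
      next
        case False
        then show ?thesis by (rule distinct_cells_meet_in_corners[OF w wp(1) _ y_sq p_sq wp(3)])
      qed
    qed
    then show ?thesis using True h(1) by (simp add: v_def)
  next
    case False
    have "W (word_map w y) \<in> words I n \<and> word_map w y \<in> word_map (W (word_map w y)) ` vertices I 1"
      unfolding W_def by (rule someI[of _ w]) (use w y in blast)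
    then obtain y' where w': "W (word_map w y) \<in> words I n" "y' \<in> vertices I 1"
      "word_map w y = word_map (W (word_map w y)) y'"
      by (elim conjE imageE)
    have "W (word_map w y) = w"
    proof (rule ccontr)
      assume "W (word_map w y) \<noteq> w"
      then have "w \<noteq> W (word_map w y)" by simp
      then have "y \<in> corners"
        by (rule distinct_cells_meet_in_corners[OF w w'(1) _ _ _ w'(3)])
          (rule subsetD[OF vertices_subset_square y], rule subsetD[OF vertices_subset_square w'(2)])
      then show False using False cell_corner_vertex[OF w] by simp
    qed
    then show ?thesis using False by (simp add: v_def)
  qed
  have sub: "contraction i p \<in> vertices I 1" if "i \<in> I" "p \<in> corners" for i p
    using that by auto
  have "net_energy I r s (n + Suc 0) v
      = (\<Sum>w\<in>words I n. \<Sum>i\<in>I. cell_energy (r (w @ [i])) (s (w @ [i])) (h w \<circ> contraction i))"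
    unfolding net_energy_add net_energy_1
    by (intro sum.cong refl cell_energy_cong) (simp add: v[OF _ sub])
  also have "\<dots> \<le> net_energy I r s n u"
    unfolding net_energy_def by (intro sum_mono h(2))
  finally have le: "net_energy I r s (Suc n) v \<le> net_energy I r s n u" by simp
  have vu: "v x = u x" if "x \<in> vertices I n" for x using that by (simp add: v_def)
  have "net_energy I r s n u = net_energy I r s n v"
    by (rule net_energy_cong) (simp add: vu)
  also have "\<dots> \<le> net_energy I r s (Suc n) v" by (rule net_energy_Suc[OF sys])
  finally show ?thesis using that[OF vu] le by simp
qed

lemma compatible_network:
  assumes sys: "leg_system r s M" shows "compatible I (network_conductance r s)"
  unfolding compatible_def Let_def energy_net
proof (intro allI conjI ballI)
  fix n u
  obtain v where "\<And>x. x \<in> vertices I n \<Longrightarrow> v x = u x"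
    "net_energy I r s (Suc n) v = net_energy I r s n u"
    by (rule harmonic_step[OF sys, of n u]) (rule that)
  then show "net_energy I r s n u \<in> {net_energy I r s (Suc n) v |v. \<forall>x\<in>vertices I n. v x = u x}"
    by (intro CollectI exI[of _ v] conjI ballI) simp_all
next
  fix n u e
  assume "e \<in> {net_energy I r s (Suc n) v |v. \<forall>x\<in>vertices I n. v x = u x}"
  then obtain v where v: "e = net_energy I r s (Suc n) v" "\<forall>x\<in>vertices I n. v x = u x" by blast
  have "net_energy I r s n u = net_energy I r s n v"
    by (rule net_energy_cong) (simp add: v)
  also have "\<dots> \<le> e" unfolding v(1) by (rule net_energy_Suc[OF sys])
  finally show "net_energy I r s n u \<le> e" .
qed

section \<open>Oscillation of functions of finite energy\<close>

text \<open>From every cell one reaches the centre cell in at most four steps between neighbouring cells, so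
  five cells are crossed, and as many on the way from the centre cell to the lower left corner.\<close>

lemma level_one_path:
  fixes v :: "point \<Rightarrow> real"
  assumes d: "\<And>i p q. i \<in> I \<Longrightarrow> p \<in> corners \<Longrightarrow> q \<in> corners \<Longrightarrow> \<bar>v (contraction i p) - v (contraction i q)\<bar> \<le> d"
    and i: "i \<in> I" "p \<in> corners"
  shows "\<bar>v (contraction i p) - v (-1/2, -1/2)\<bar> \<le> 10 * d"
proof -
  define c where "c = v (contraction (0,0) (-1/2,-1/2))"
  define P where "P i k \<longleftrightarrow> (\<forall>p\<in>corners. \<bar>v (contraction i p) - c\<bar> \<le> k * d)" for i and k :: real
  have c1: "(-1/2,-1/2) \<in> corners" by (simp add: corners_def)
  have d0: "d \<ge> 0" using d[OF corner_cells(1) c1 c1] by simp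
  \<comment> \<open>neighbouring cells share the corner \<open>?a\<close> of \<open>i\<close>, which is the opposite corner of \<open>j\<close>\<close>
  have step: "P j (k + 1)" if P: "P i k" and j: "j \<in> I"
    and adj: "\<bar>fst i - fst j\<bar> = 1" "\<bar>snd i - snd j\<bar> = 1" for i j k
    unfolding P_def
  proof
    fix p assume p: "p \<in> corners"
    let ?a = "((of_int (fst j) - of_int (fst i)) / 2, (of_int (snd j) - of_int (snd i)) / 2) :: point"
    have "\<bar>real_of_int (fst j) - real_of_int (fst i)\<bar> = 1" "\<bar>real_of_int (snd j) - real_of_int (snd i)\<bar> = 1"
      using adj by linarith+
    then have ac: "?a \<in> corners" "- ?a \<in> corners"
      unfolding corners_iff by (simp_all add: abs_divide abs_minus_commute)
    have eq: "contraction i ?a = contraction j (- ?a)"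
    proof -
      have h: "1/9 * ((b - a) / 2) + a / 9 = 1/9 * - ((b - a) / 2) + b / 9" for a b :: real
        by (simp add: field_simps)
      show ?thesis
        unfolding contraction_def prod_eq_iff
        by (simp only: fst_add snd_add fst_scaleR snd_scaleR fst_uminus snd_uminus fst_conv snd_conv
            real_scaleR_def h)
    qed
    have "\<bar>v (contraction j (- ?a)) - c\<bar> \<le> k * d"
      using P ac(1) unfolding eq[symmetric] P_def by blast
    moreover have "\<bar>v (contraction j p) - v (contraction j (- ?a))\<bar> \<le> d" by (rule d[OF j p ac(2)])
    ultimately show "\<bar>v (contraction j p) - c\<bar> \<le> (k + 1) * d"
      unfolding distrib_right by linarith
  qed
  have P0: "P (0,0) 1" unfolding P_def c_def using d[OF corner_cells(5) _ c1] by simp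
  have I: "(1,1) \<in> I" "(2,2) \<in> I" "(3,3) \<in> I" "(4,4) \<in> I" "(-1,-1) \<in> I" "(-2,-2) \<in> I" "(-3,-3) \<in> I" "(-4,-4) \<in> I"
    "(1,-1) \<in> I" "(2,-2) \<in> I" "(3,-3) \<in> I" "(4,-4) \<in> I" "(-1,1) \<in> I" "(-2,2) \<in> I" "(-3,3) \<in> I" "(-4,4) \<in> I"
    unfolding cells_eq diagonal_cells_def lower_right_cells_def upper_left_cells_def by simp_all
  have LU: "L \<subseteq> I" "U \<subseteq> I" unfolding cells_eq lower_right_cells_def upper_left_cells_def by auto
  have weak: "P i 5" if "P i k" "k \<le> 5" for i k
    unfolding P_def
  proof
    fix p assume "p \<in> corners"
    then have "\<bar>v (contraction i p) - c\<bar> \<le> k * d" using that unfolding P_def by blast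
    also have "\<dots> \<le> 5 * d" using that d0 by (intro mult_right_mono)
    finally show "\<bar>v (contraction i p) - c\<bar> \<le> 5 * d" .
  qed
  have chain: "P (a,b) 5 \<and> P (2*a,2*b) 3 \<and> P (2*a,2*b) 5 \<and> P (3*a,3*b) 5 \<and> P (4*a,4*b) 5"
    if "(a,b) \<in> I" "(2*a,2*b) \<in> I" "(3*a,3*b) \<in> I" "(4*a,4*b) \<in> I" "\<bar>a\<bar> = 1" "\<bar>b\<bar> = 1" for a b
  proof -
    have 2: "P (a,b) 2" using step[OF P0 that(1)] that(5,6) by simp
    have 3: "P (2*a,2*b) 3" using step[OF 2 that(2)] that(5,6) by simp
    have 4: "P (3*a,3*b) 4" using step[OF 3 that(3)] that(5,6) by simp
    have 5: "P (4*a,4*b) 5" using step[OF 4 that(4)] that(5,6) by simp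
    show ?thesis using 3 5 weak[OF 2] weak[OF 3] weak[OF 4] by simp
  qed
  note ch = chain[of 1 1] chain[of "-1" "-1"] chain[of 1 "-1"] chain[of "-1" 1]
  have P2: "P (2,-2) 3" "P (-2,2) 3"
    using ch I by simp_all
  have arms: "\<forall>j \<in> diagonal_cells \<union> {(1,-1), (2,-2), (3,-3), (4,-4)} \<union> {(-1,1), (-2,2), (-3,3), (-4,4)}. P j 5"
    unfolding diagonal_cells_def using ch I weak[OF P0] by simp
  have bolt: "P a 5 \<and> P b 5"
    if "P i 3" "a \<in> I" "b \<in> I" "\<bar>fst i - fst a\<bar> = 1" "\<bar>snd i - snd a\<bar> = 1"
      "\<bar>fst a - fst b\<bar> = 1" "\<bar>snd a - snd b\<bar> = 1" for i a b
  proof -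
    have 4: "P a 4" using step[OF that(1,2,4,5)] by simp
    show ?thesis using weak[OF 4] step[OF 4 that(3,6,7)] by simp
  qed
  have PL: "\<forall>i\<in>L. P i 5"
    using L_cases bolt[OF P2(1), of "(3,-1)" "(4,-2)"] bolt[OF P2(1), of "(1,-3)" "(2,-4)"] LU(1)
    by (elim disjE) simp_all
  have PU: "\<forall>i\<in>U. P i 5"
    using U_cases bolt[OF P2(2), of "(-3,1)" "(-4,2)"] bolt[OF P2(2), of "(-1,3)" "(-2,4)"] LU(2)
    by (elim disjE) simp_all
  have all: "P j 5" if j: "j \<in> I" for j
  proof -
    let ?A = "diagonal_cells \<union> {(1,-1), (2,-2), (3,-3), (4,-4)} \<union> {(-1,1), (-2,2), (-3,3), (-4,4)}"
    have "j \<in> ?A \<or> j \<in> L \<or> j \<in> U"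
      using j unfolding cells_eq lower_right_cells_def upper_left_cells_def Un_iff by argo
    then show ?thesis by (elim disjE bspec[OF arms] bspec[OF PL] bspec[OF PU])
  qed
  have "contraction (-4,-4) (-1/2,-1/2) = (-1/2,-1/2)" by (simp add: contraction_def)
  then have "\<bar>v (-1/2,-1/2) - c\<bar> \<le> 5 * d"
    using bspec[OF all[OF corner_cells(1), unfolded P_def] c1] by simp
  moreover have "\<bar>v (contraction i p) - c\<bar> \<le> 5 * d"
    using all[OF i(1)] i(2) unfolding P_def by blast
  ultimately show ?thesis by linarith
qed

lemma abs_le_if_square_le: "x\<^sup>2 \<le> y\<^sup>2 \<Longrightarrow> 0 \<le> y \<Longrightarrow> \<bar>x\<bar> \<le> y" for x y :: real
  by (rule power2_le_imp_le) simp_all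

text \<open>Induction on the level. A vertex lies in some cell of the first level, where the induction
  hypothesis holds with \<open>M / 8\<close> in place of \<open>M\<close>, and the lower left corner of that cell is reached
  along a path. The constant \<open>10\<close> reproduces itself because \<open>sqrt (1/8) \<le> 1/2\<close> and because a path costs
  at most \<open>10\<close> times \<open>sqrt (M * B) / 2\<close>.\<close>

lemma osc_bound_corner:
  assumes "leg_system r s M" and "\<And>n. net_energy I r s n u \<le> B" and "x \<in> vertices I n"
  shows "\<bar>u x - u (-1/2, -1/2)\<bar> \<le> 10 * sqrt (M * B)"
  using assms
proof (induction n arbitrary: r s M u x)
  case 0
  have M: "M > 0" using leg_system_bound_pos 0 by blast
  have B: "B \<ge> 0" using net_energy_nonneg[OF 0(1)] 0(2) order_trans by blast
  have "(u x - u (-1/2, -1/2))\<^sup>2 \<le> 2 * (r [] + s []) * cell_energy (r []) (s []) u"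
    by (rule cell_energy_osc) (use 0 leg_systemD[OF 0(1)] in \<open>auto simp: corners_def\<close>)
  also have "\<dots> \<le> 2 * M * B"
    using leg_systemD[OF 0(1), of "[]"] 0(2)[of 0] cell_energy_nonneg[of "r []" "s []"] M
    by (intro mult_mono) auto
  also have "\<dots> \<le> (10 * sqrt (M * B))\<^sup>2" using M B by (simp add: power_mult_distrib)
  finally show ?case by (rule abs_le_if_square_le) (use M B in simp)
next
  case (Suc n)
  note sys = Suc.prems(1)
  have M: "M > 0" using leg_system_bound_pos sys by blast
  have B: "B \<ge> 0" using net_energy_nonneg[OF sys] Suc.prems(2) order_trans by blast
  obtain i y where i: "i \<in> I" and y: "y \<in> vertices I n" and x: "x = contraction i y"
    using Suc.prems by auto
  have sysj: "leg_system (\<lambda>w. r (j # w)) (\<lambda>w. s (j # w)) (M / 8)" for j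
    using leg_system_shift[OF sys, of "[j]"] by simp
  have Ej: "net_energy I (\<lambda>w. r (j # w)) (\<lambda>w. s (j # w)) k (u \<circ> contraction j) \<le> B" if j: "j \<in> I" for k j
  proof -
    have "net_energy I (\<lambda>w. r (j # w)) (\<lambda>w. s (j # w)) k (u \<circ> contraction j)
      \<le> (\<Sum>i\<in>I. net_energy I (\<lambda>w. r (i # w)) (\<lambda>w. s (i # w)) k (u \<circ> contraction i))"
      using j net_energy_nonneg[OF sysj]
      by (intro member_le_sum[of j I "\<lambda>i. net_energy I (\<lambda>w. r (i # w)) (\<lambda>w. s (i # w)) k (u \<circ> contraction i)"]) auto
    also have "\<dots> = net_energy I r s (Suc 0 + k) u"
      unfolding net_energy_add[of _ _ _ "Suc 0"] sum_words_Suc by simp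
    also have "\<dots> \<le> B" by (rule Suc.prems(2))
    finally show ?thesis .
  qed
  have MB: "M * B \<ge> 0" using M B by simp
  have half: "sqrt (M / 8 * B) \<le> sqrt (M * B) / 2"
  proof -
    have "sqrt (M / 8 * B) \<le> sqrt (M * B / 4)" using M B by (intro real_sqrt_le_mono) simp
    then show ?thesis by (simp add: real_sqrt_divide)
  qed
  have "\<bar>(u \<circ> contraction i) y - (u \<circ> contraction i) (-1/2, -1/2)\<bar> \<le> 10 * sqrt (M / 8 * B)"
    by (rule Suc.IH[OF sysj Ej[OF i] y])
  moreover have "\<bar>u (contraction i (-1/2,-1/2)) - u (-1/2, -1/2)\<bar> \<le> 10 * (sqrt (M * B) / 2)"
  proof (rule level_one_path)
    show "i \<in> I" "(-1/2,-1/2) \<in> corners" using i by (auto simp: corners_def)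
    fix j p q assume j: "j \<in> I" "p \<in> corners" "q \<in> corners"
    have r: "r [j] > 0" "s [j] > 0" "r [j] + s [j] \<le> M / 8" using leg_systemD[OF sys, of "[j]"] by auto
    have "((u \<circ> contraction j) p - (u \<circ> contraction j) q)\<^sup>2 \<le> 2 * (r [j] + s [j]) * cell_energy (r [j]) (s [j]) (u \<circ> contraction j)"
      by (rule cell_energy_osc[OF r(1,2) j(2,3)])
    also have "\<dots> \<le> 2 * (M / 8) * B"
      using r Ej[OF j(1), of 0] cell_energy_nonneg[OF r(1,2)] M by (intro mult_mono) auto
    also have "\<dots> = (sqrt (M * B) / 2)\<^sup>2" unfolding power_divide real_sqrt_pow2[OF MB] by simp
    finally show "\<bar>u (contraction j p) - u (contraction j q)\<bar> \<le> sqrt (M * B) / 2"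
      unfolding comp_def by (rule abs_le_if_square_le) (use real_sqrt_ge_zero[OF MB] in simp)
  qed
  ultimately show ?case using half unfolding x comp_def by linarith
qed

lemma osc_bound:
  assumes "leg_system r s M" and "\<And>n. net_energy I r s n u \<le> B"
    and "x \<in> (\<Union>n. vertices I n)" "y \<in> (\<Union>n. vertices I n)"
  shows "\<bar>u x - u y\<bar> \<le> 20 * sqrt (M * B)"
proof -
  have "\<bar>u x - u (-1/2, -1/2)\<bar> \<le> 10 * sqrt (M * B)" "\<bar>u y - u (-1/2, -1/2)\<bar> \<le> 10 * sqrt (M * B)"
    using osc_bound_corner[OF assms(1,2)] assms(3,4) by blast+
  then show ?thesis by linarith
qed

lemma local_energy_le:
  assumes "leg_system r s M" and "\<And>n. net_energy I r s n u \<le> B" and w: "w \<in> words I m"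
  shows "net_energy I (\<lambda>v. r (w @ v)) (\<lambda>v. s (w @ v)) n (u \<circ> word_map w) \<le> B"
proof -
  have "net_energy I (\<lambda>v. r (w @ v)) (\<lambda>v. s (w @ v)) n (u \<circ> word_map w) \<le> net_energy I r s (m + n) u"
    unfolding net_energy_add
    using w net_energy_nonneg[OF leg_system_shift[OF assms(1)]]
    by (intro member_le_sum[of w _ "\<lambda>w. net_energy I (\<lambda>v. r (w @ v)) (\<lambda>v. s (w @ v)) n (u \<circ> word_map w)"])
      (auto simp: finite_words)
  also have "\<dots> \<le> B" by (rule assms(2))
  finally show ?thesis .
qed

lemma cell_osc_bound:
  assumes "leg_system r s M" and "\<And>n. net_energy I r s n u \<le> B" and w: "w \<in> words I m"
    and "x \<in> word_map w ` (\<Union>n. vertices I n)" "y \<in> word_map w ` (\<Union>n. vertices I n)"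
  shows "\<bar>u x - u y\<bar> \<le> 20 * sqrt (M / 8 ^ m * B)"
proof -
  obtain x' y' where *: "x = word_map w x'" "y = word_map w y'" "x' \<in> (\<Union>n. vertices I n)" "y' \<in> (\<Union>n. vertices I n)"
    using assms(4,5) by blast
  have "\<bar>(u \<circ> word_map w) x' - (u \<circ> word_map w) y'\<bar> \<le> 20 * sqrt (M / 8 ^ length w * B)"
    by (rule osc_bound[OF leg_system_shift[OF assms(1)] local_energy_le[OF assms(1-3)] *(3,4)])
  then show ?thesis using w * by (simp add: words_def)
qed

end

section \<open>Continuous harmonic extensions\<close>

locale eyebolted_fractal = eyebolted_cross +
  fixes K :: "point set"
  assumes K: "attractor I K"
begin

lemma K_nonempty: "K \<noteq> {}" and K_compact: "compact K" and K_eq: "K = (\<Union>i\<in>I. contraction i ` K)"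
  using K unfolding attractor_def by auto

lemma contraction_in_K: "i \<in> I \<Longrightarrow> x \<in> K \<Longrightarrow> contraction i x \<in> K"
  using K_eq by blast

lemma K_words: "K = (\<Union>w\<in>words I n. word_map w ` K)"
proof (induction n)
  case (Suc n)
  have "(\<Union>w\<in>words I (Suc n). word_map w ` K) = (\<Union>i\<in>I. contraction i ` (\<Union>w\<in>words I n. word_map w ` K))"
    unfolding words_Suc by (auto simp: image_iff) blast+
  then show ?case using Suc K_eq by simp
qed simp

text \<open>If \<open>a\<close> is the largest maximum norm in \<open>K\<close>, the contracted copies of \<open>K\<close> have norm at most
  \<open>a / 9 + 4 / 9\<close>, so \<open>a \<le> 1 / 2\<close>.\<close>

lemma K_subset_square: "K \<subseteq> square"
proof -
  let ?f = "\<lambda>x :: point. max \<bar>fst x\<bar> \<bar>snd x\<bar>"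
  have "continuous_on K ?f" by (intro continuous_intros)
  then obtain x where x: "x \<in> K" "\<And>y. y \<in> K \<Longrightarrow> ?f y \<le> ?f x"
    using continuous_attains_sup[OF K_compact K_nonempty] by blast
  obtain i y where i: "i \<in> I" "y \<in> K" "x = contraction i y" using K_eq x(1) by blast
  have b: "\<bar>a / 9 + of_int k / 9\<bar> \<le> \<bar>a\<bar> / 9 + 4 / 9" if "\<bar>k\<bar> \<le> 4" for a :: real and k :: int
  proof -
    have "\<bar>real_of_int k\<bar> \<le> 4" using that by linarith
    then show ?thesis by linarith
  qed
  have "?f x \<le> ?f y / 9 + 4 / 9"
    using b[of "fst i" "fst y"] b[of "snd i" "snd y"] index_bounds[OF i(1)]
    unfolding i(3) by (intro max.boundedI; simp add: contraction_def; linarith)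
  then have "?f x \<le> 1 / 2" using x(2)[OF i(2)] by linarith
  then show ?thesis using x(2) unfolding square_def by fastforce
qed

text \<open>A corner is fixed by one of the contractions, which would bring a nearest point of \<open>K\<close> nine times
  closer.\<close>

lemma corners_in_K: "corners \<subseteq> K"
proof
  fix p assume "p \<in> corners"
  then obtain i where i: "i \<in> I" "contraction i p = p" using corner_fixed by blast
  obtain x where x: "x \<in> K" "\<And>y. y \<in> K \<Longrightarrow> dist p x \<le> dist p y"
    using distance_attains_inf[OF compact_imp_closed[OF K_compact] K_nonempty] by blast
  have "dist p (contraction i x) = dist (contraction i p) (contraction i x)" using i by simp
  also have "\<dots> = dist p x / 9"
    by (simp add: contraction_def dist_norm scaleR_diff_right[symmetric])
  finally have "dist p x \<le> 0" using x(2)[OF contraction_in_K[OF i(1) x(1)]] by linarith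
  then show "p \<in> K" using x(1) by simp
qed

lemma vertices_in_K: "vertices I n \<subseteq> K"
  by (induction n) (use corners_in_K contraction_in_K in auto)

definition all_vertices :: "point set" where
  "all_vertices = (\<Union>n. vertices I n)"

lemma all_vertices_in_K: "all_vertices \<subseteq> K"
  unfolding all_vertices_def using vertices_in_K by blast

lemma cell_diameter:
  assumes "x \<in> square" "y \<in> square"
  shows "\<bar>fst (word_map w x) - fst (word_map w y)\<bar> \<le> 1 / 9 ^ length w"
    "\<bar>snd (word_map w x) - snd (word_map w y)\<bar> \<le> 1 / 9 ^ length w"
    "dist (word_map w x) (word_map w y) \<le> 2 / 9 ^ length w"
proof -
  have e: "\<bar>(a + k) / P - (b + k) / P\<bar> \<le> 1 / P" if "\<bar>a\<bar> \<le> 1/2" "\<bar>b\<bar> \<le> 1/2" "P > 0" for a b k P :: real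
  proof -
    have "(a + k) / P - (b + k) / P = (a - b) / P" by (simp add: diff_divide_distrib add_divide_distrib)
    moreover have "\<bar>a - b\<bar> \<le> 1" using that by linarith
    ultimately show ?thesis using that(3) by (simp add: abs_divide divide_right_mono)
  qed
  show 1: "\<bar>fst (word_map w x) - fst (word_map w y)\<bar> \<le> 1 / 9 ^ length w"
    unfolding word_map_offset by (rule e) (use assms in \<open>auto simp: square_def\<close>)
  show 2: "\<bar>snd (word_map w x) - snd (word_map w y)\<bar> \<le> 1 / 9 ^ length w"
    unfolding word_map_offset by (rule e) (use assms in \<open>auto simp: square_def\<close>)
  have "dist (word_map w x) (word_map w y)
    \<le> \<bar>fst (word_map w x) - fst (word_map w y)\<bar> + \<bar>snd (word_map w x) - snd (word_map w y)\<bar>"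
    using sqrt_sum_squares_le_sum_abs by (simp add: dist_norm norm_prod_def)
  then show "dist (word_map w x) (word_map w y) \<le> 2 / 9 ^ length w"
    using 1 2 by simp
qed

lemma power_scale_small: "e > 0 \<Longrightarrow> \<exists>n. c / 9 ^ n < e" for c e :: real
proof -
  assume "e > 0"
  have "(\<lambda>n. c * (1 / 9) ^ n) \<longlonglongrightarrow> c * 0"
    by (intro tendsto_mult tendsto_const LIMSEQ_realpow_zero) auto
  then have "\<forall>\<^sub>F n in sequentially. c * (1 / 9) ^ n < e"
    using \<open>e > 0\<close> by (intro order_tendstoD(2)) auto
  then show ?thesis by (auto simp: eventually_sequentially power_divide)
qed

lemma K_closure: "closure all_vertices = K"
proof
  show "closure all_vertices \<subseteq> K"
    using all_vertices_in_K compact_imp_closed[OF K_compact] by (rule closure_minimal)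
  show "K \<subseteq> closure all_vertices"
  proof
    fix x assume x: "x \<in> K"
    show "x \<in> closure all_vertices"
      unfolding closure_approachable
    proof (intro allI impI)
      fix e :: real assume "e > 0"
      then obtain n where n: "2 / 9 ^ n < e" using power_scale_small by blast
      obtain w y where w: "w \<in> words I n" "y \<in> K" "x = word_map w y" using x K_words[of n] by blast
      have p: "(1/2, 1/2) \<in> corners" by (simp add: corners_def)
      have "word_map w (1/2, 1/2) \<in> all_vertices"
        unfolding all_vertices_def using cell_corner_vertex[OF w(1) p] by blast
      moreover have "dist (word_map w (1/2, 1/2)) x \<le> 2 / 9 ^ n"
        using cell_diameter(3)[of "(1/2, 1/2)" y w] w K_subset_square corners_subset_square p
        by (auto simp: words_def)
      ultimately show "\<exists>y\<in>all_vertices. dist y x < e" using n by force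
    qed
  qed
qed

lemma word_map_all_vertices:
  assumes "x \<in> all_vertices"
  obtains w y where "w \<in> words I m" "y \<in> all_vertices" "x = word_map w y"
proof -
  obtain n where "x \<in> vertices I n" using assms unfolding all_vertices_def by blast
  then have "x \<in> vertices I (m + n)" using vertices_mono[of n "m + n"] by auto
  then obtain w y where "w \<in> words I m" "y \<in> vertices I n" "x = word_map w y"
    unfolding vertices_add by blast
  then show ?thesis using that unfolding all_vertices_def by blast
qed

text \<open>Vertices at distance less than \<open>1/9\<^sup>m\<close> lie in the same \<open>m\<close>-cell or in two with a common corner, and
  on \<open>m\<close>-cells the oscillation is small.\<close>

lemma finite_energy_uniformly_continuous:
  assumes sys: "leg_system r s M" and B: "\<And>n. net_energy I r s n u \<le> B"
  shows "uniformly_continuous_on all_vertices u"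
  unfolding uniformly_continuous_on_def
proof (intro allI impI)
  fix e :: real assume e: "e > 0"
  have "(\<lambda>m. 40 * sqrt (M * (1 / 8) ^ m * B)) \<longlonglongrightarrow> 40 * sqrt (M * 0 * B)"
    by (intro tendsto_intros LIMSEQ_realpow_zero) auto
  then have "\<forall>\<^sub>F m in sequentially. 40 * sqrt (M * (1 / 8) ^ m * B) < e"
    using e by (intro order_tendstoD(2)) auto
  then obtain m where m: "40 * sqrt (M / 8 ^ m * B) < e"
    by (auto simp: eventually_sequentially power_divide)
  show "\<exists>d>0. \<forall>x\<in>all_vertices. \<forall>x'\<in>all_vertices. dist x' x < d \<longrightarrow> dist (u x') (u x) < e"
  proof (intro exI[of _ "1 / 9 ^ m"] conjI ballI impI)
    show "(0::real) < 1 / 9 ^ m" by simp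
    fix x x' assume x: "x \<in> all_vertices" "x' \<in> all_vertices" and d: "dist x' x < 1 / 9 ^ m"
    obtain w y where w: "w \<in> words I m" "y \<in> all_vertices" "x = word_map w y"
      using word_map_all_vertices[OF x(1)] .
    obtain w' y' where w': "w' \<in> words I m" "y' \<in> all_vertices" "x' = word_map w' y'"
      using word_map_all_vertices[OF x(2)] .
    have sq: "y \<in> square" "y' \<in> square"
      using w(2) w'(2) all_vertices_in_K K_subset_square by auto
    have "\<bar>fst (word_map w' y') - fst (word_map w y)\<bar> < 1 / 9 ^ m" "\<bar>snd (word_map w' y') - snd (word_map w y)\<bar> < 1 / 9 ^ m"
      using d dist_fst_le[of x' x] dist_snd_le[of x' x] unfolding w w' dist_real_def by linarith+
    then obtain p q where pq: "p \<in> corners" "q \<in> corners" "word_map w' p = word_map w q"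
      using close_cells_share_corner[OF w'(1) w(1) sq(2,1)] by blast
    have "p \<in> (\<Union>n. vertices I n)" "q \<in> (\<Union>n. vertices I n)"
      using pq by (metis UN_iff UNIV_I vertices.simps(1))+
    note pq_all = this
    have "\<bar>u (word_map w' y') - u (word_map w' p)\<bar> \<le> 20 * sqrt (M / 8 ^ m * B)"
      by (rule cell_osc_bound[OF sys B w'(1)]) (use w'(2) pq_all in \<open>auto simp: all_vertices_def\<close>)
    moreover have "\<bar>u (word_map w q) - u (word_map w y)\<bar> \<le> 20 * sqrt (M / 8 ^ m * B)"
      by (rule cell_osc_bound[OF sys B w(1)]) (use w(2) pq_all in \<open>auto simp: all_vertices_def\<close>)
    ultimately show "dist (u x') (u x) < e"
      using m unfolding w w' dist_real_def pq(3) by linarith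
  qed
qed

lemma continuous_extension:
  assumes sys: "leg_system r s M" and B: "\<And>n. net_energy I r s n u \<le> B"
  obtains h where "continuous_on K h" "\<And>x. x \<in> all_vertices \<Longrightarrow> h x = u x"
proof -
  obtain h where "uniformly_continuous_on (closure all_vertices) h" "\<And>x. x \<in> all_vertices \<Longrightarrow> u x = h x"
    by (rule uniformly_continuous_on_extension_on_closure[OF finite_energy_uniformly_continuous[OF sys B]]) blast
  then show ?thesis
    using that uniformly_continuous_imp_continuous unfolding K_closure by metis
qed

text \<open>Minimisers of consecutive levels, each extending the one before, define a function on all vertices
  that keeps the energy of the initial data.\<close>

lemma harmonic_extension:
  assumes sys: "leg_system r s M"
  obtains h where "continuous_on K h" "\<And>x. x \<in> vertices I m \<Longrightarrow> h x = u x"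
    "\<And>n. net_energy I r s (m + n) h = net_energy I r s m u"
proof -
  let ?P = "\<lambda>k v v'. (\<forall>x\<in>vertices I (m + k). v' x = v x) \<and>
      net_energy I r s (Suc (m + k)) v' = net_energy I r s (m + k) v"
  define S where "S k v = (SOME v'. ?P k v v')" for k v
  have P: "?P k v (S k v)" for k v
  proof -
    obtain v' where "\<And>x. x \<in> vertices I (m + k) \<Longrightarrow> v' x = v x"
      "net_energy I r s (Suc (m + k)) v' = net_energy I r s (m + k) v"
      by (rule harmonic_step[OF sys, of "m + k" v]) (rule that)
    then have "?P k v v'" by (intro conjI ballI)
    then show ?thesis unfolding S_def by (rule someI[where P = "?P k v"])
  qed
  have S: "\<And>k v x. x \<in> vertices I (m + k) \<Longrightarrow> S k v x = v x"
    "\<And>k v. net_energy I r s (Suc (m + k)) (S k v) = net_energy I r s (m + k) v"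
    using P by blast+
  define f where "f = rec_nat u S"
  have f: "f 0 = u" "f (Suc k) = S k (f k)" for k by (simp_all add: f_def)
  have stable: "f j x = f k x" if "x \<in> vertices I (m + k)" "k \<le> j" for j k x
    using that(2)
  proof (induction j rule: dec_induct)
    case (step j)
    have "x \<in> vertices I (m + j)" using that(1) vertices_mono[of "m + k" "m + j"] step(1) by auto
    then show ?case using S(1) step(3) f(2) by simp
  qed simp
  have en: "net_energy I r s (m + k) (f k) = net_energy I r s m u" for k
    by (induction k) (use S(2) f in auto)
  define h0 where "h0 x = f (LEAST k. x \<in> vertices I (m + k)) x" for x
  have h0: "h0 x = f k x" if "x \<in> vertices I (m + k)" for k x
    unfolding h0_def
    using stable[of x "LEAST k. x \<in> vertices I (m + k)" k] that
      LeastI[of "\<lambda>k. x \<in> vertices I (m + k)" k] Least_le[of "\<lambda>k. x \<in> vertices I (m + k)" k]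
    by simp
  have en0: "net_energy I r s (m + n) h0 = net_energy I r s m u" for n
    unfolding en[of n, symmetric] by (rule net_energy_cong) (rule h0)
  have "net_energy I r s n h0 \<le> net_energy I r s m u" for n
    using net_energy_level_mono[OF sys, of n "m + n" h0] en0[of n] by simp
  then obtain h where h: "continuous_on K h" "\<And>x. x \<in> all_vertices \<Longrightarrow> h x = h0 x"
    using continuous_extension[OF sys] by blast
  have hh: "h x = h0 x" if "x \<in> vertices I n" for n x
    using h(2) that unfolding all_vertices_def by blast
  show ?thesis
  proof
    show "continuous_on K h" by (rule h)
    show "h x = u x" if "x \<in> vertices I m" for x
      using hh[OF that] h0[of x 0] that f(1) by simp
    show "net_energy I r s (m + n) h = net_energy I r s m u" for n
      unfolding en0[of n, symmetric] by (rule net_energy_cong) (rule hh)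
  qed
qed

text \<open>The energies of the single \<open>m\<close>-cells can only increase with the level. As their sum is constant
  for a harmonic function, so is each of them, and a cell whose corner values are equal keeps the
  energy zero.\<close>

lemma harmonic_constant:
  assumes sys: "leg_system r s M" and h: "continuous_on K h"
    and en: "\<And>n. net_energy I r s (m + n) h = net_energy I r s m h"
    and w: "w \<in> words I m" and c: "\<And>p. p \<in> corners \<Longrightarrow> h (word_map w p) = c" and y: "y \<in> K"
  shows "h (word_map w y) = c"
proof -
  let ?E = "\<lambda>v n. net_energy I (\<lambda>w. r (v @ w)) (\<lambda>w. s (v @ w)) n (h \<circ> word_map v)"
  have sh: "leg_system (\<lambda>w. r (v @ w)) (\<lambda>w. s (v @ w)) (M / 8 ^ length v)" for v
    by (rule leg_system_shift[OF sys])
  have le: "?E w n \<le> 0" for n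
  proof -
    have mono: "?E v 0 \<le> ?E v n" for v
      by (rule net_energy_level_mono[OF sh]) simp
    have "(\<Sum>v\<in>words I m. ?E v n) = (\<Sum>v\<in>words I m. ?E v 0)"
      using en[of n] en[of 0] unfolding net_energy_add by simp
    moreover have "(\<Sum>v\<in>words I m - {w}. ?E v 0) \<le> (\<Sum>v\<in>words I m - {w}. ?E v n)"
      by (intro sum_mono mono)
    moreover have "(\<Sum>v\<in>words I m. ?E v k) = ?E w k + (\<Sum>v\<in>words I m - {w}. ?E v k)" for k
      by (rule sum.remove) (use w in \<open>auto simp: finite_words\<close>)
    moreover have "?E w 0 = 0"
      unfolding net_energy_0 by (rule cell_energy_const[where k = c]) (simp add: c)
    ultimately show ?thesis by (simp del: net_energy_0)
  qed
  have c1: "(1/2, 1/2) \<in> corners" by (simp add: corners_def)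
  have c1v: "(1/2, 1/2) \<in> (\<Union>n. vertices I n)" using c1 by (metis UN_iff UNIV_I vertices.simps(1))
  have v: "h (word_map w x) = c" if "x \<in> all_vertices" for x
  proof -
    have "\<bar>(h \<circ> word_map w) x - (h \<circ> word_map w) (1/2, 1/2)\<bar> \<le> 20 * sqrt (M / 8 ^ length w * 0)"
      by (rule osc_bound[OF sh le _ c1v]) (use that in \<open>simp add: all_vertices_def\<close>)
    then show ?thesis using c[OF c1] by simp
  qed
  have wK: "word_map w ` K \<subseteq> K" using K_words[of m] w by blast
  have "continuous_on K (\<lambda>x. h (word_map w x))"
    by (rule continuous_on_compose2[OF h continuous_word_map wK])
  then have "continuous_on (closure all_vertices) (\<lambda>x. h (word_map w x))" unfolding K_closure .
  then show ?thesis
    using continuous_constant_on_closure[of all_vertices "\<lambda>x. h (word_map w x)" c] v y unfolding K_closure by blast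
qed

end

section \<open>Measures of full support\<close>

lemma full_support_witness:
  assumes \<nu>: "radon_full_support K \<nu>" and W: "open W" "W \<inter> K \<noteq> {}" and P: "AE x in \<nu>. P x"
  obtains x where "x \<in> W" "x \<in> K" "P x"
proof -
  have sets: "sets \<nu> = sets (restrict_space borel K)" and pos: "emeasure \<nu> (W \<inter> K) > 0"
    using \<nu> W unfolding radon_full_support_def by auto
  have space: "space \<nu> = K" using sets_eq_imp_space_eq[OF sets] by (simp add: space_restrict_space)
  obtain N where N: "{x \<in> space \<nu>. \<not> P x} \<subseteq> N" "emeasure \<nu> N = 0" "N \<in> sets \<nu>"
    using P by (rule AE_E)
  have "\<not> W \<inter> K \<subseteq> N"
    using emeasure_mono[of "W \<inter> K" N \<nu>] N pos by auto
  then obtain x where "x \<in> W" "x \<in> K" "x \<notin> N" by blast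
  then show ?thesis using that[of x] N(1) space by blast
qed

lemma radon_space: "radon_full_support K \<nu> \<Longrightarrow> space \<nu> = K"
  unfolding radon_full_support_def using sets_eq_imp_space_eq[of \<nu> "restrict_space borel K"]
  by (simp add: space_restrict_space)

lemma radon_continuous_measurable:
  fixes u :: "point \<Rightarrow> real"
  assumes "radon_full_support K \<nu>" "continuous_on K u"
  shows "u \<in> borel_measurable \<nu>"
proof -
  have "sets \<nu> = sets (restrict_space borel K)" using assms unfolding radon_full_support_def by auto
  from measurable_cong_sets[OF this refl] show ?thesis
    using borel_measurable_continuous_on_restrict[OF assms(2)] by blast
qed

lemma AE_eq_continuous:
  fixes u v :: "point \<Rightarrow> real"
  assumes \<nu>: "radon_full_support K \<nu>" and c: "continuous_on K u" "continuous_on K v"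
    and ae: "AE x in \<nu>. u x = v x" and x: "x \<in> K"
  shows "u x = v x"
proof (rule ccontr)
  assume ne: "u x \<noteq> v x"
  have "continuous_on K (\<lambda>x. u x - v x)" by (intro continuous_intros c)
  then obtain W where W: "open W" "W \<inter> K = (\<lambda>x. u x - v x) -` (- {0}) \<inter> K"
    unfolding continuous_on_open_invariant using open_Compl[OF closed_singleton[of "0::real"]] by metis
  have "W \<inter> K \<noteq> {}" using W ne x by auto
  then obtain y where "y \<in> W" "y \<in> K" "u y = v y"
    using full_support_witness[OF \<nu> W(1) _ ae] by blast
  then show False using W(2) by auto
qed

lemma AE_support_continuous:
  fixes u :: "point \<Rightarrow> real"
  assumes \<nu>: "radon_full_support K \<nu>" and c: "continuous_on K u" and x: "x \<in> K" "u x \<noteq> 0"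
  shows "x \<in> AE_support \<nu> u"
  unfolding AE_support_def radon_space[OF \<nu>]
proof (intro CollectI conjI x(1) allI impI notI)
  fix V assume V: "open V \<and> x \<in> V" and ae: "AE y in \<nu>. y \<in> V \<longrightarrow> u y = 0"
  obtain W where W: "open W" "W \<inter> K = u -` (- {0}) \<inter> K"
    using c unfolding continuous_on_open_invariant using open_Compl[OF closed_singleton[of "0::real"]] by metis
  have "open (V \<inter> W)" "(V \<inter> W) \<inter> K \<noteq> {}" using W V x by auto
  then obtain y where "y \<in> V \<inter> W" "y \<in> K" "y \<in> V \<longrightarrow> u y = 0"
    using full_support_witness[OF \<nu> _ _ ae] by blast
  then show False using W(2) by auto
qed

text \<open>The image of the geometric distribution under an enumeration of a countable dense set. For this
  atomic measure the density of the continuous functions is elementary: square-integrable functions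
  are approximated by functions that live on finitely many atoms, and these by sums of narrow tents.\<close>

lemma exists_full_support_measure:
  fixes K :: "point set"
  assumes K: "closed K" "K \<noteq> {}"
  obtains \<nu> where "radon_full_support K \<nu>"
    "\<And>f e. f \<in> square_integrable \<nu> \<Longrightarrow> e > 0 \<Longrightarrow>
      \<exists>g. continuous_on K g \<and> L2_norm \<nu> (\<lambda>x. f x - g x) < e"
proof -
  obtain T where T: "countable T" "T \<subseteq> K" "K \<subseteq> closure T" using separable .
  have "T \<noteq> {}" using T(3) K(2) by auto
  define e where "e = from_nat_into T"
  have e: "range e = T" unfolding e_def by (rule range_from_nat_into[OF \<open>T \<noteq> {}\<close> T(1)])
  define p where "p = geometric_pmf (1 / 2)"
  have supp: "set_pmf p = UNIV" unfolding p_def by (rule set_pmf_geometric) auto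
  define \<nu> where "\<nu> = distr (measure_pmf p) (restrict_space borel K) e"
  have meas: "e \<in> measurable (measure_pmf p) (restrict_space borel K)"
    using e T(2) by (auto simp: space_restrict_space)
  have sets: "sets \<nu> = sets (restrict_space borel K)" unfolding \<nu>_def by simp
  have "prob_space \<nu>" unfolding \<nu>_def by (rule prob_space.prob_space_distr[OF prob_space_measure_pmf meas])
  then have fin: "finite_measure \<nu>" by (rule prob_space.finite_measure)
  have radon: "radon_full_support K \<nu>"
    unfolding radon_full_support_def
  proof (intro conjI allI impI sets fin)
    fix W :: "point set" assume W: "open W \<and> W \<inter> K \<noteq> {}"
    then have "W \<inter> closure T \<noteq> {}" using T(3) by auto
    then have "W \<inter> T \<noteq> {}" using W by (simp add: open_Int_closure_eq_empty)
    then obtain n where n: "e n \<in> W" using e by blast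
    have WK: "W \<inter> K \<in> sets (restrict_space borel K)"
      using W K by (subst sets_restrict_space_iff) auto
    have "0 < emeasure (measure_pmf p) {n}"
      using supp by (simp add: emeasure_pmf_single pmf_positive)
    also have "\<dots> \<le> emeasure (measure_pmf p) (e -` (W \<inter> K) \<inter> space (measure_pmf p))"
      by (rule emeasure_mono) (use n e T(2) in auto)
    also have "\<dots> = emeasure \<nu> (W \<inter> K)"
      unfolding \<nu>_def by (rule emeasure_distr[OF meas WK, symmetric])
    finally show "0 < emeasure \<nu> (W \<inter> K)" .
  qed
  have int: "(LINT x|\<nu>. f x) = (LINT n|measure_pmf p. f (e n))" if "f \<in> borel_measurable \<nu>" for f :: "point \<Rightarrow> real"
    unfolding \<nu>_def by (rule integral_distr[OF meas]) (use that in \<open>simp add: measurable_cong_sets[OF sets refl]\<close>)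
  have intg: "integrable \<nu> f \<longleftrightarrow> integrable (measure_pmf p) (\<lambda>n. f (e n))" if "f \<in> borel_measurable \<nu>" for f :: "point \<Rightarrow> real"
    unfolding \<nu>_def by (rule integrable_distr_eq[OF meas]) (use that in \<open>simp add: measurable_cong_sets[OF sets refl]\<close>)
  show ?thesis
  proof (rule that[OF radon])
    fix f :: "point \<Rightarrow> real" and \<epsilon> :: real assume f: "f \<in> square_integrable \<nu>" and \<epsilon>: "\<epsilon> > 0"
    have fm: "f \<in> borel_measurable \<nu>" and fi: "integrable (measure_pmf p) (\<lambda>n. (f (e n))\<^sup>2)"
      using f intg[of "\<lambda>x. (f x)\<^sup>2"] unfolding square_integrable_def by auto
    define F where "F N x = (if x \<in> e ` {..<N} then f x else 0)" for N x
    have "(\<lambda>N. LINT n|measure_pmf p. (f (e n) - F N (e n))\<^sup>2) \<longlonglongrightarrow> (LINT n|measure_pmf p. 0)"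
    proof (rule integral_dominated_convergence[OF _ _ fi])
      show "AE n in measure_pmf p. (\<lambda>N. (f (e n) - F N (e n))\<^sup>2) \<longlonglongrightarrow> 0"
      proof (rule AE_I2)
        fix n
        have "\<forall>\<^sub>F N in sequentially. (f (e n) - F N (e n))\<^sup>2 = 0"
          using eventually_gt_at_top[of n] by eventually_elim (auto simp: F_def)
        then show "(\<lambda>N. (f (e n) - F N (e n))\<^sup>2) \<longlonglongrightarrow> 0" by (rule tendsto_eventually)
      qed
      show "AE n in measure_pmf p. norm ((f (e n) - F N (e n))\<^sup>2) \<le> (f (e n))\<^sup>2" for N
        by (rule AE_I2) (auto simp: F_def)
    qed auto
    then have "\<forall>\<^sub>F N in sequentially. (LINT n|measure_pmf p. (f (e n) - F N (e n))\<^sup>2) < \<epsilon>\<^sup>2 / 8"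
      using \<epsilon> by (intro order_tendstoD(2)) auto
    then obtain N where N: "(LINT n|measure_pmf p. (f (e n) - F N (e n))\<^sup>2) < \<epsilon>\<^sup>2 / 8"
      by (auto simp: eventually_sequentially)
    define P where "P = e ` {..<N}"
    have P: "finite P" unfolding P_def by simp
    define g where "g j x = (\<Sum>t\<in>P. f t * max 0 (1 - real j * dist x t))" for j x
    have gF: "(\<lambda>j. g j x) \<longlonglongrightarrow> F N x" for x
    proof -
      have bump: "(\<lambda>j. f t * max 0 (1 - real j * dist x t)) \<longlonglongrightarrow> (if t = x then f t else 0)" for t
      proof (cases "t = x")
        case False
        then obtain j0 where j0: "1 < real j0 * dist x t" using reals_Archimedean3[of "dist x t"] by auto
        have "\<forall>\<^sub>F j in sequentially. f t * max 0 (1 - real j * dist x t) = 0"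
          using eventually_ge_at_top[of j0]
        proof eventually_elim
          case (elim j)
          have "real j0 * dist x t \<le> real j * dist x t" using elim by (intro mult_right_mono) auto
          then show ?case using j0 by simp
        qed
        then show ?thesis using False by (simp add: tendsto_eventually)
      qed simp
      have "(\<lambda>j. g j x) \<longlonglongrightarrow> (\<Sum>t\<in>P. if t = x then f t else 0)"
        unfolding g_def by (intro tendsto_sum bump)
      then show ?thesis using P by (simp add: F_def P_def)
    qed
    define C where "C = (\<Sum>t\<in>P. \<bar>f t\<bar>)"
    have gb: "\<bar>g j x\<bar> \<le> C" for j x
      unfolding g_def C_def
    proof (rule order_trans[OF sum_abs sum_mono])
      fix t
      have "\<bar>max 0 (1 - real j * dist x t)\<bar> \<le> 1" by (simp add: max_def)
      then show "\<bar>f t * max 0 (1 - real j * dist x t)\<bar> \<le> \<bar>f t\<bar>"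
        unfolding abs_mult by (rule mult_left_le) simp
    qed
    have Fb: "\<bar>F N x\<bar> \<le> C" for x
      by (rule LIMSEQ_le_const2[OF tendsto_rabs[OF gF]]) (use gb in blast)
    have Fg: "norm ((F N x - g j x)\<^sup>2) \<le> (2 * C)\<^sup>2" for j x
    proof -
      have "\<bar>F N x - g j x\<bar> \<le> \<bar>2 * C\<bar>" using Fb[of x] gb[of j x] by linarith
      then show ?thesis by (simp only: real_norm_def abs_power2 abs_le_square_iff)
    qed
    have "(\<lambda>j. LINT n|measure_pmf p. (F N (e n) - g j (e n))\<^sup>2) \<longlonglongrightarrow> (LINT n|measure_pmf p. 0)"
    proof (rule integral_dominated_convergence[where w = "\<lambda>_. (2 * C)\<^sup>2"])
      show "AE n in measure_pmf p. (\<lambda>j. (F N (e n) - g j (e n))\<^sup>2) \<longlonglongrightarrow> 0"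
      proof (rule AE_I2)
        fix n
        have "(\<lambda>j. (F N (e n) - g j (e n))\<^sup>2) \<longlonglongrightarrow> (F N (e n) - F N (e n))\<^sup>2"
          by (intro tendsto_intros gF)
        then show "(\<lambda>j. (F N (e n) - g j (e n))\<^sup>2) \<longlonglongrightarrow> 0" by simp
      qed
      show "AE n in measure_pmf p. norm ((F N (e n) - g j (e n))\<^sup>2) \<le> (2 * C)\<^sup>2" for j
        by (rule AE_I2) (rule Fg)
    qed auto
    then have "\<forall>\<^sub>F j in sequentially. (LINT n|measure_pmf p. (F N (e n) - g j (e n))\<^sup>2) < \<epsilon>\<^sup>2 / 8"
      using \<epsilon> by (intro order_tendstoD(2)) auto
    then obtain j where j: "(LINT n|measure_pmf p. (F N (e n) - g j (e n))\<^sup>2) < \<epsilon>\<^sup>2 / 8"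
      by (auto simp: eventually_sequentially)
    have gc: "continuous_on K (g j)" unfolding g_def by (intro continuous_intros)
    have gm: "g j \<in> borel_measurable \<nu>" by (rule radon_continuous_measurable[OF radon gc])
    have i1: "integrable (measure_pmf p) (\<lambda>n. (f (e n) - F N (e n))\<^sup>2)"
      by (rule Bochner_Integration.integrable_bound[OF fi]) (auto simp: F_def)
    have i2: "integrable (measure_pmf p) (\<lambda>n. (F N (e n) - g j (e n))\<^sup>2)"
      by (rule measure_pmf.integrable_const_bound[where B = "(2 * C)\<^sup>2"]) (rule AE_I2, rule Fg, simp)
    have sq: "(a - b)\<^sup>2 \<le> 2 * (a - c)\<^sup>2 + 2 * (c - b)\<^sup>2" for a b c :: real
      using sum_squares_ge_zero[of "a - 2 * c + b" 0] by (simp add: power2_eq_square algebra_simps)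
    have "(LINT x|\<nu>. (f x - g j x)\<^sup>2) = (LINT n|measure_pmf p. (f (e n) - g j (e n))\<^sup>2)"
      by (rule int) (use fm gm in measurable)
    also have "\<dots> \<le> (LINT n|measure_pmf p. 2 * (f (e n) - F N (e n))\<^sup>2 + 2 * (F N (e n) - g j (e n))\<^sup>2)"
    proof (rule integral_mono)
      show i3: "integrable (measure_pmf p) (\<lambda>n. 2 * (f (e n) - F N (e n))\<^sup>2 + 2 * (F N (e n) - g j (e n))\<^sup>2)"
        using i1 i2 by auto
      show "integrable (measure_pmf p) (\<lambda>n. (f (e n) - g j (e n))\<^sup>2)"
        by (rule Bochner_Integration.integrable_bound[OF i3]) (auto intro!: AE_I2 order_trans[OF sq])
    qed (rule sq)
    also have "\<dots> = 2 * (LINT n|measure_pmf p. (f (e n) - F N (e n))\<^sup>2) + 2 * (LINT n|measure_pmf p. (F N (e n) - g j (e n))\<^sup>2)"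
      using i1 i2 by simp
    also have "\<dots> < \<epsilon>\<^sup>2" using N j zero_less_power[OF \<epsilon>, of 2] by linarith
    finally have "L2_norm \<nu> (\<lambda>x. f x - g j x) < \<epsilon>"
      unfolding L2_norm_def using \<epsilon> by (simp add: real_less_lsqrt)
    then show "\<exists>g. continuous_on K g \<and> L2_norm \<nu> (\<lambda>x. f x - g x) < \<epsilon>" using gc by blast
  qed
qed

section \<open>The limit form\<close>

definition star_bilinear :: "real \<Rightarrow> real \<Rightarrow> (point \<Rightarrow> real) \<Rightarrow> (point \<Rightarrow> real) \<Rightarrow> real" where
  "star_bilinear r s u v = (let d = (\<lambda>p q. (u p - u q) * (v p - v q));
      p1 = (-1/2, -1/2); p2 = (1/2, -1/2); p3 = (1/2, 1/2); p4 = (-1/2, 1/2) in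
     (s / r * d p1 p3 + r / s * d p2 p4 + d p1 p2 + d p2 p3 + d p3 p4 + d p4 p1) / (2 * (r + s)))"

text \<open>The limit form is defined by polarisation. The explicit bilinear form of a cell makes it a limit of
  bilinear forms.\<close>

lemma star_bilinear_polarization:
  "cell_energy r s (\<lambda>x. u x + v x) - cell_energy r s (\<lambda>x. u x - v x) = 4 * star_bilinear r s u v"
proof -
  have e: "(a + b - (c + d))\<^sup>2 = (a - b - (c - d))\<^sup>2 + 4 * ((a - c) * (b - d))" for a b c d :: real
    by (simp add: power2_eq_square algebra_simps)
  show ?thesis
    unfolding cell_energy_def star_energy_def star_bilinear_def Let_def e
    by (simp add: diff_divide_distrib[symmetric] distrib_left add_divide_distrib mult_ac)
qed

lemma star_bilinear_diag: "star_bilinear r s u u = cell_energy r s u"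
  unfolding cell_energy_def star_energy_def star_bilinear_def Let_def by (simp add: power2_eq_square)

lemma star_bilinear_commute: "star_bilinear r s u v = star_bilinear r s v u"
  unfolding star_bilinear_def Let_def by (simp add: mult.commute)

lemma star_bilinear_linear:
  "star_bilinear r s (\<lambda>x. a * u x + b * v x) w = a * star_bilinear r s u w + b * star_bilinear r s v w"
proof -
  have e: "(a * x + b * y - (a * x' + b * y')) * z = a * ((x - x') * z) + b * ((y - y') * z)" for x x' y y' z :: real
    by (simp add: algebra_simps)
  have f: "c * (a * x + b * y) = a * (c * x) + b * (c * y)" for c x y :: real by (simp add: algebra_simps)
  have g: "a * (x / k) + b * (y / k) = (a * x + b * y) / k" for k x y :: real by (simp add: add_divide_distrib)
  show ?thesis
    unfolding star_bilinear_def Let_def e f g by (simp only: distrib_left add_ac)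
qed

lemma square_combination: "(a * x + b * y)\<^sup>2 \<le> 2 * a\<^sup>2 * x\<^sup>2 + 2 * b\<^sup>2 * y\<^sup>2" for a b x y :: real
  using zero_le_power2[of "a * x - b * y"] by (simp add: power2_eq_square algebra_simps)

locale eyebolted_form = eyebolted_fractal +
  fixes r s :: "index list \<Rightarrow> real" and M :: real
  assumes sys: "leg_system r s M"
begin

abbreviation conduct :: conductance where "conduct \<equiv> network_conductance r s"
abbreviation E :: "nat \<Rightarrow> (point \<Rightarrow> real) \<Rightarrow> real" where "E \<equiv> net_energy I r s"
abbreviation lim_energy :: "(point \<Rightarrow> real) \<Rightarrow> ereal" where "lim_energy \<equiv> limit_energy I conduct"
abbreviation \<F> :: "(point \<Rightarrow> real) set" where "\<F> \<equiv> energy_domain I K conduct"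
abbreviation form :: "(point \<Rightarrow> real) \<Rightarrow> (point \<Rightarrow> real) \<Rightarrow> real" where "form \<equiv> energy_form I conduct"

definition total :: "(point \<Rightarrow> real) \<Rightarrow> real" where
  "total u = real_of_ereal (lim_energy u)"

lemma E_incseq: "incseq (\<lambda>n. E n u)"
  unfolding incseq_def using net_energy_level_mono[OF sys] by blast

lemma limit_energy_tendsto: "(\<lambda>n. ereal (E n u)) \<longlonglongrightarrow> lim_energy u"
proof -
  have "incseq (\<lambda>n. ereal (E n u))" using E_incseq by (auto simp: incseq_def)
  then have "(\<lambda>n. ereal (E n u)) \<longlonglongrightarrow> (SUP n. ereal (E n u))" by (rule LIMSEQ_SUP)
  then show ?thesis unfolding limit_energy_def energy_net using limI by metis
qed

lemma limit_energy_ge: "ereal (E n u) \<le> lim_energy u"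
proof (rule LIMSEQ_le_const[OF limit_energy_tendsto])
  show "\<exists>N. \<forall>m\<ge>N. ereal (E n u) \<le> ereal (E m u)"
    using E_incseq[of u] by (auto simp: incseq_def)
qed

lemma limit_energy_le: "(\<And>n. E n u \<le> B) \<Longrightarrow> lim_energy u \<le> ereal B"
  by (rule LIMSEQ_le_const2[OF limit_energy_tendsto]) auto

lemma limit_energy_finite:
  assumes "lim_energy u < \<infinity>"
  shows "lim_energy u = ereal (total u)"
proof -
  have "ereal (E 0 u) \<le> lim_energy u" by (rule limit_energy_ge)
  then have "lim_energy u \<noteq> - \<infinity>" by auto
  then show ?thesis using assms unfolding total_def by (cases "lim_energy u") auto
qed

lemma domI:
  assumes "continuous_on K u" "\<And>n. E n u \<le> B"
  shows "u \<in> \<F>" "total u \<le> B"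
proof -
  have le: "lim_energy u \<le> ereal B" by (rule limit_energy_le[OF assms(2)])
  then have fin: "lim_energy u < \<infinity>" using le_less_trans by fastforce
  show "u \<in> \<F>" using assms(1) fin unfolding energy_domain_def by blast
  show "total u \<le> B" using le unfolding limit_energy_finite[OF fin] by simp
qed

lemma dom_continuous: "u \<in> \<F> \<Longrightarrow> continuous_on K u"
  unfolding energy_domain_def by blast

lemma dom_limit: "u \<in> \<F> \<Longrightarrow> lim_energy u = ereal (total u)"
  unfolding energy_domain_def using limit_energy_finite by blast

lemma E_le_total: "u \<in> \<F> \<Longrightarrow> E n u \<le> total u"
  using limit_energy_ge[of n u] by (simp add: dom_limit)

lemma E_tendsto_total: "u \<in> \<F> \<Longrightarrow> (\<lambda>n. E n u) \<longlonglongrightarrow> total u"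
  using limit_energy_tendsto[of u] by (simp add: dom_limit)

lemma total_nonneg: "u \<in> \<F> \<Longrightarrow> total u \<ge> 0"
  using E_le_total[of u 0] net_energy_nonneg[OF sys, of I 0 u] by linarith

lemma vertices_K: "x \<in> vertices I n \<Longrightarrow> x \<in> K"
  using vertices_in_K by blast

lemma E_lincomb: "E n (\<lambda>x. a * u x + b * v x) \<le> 2 * a\<^sup>2 * E n u + 2 * b\<^sup>2 * E n v"
proof (rule net_energy_mono[OF sys])
  fix x y
  show "(a * u x + b * v x - (a * u y + b * v y))\<^sup>2 \<le> 2 * a\<^sup>2 * (u x - u y)\<^sup>2 + 2 * b\<^sup>2 * (v x - v y)\<^sup>2"
    using square_combination[of a "u x - u y" b "v x - v y"] by (simp add: algebra_simps)
qed

lemma dom_lincomb: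
  assumes "u \<in> \<F>" "v \<in> \<F>" shows "(\<lambda>x. a * u x + b * v x) \<in> \<F>"
proof (rule domI(1))
  show "continuous_on K (\<lambda>x. a * u x + b * v x)" by (intro continuous_intros dom_continuous assms)
  fix n
  have "E n (\<lambda>x. a * u x + b * v x) \<le> 2 * a\<^sup>2 * E n u + 2 * b\<^sup>2 * E n v" by (rule E_lincomb)
  also have "\<dots> \<le> 2 * a\<^sup>2 * total u + 2 * b\<^sup>2 * total v"
    by (intro add_mono mult_left_mono E_le_total assms) auto
  finally show "E n (\<lambda>x. a * u x + b * v x) \<le> 2 * a\<^sup>2 * total u + 2 * b\<^sup>2 * total v" .
qed

lemma dom_add: "u \<in> \<F> \<Longrightarrow> v \<in> \<F> \<Longrightarrow> (\<lambda>x. u x + v x) \<in> \<F>"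
  and dom_diff: "u \<in> \<F> \<Longrightarrow> v \<in> \<F> \<Longrightarrow> (\<lambda>x. u x - v x) \<in> \<F>"
  using dom_lincomb[of u v 1 1] dom_lincomb[of u v 1 "-1"] by simp_all

lemma E_const: "E n (\<lambda>x. c) = 0"
  unfolding net_energy_def by (simp add: cell_energy_const)

lemma dom_const: "(\<lambda>x. c) \<in> \<F>"
  by (rule domI(1)[where B = 0]) (auto simp: E_const)

text \<open>The difference \<open>u x * v x - u y * v y\<close> equals \<open>u x * (v x - v y) + v y * (u x - u y)\<close>, and \<open>u\<close>, \<open>v\<close> are
  bounded.\<close>

lemma dom_mult:
  assumes u: "u \<in> \<F>" and v: "v \<in> \<F>" shows "(\<lambda>x. u x * v x) \<in> \<F>"
proof -
  have "bounded (u ` K)" "bounded (v ` K)"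
    using dom_continuous u v K_compact by (auto intro!: compact_imp_bounded compact_continuous_image)
  then obtain A B where A: "\<And>x. x \<in> K \<Longrightarrow> \<bar>u x\<bar> \<le> A" and B: "\<And>x. x \<in> K \<Longrightarrow> \<bar>v x\<bar> \<le> B"
    unfolding bounded_iff by (metis imageI real_norm_def)
  show ?thesis
  proof (rule domI(1))
    show "continuous_on K (\<lambda>x. u x * v x)" by (intro continuous_intros dom_continuous u v)
    fix n
    have "E n (\<lambda>x. u x * v x) \<le> 2 * A\<^sup>2 * E n v + 2 * B\<^sup>2 * E n u"
    proof (rule net_energy_mono[OF sys])
      fix x y assume "x \<in> vertices I n" "y \<in> vertices I n"
      then have xy: "x \<in> K" "y \<in> K" using vertices_K by auto
      have "(u x * v x - u y * v y)\<^sup>2 = (u x * (v x - v y) + v y * (u x - u y))\<^sup>2"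
        by (simp add: algebra_simps)
      also have "\<dots> \<le> 2 * (u x)\<^sup>2 * (v x - v y)\<^sup>2 + 2 * (v y)\<^sup>2 * (u x - u y)\<^sup>2"
        by (rule square_combination)
      also have "\<dots> \<le> 2 * A\<^sup>2 * (v x - v y)\<^sup>2 + 2 * B\<^sup>2 * (u x - u y)\<^sup>2"
      proof -
        have "(u x)\<^sup>2 \<le> A\<^sup>2" "(v y)\<^sup>2 \<le> B\<^sup>2"
          using power_mono[OF A[OF xy(1)], of 2] power_mono[OF B[OF xy(2)], of 2] by auto
        then show ?thesis by (intro add_mono mult_right_mono) auto
      qed
      finally show "(u x * v x - u y * v y)\<^sup>2 \<le> 2 * A\<^sup>2 * (v x - v y)\<^sup>2 + 2 * B\<^sup>2 * (u x - u y)\<^sup>2" .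
    qed
    also have "\<dots> \<le> 2 * A\<^sup>2 * total v + 2 * B\<^sup>2 * total u"
      by (intro add_mono mult_left_mono E_le_total u v) auto
    finally show "E n (\<lambda>x. u x * v x) \<le> 2 * A\<^sup>2 * total v + 2 * B\<^sup>2 * total u" .
  qed
qed

definition E_bilinear :: "nat \<Rightarrow> (point \<Rightarrow> real) \<Rightarrow> (point \<Rightarrow> real) \<Rightarrow> real" where
  "E_bilinear n u v = (\<Sum>w\<in>words I n. star_bilinear (r w) (s w) (u \<circ> word_map w) (v \<circ> word_map w))"

lemma E_polarization: "E n (\<lambda>x. u x + v x) - E n (\<lambda>x. u x - v x) = 4 * E_bilinear n u v"
  unfolding net_energy_def E_bilinear_def sum_subtractf[symmetric] sum_distrib_left
  by (rule sum.cong) (simp_all add: comp_def star_bilinear_polarization)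

lemma E_bilinear_tendsto:
  assumes "u \<in> \<F>" "v \<in> \<F>" shows "(\<lambda>n. E_bilinear n u v) \<longlonglongrightarrow> form u v"
proof -
  have "(\<lambda>n. (E n (\<lambda>x. u x + v x) - E n (\<lambda>x. u x - v x)) / 4) \<longlonglongrightarrow> (total (\<lambda>x. u x + v x) - total (\<lambda>x. u x - v x)) / 4"
    by (intro tendsto_divide tendsto_diff tendsto_const E_tendsto_total dom_add dom_diff assms) simp
  then show ?thesis unfolding E_polarization energy_form_def total_def by simp
qed

lemma form_diag: "u \<in> \<F> \<Longrightarrow> form u u = total u"
proof -
  assume u: "u \<in> \<F>"
  have "E_bilinear n u u = E n u" for n
    unfolding net_energy_def E_bilinear_def by (simp add: star_bilinear_diag)
  then show ?thesis using E_bilinear_tendsto[OF u u] E_tendsto_total[OF u] LIMSEQ_unique by simp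
qed

lemma form_commute: "u \<in> \<F> \<Longrightarrow> v \<in> \<F> \<Longrightarrow> form u v = form v u"
proof -
  assume uv: "u \<in> \<F>" "v \<in> \<F>"
  have "E_bilinear n u v = E_bilinear n v u" for n
    unfolding E_bilinear_def by (simp add: star_bilinear_commute)
  then show ?thesis using E_bilinear_tendsto[OF uv] E_bilinear_tendsto[OF uv(2,1)] LIMSEQ_unique by simp
qed

lemma form_linear:
  assumes "u \<in> \<F>" "v \<in> \<F>" "w \<in> \<F>"
  shows "form (\<lambda>x. a * u x + b * v x) w = a * form u w + b * form v w"
proof -
  have "E_bilinear n (\<lambda>x. a * u x + b * v x) w = a * E_bilinear n u w + b * E_bilinear n v w" for n
    unfolding E_bilinear_def sum_distrib_left sum.distrib[symmetric]
    by (rule sum.cong) (simp_all add: comp_def star_bilinear_linear)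
  moreover have "(\<lambda>n. a * E_bilinear n u w + b * E_bilinear n v w) \<longlonglongrightarrow> a * form u w + b * form v w"
    by (intro tendsto_intros E_bilinear_tendsto assms)
  ultimately show ?thesis
    using E_bilinear_tendsto[OF dom_lincomb[OF assms(1,2), of a b] assms(3)] LIMSEQ_unique by simp
qed

lemma total_cong: "(\<And>x. x \<in> K \<Longrightarrow> u x = v x) \<Longrightarrow> lim_energy u = lim_energy v"
proof -
  assume "\<And>x. x \<in> K \<Longrightarrow> u x = v x"
  then have "E n u = E n v" for n by (intro net_energy_cong) (simp add: vertices_K)
  then show ?thesis unfolding limit_energy_def energy_net by simp
qed

lemma harmonic_extension_dom:
  obtains h where "h \<in> \<F>" "\<And>x. x \<in> vertices I m \<Longrightarrow> h x = u x"
    "\<And>n. E (m + n) h = E m u" "total h = E m u"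
proof -
  obtain h where h: "continuous_on K h" "\<And>x. x \<in> vertices I m \<Longrightarrow> h x = u x"
    "\<And>n. E (m + n) h = E m u"
    by (rule harmonic_extension[OF sys, of m u]) (rule that)
  have b: "E n h \<le> E m u" for n
    using net_energy_level_mono[OF sys, of n "m + n" h] h(3)[of n] by simp
  have "h \<in> \<F>" "total h \<le> E m u" using domI[OF h(1) b] by auto
  moreover from this have "E m u \<le> total h" using E_le_total[of h m] h(3)[of 0] by simp
  ultimately show ?thesis using that[OF _ h(2,3)] by simp
qed

text \<open>Let \<open>h\<close> be harmonic with the value \<open>1\<close> at the vertices of a fine level that are near \<open>x\<close> and \<open>0\<close> at the
  others. It is constant on the cell of \<open>x\<close> and on the cell of \<open>y\<close>.\<close>

lemma separation:
  assumes x: "x \<in> K" and y: "y \<in> K" and ne: "x \<noteq> y"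
  shows "\<exists>f\<in>\<F>. f x \<noteq> f y"
proof -
  have "\<bar>fst x - fst y\<bar> > 0 \<or> \<bar>snd x - snd y\<bar> > 0" using ne by (auto simp: prod_eq_iff)
  then obtain d where d: "d > 0" "\<bar>fst x - fst y\<bar> \<ge> d \<or> \<bar>snd x - snd y\<bar> \<ge> d" by blast
  obtain m where m: "2 / 9 ^ m < d" using power_scale_small[OF d(1)] by blast
  define near where "near v \<longleftrightarrow> \<bar>fst v - fst x\<bar> \<le> 1 / 9 ^ m \<and> \<bar>snd v - snd x\<bar> \<le> 1 / 9 ^ m" for v :: point
  obtain h where h: "h \<in> \<F>" "\<And>v. v \<in> vertices I m \<Longrightarrow> h v = (if near v then 1 else 0)"
    "\<And>n. E (m + n) h = E m (\<lambda>v. if near v then 1 else 0)"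
    using harmonic_extension_dom[of m "\<lambda>v. if near v then 1 else 0"] by metis
  have en: "E (m + n) h = E m h" for n using h(3)[of n] h(3)[of 0] by simp
  have const: "h z = c" if z: "z \<in> K" and c: "\<And>v. v \<in> vertices I m \<Longrightarrow>
      \<bar>fst v - fst z\<bar> \<le> 1 / 9 ^ m \<Longrightarrow> \<bar>snd v - snd z\<bar> \<le> 1 / 9 ^ m \<Longrightarrow> h v = c" for z c
  proof -
    obtain w z' where w: "w \<in> words I m" "z' \<in> K" "z = word_map w z'" using z K_words[of m] by blast
    have len: "length w = m" using w(1) by (simp add: words_def)
    have "h (word_map w z') = c"
    proof (rule harmonic_constant[OF sys dom_continuous[OF h(1)] en w(1) _ w(2)])
      fix p assume p: "p \<in> corners"
      have "p \<in> square" "z' \<in> square" using p w(2) corners_subset_square K_subset_square by auto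
      from cell_diameter(1,2)[OF this, of w] show "h (word_map w p) = c"
        using c[OF cell_corner_vertex[OF w(1) p]] unfolding w(3) len by blast
    qed
    then show ?thesis using w(3) by simp
  qed
  have "h x = 1" by (rule const[OF x]) (simp add: h(2) near_def)
  moreover have "h y = 0"
  proof (rule const[OF y])
    fix v assume v: "v \<in> vertices I m" "\<bar>fst v - fst y\<bar> \<le> 1 / 9 ^ m" "\<bar>snd v - snd y\<bar> \<le> 1 / 9 ^ m"
    have "\<not> near v"
    proof
      assume "near v"
      then have "\<bar>fst x - fst y\<bar> \<le> 1 / 9 ^ m + 1 / 9 ^ m" "\<bar>snd x - snd y\<bar> \<le> 1 / 9 ^ m + 1 / 9 ^ m"
        using v(2,3) unfolding near_def by linarith+
      then show False using d(2) m by simp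
    qed
    then show "h v = 0" using h(2)[OF v(1)] by simp
  qed
  ultimately show ?thesis using h(1) by (intro bexI[of _ h]) simp_all
qed

lemma dom_uniformly_dense:
  assumes "continuous_on K f" "e > 0"
  obtains g where "g \<in> \<F>" "\<And>x. x \<in> K \<Longrightarrow> \<bar>f x - g x\<bar> < e"
proof -
  interpret function_ring_on \<F> K
    by unfold_locales (auto intro: K_compact dom_continuous dom_add dom_mult dom_const separation)
  show ?thesis using Stone_Weierstrass_basic[OF assms] that by blast
qed

lemma osc_K:
  assumes u: "u \<in> \<F>" and x: "x \<in> K" and y: "y \<in> K"
  shows "\<bar>u x - u y\<bar> \<le> 20 * sqrt (M * total u)"
proof -
  have c: "continuous_on (closure all_vertices) u" unfolding K_closure by (rule dom_continuous[OF u])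
  have 1: "\<bar>u a - u b\<bar> \<le> 20 * sqrt (M * total u)" if "a \<in> all_vertices" "b \<in> all_vertices" for a b
    using osc_bound[OF sys E_le_total[OF u]] that unfolding all_vertices_def by blast
  have 2: "\<bar>u x - u b\<bar> \<le> 20 * sqrt (M * total u)" if b: "b \<in> all_vertices" for b
    by (rule continuous_le_on_closure[of all_vertices "\<lambda>x. \<bar>u x - u b\<bar>"])
      (use c 1[OF _ b] x K_closure in \<open>auto intro!: continuous_intros\<close>)
  show ?thesis
    by (rule continuous_le_on_closure[of all_vertices "\<lambda>y. \<bar>u x - u y\<bar>"])
      (use c 2 y K_closure in \<open>auto intro!: continuous_intros\<close>)
qed

lemma E_pointwise_tendsto:
  assumes "\<And>x. x \<in> vertices I n \<Longrightarrow> (\<lambda>k. f k x) \<longlonglongrightarrow> g x"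
  shows "(\<lambda>k. E n (f k)) \<longlonglongrightarrow> E n g"
proof -
  have "(\<lambda>k. cell_energy (r w) (s w) (f k \<circ> word_map w)) \<longlonglongrightarrow> cell_energy (r w) (s w) (g \<circ> word_map w)"
    if w: "w \<in> words I n" for w
  proof -
    have p: "(\<lambda>k. f k (word_map w p)) \<longlonglongrightarrow> g (word_map w p)" if "p \<in> corners" for p
      using assms cell_corner_vertex[OF w that] by blast
    show ?thesis
      unfolding cell_energy_def star_energy_def comp_def
      by (intro tendsto_intros p) (use leg_systemD[OF sys, of w] in \<open>auto simp: corners_def\<close>)
  qed
  then show ?thesis unfolding net_energy_def by (intro tendsto_sum)
qed

end

section \<open>The limit form is a local regular Dirichlet form\<close>

lemma square_sum_le: "(a + b)\<^sup>2 \<le> 2 * a\<^sup>2 + 2 * b\<^sup>2" for a b :: real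
  using square_combination[of 1 a 1 b] by simp

context eyebolted_form
begin

context
  fixes \<nu> :: "point measure"
  assumes \<nu>: "radon_full_support K \<nu>"
begin

lemma finite_nu: "finite_measure \<nu>"
  using \<nu> unfolding radon_full_support_def by auto

lemma mass_pos: "measure \<nu> K > 0"
proof -
  have "emeasure \<nu> (UNIV \<inter> K) > 0"
    using \<nu> K_nonempty unfolding radon_full_support_def by (metis Int_UNIV_left open_UNIV)
  then show ?thesis using finite_measure.emeasure_eq_measure[OF finite_nu] by simp
qed

lemma continuous_square_integrable:
  assumes "continuous_on K u" shows "u \<in> square_integrable \<nu>" "integrable \<nu> (\<lambda>x. (u x)\<^sup>2)"
proof -
  have c: "continuous_on K (\<lambda>x. (u x)\<^sup>2)" by (intro continuous_intros assms)
  then have "bounded ((\<lambda>x. (u x)\<^sup>2) ` K)"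
    using K_compact by (auto intro!: compact_imp_bounded compact_continuous_image)
  then obtain B where B: "\<And>x. x \<in> K \<Longrightarrow> norm ((u x)\<^sup>2) \<le> B" unfolding bounded_iff by blast
  show "integrable \<nu> (\<lambda>x. (u x)\<^sup>2)"
    by (rule finite_measure.integrable_const_bound[OF finite_nu, where B = B])
      (use B radon_space[OF \<nu>] radon_continuous_measurable[OF \<nu> c] in \<open>auto intro!: AE_I2\<close>)
  then show "u \<in> square_integrable \<nu>"
    unfolding square_integrable_def using radon_continuous_measurable[OF \<nu> assms] by blast
qed

lemma L2_norm_square: "(L2_norm \<nu> u)\<^sup>2 = (LINT x|\<nu>. (u x)\<^sup>2)"
  unfolding L2_norm_def by simp

lemma L2_norm_nonneg: "L2_norm \<nu> u \<ge> 0"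
  unfolding L2_norm_def by simp

lemma L2_norm_bound:
  assumes "continuous_on K u" "\<And>x. x \<in> K \<Longrightarrow> (u x)\<^sup>2 \<le> c"
  shows "(L2_norm \<nu> u)\<^sup>2 \<le> c * measure \<nu> K"
proof -
  have "(LINT x|\<nu>. (u x)\<^sup>2) \<le> (LINT x|\<nu>. c)"
    using assms(2) radon_space[OF \<nu>]
    by (intro integral_mono continuous_square_integrable assms(1)) (auto simp: finite_measure.integrable_const[OF finite_nu])
  then show ?thesis unfolding L2_norm_square by (simp add: radon_space[OF \<nu>] mult.commute)
qed

lemma form_norm_square:
  assumes "u \<in> \<F>" shows "(form_norm \<nu> form u)\<^sup>2 = total u + (L2_norm \<nu> u)\<^sup>2"
  using form_diag[OF assms] total_nonneg[OF assms] unfolding form_norm_def by simp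

lemma form_norm_nonneg:
  assumes "u \<in> \<F>" shows "form_norm \<nu> form u \<ge> 0"
  using form_diag[OF assms] total_nonneg[OF assms] unfolding form_norm_def by simp

definition sup_const :: real where "sup_const = 2 / measure \<nu> K + 800 * M"

text \<open>Average \<open>(u x)\<^sup>2 \<le> 2 * (u y)\<^sup>2 + 2 * (u x - u y)\<^sup>2\<close> over \<open>y\<close> and use that the oscillation of \<open>u\<close> is at
  most \<open>20 * sqrt (M * total u)\<close>; this explains the value of \<open>sup_const\<close>.\<close>

lemma sup_bound:
  assumes u: "u \<in> \<F>" and x: "x \<in> K"
  shows "(u x)\<^sup>2 \<le> sup_const * (form_norm \<nu> form u)\<^sup>2"
proof -
  let ?m = "measure \<nu> K"
  have M: "M > 0" by (rule leg_system_bound_pos[OF sys])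
  have t: "total u \<ge> 0" by (rule total_nonneg[OF u])
  have pt: "(u x)\<^sup>2 \<le> 2 * (u y)\<^sup>2 + 800 * M * total u" if y: "y \<in> K" for y
  proof -
    have "\<bar>u x - u y\<bar>\<^sup>2 \<le> (20 * sqrt (M * total u))\<^sup>2"
      by (rule power_mono[OF osc_K[OF u x y]]) simp
    then have "(u x - u y)\<^sup>2 \<le> 400 * (M * total u)" using M t by (simp add: power_mult_distrib)
    then show ?thesis using square_sum_le[of "u y" "u x - u y"] by simp
  qed
  have i: "integrable \<nu> (\<lambda>y. (u y)\<^sup>2)" by (rule continuous_square_integrable(2)[OF dom_continuous[OF u]])
  have c: "integrable \<nu> (\<lambda>y. k)" for k :: real by (rule finite_measure.integrable_const[OF finite_nu])
  have "(LINT y|\<nu>. (u x)\<^sup>2) \<le> (LINT y|\<nu>. 2 * (u y)\<^sup>2 + 800 * M * total u)"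
    by (rule integral_mono) (use i c pt radon_space[OF \<nu>] in auto)
  also have "\<dots> = 2 * (LINT y|\<nu>. (u y)\<^sup>2) + (LINT y|\<nu>. 800 * M * total u)"
    using i c by (subst Bochner_Integration.integral_add) auto
  finally have "?m * (u x)\<^sup>2 \<le> 2 * (L2_norm \<nu> u)\<^sup>2 + ?m * (800 * M * total u)"
    by (simp add: radon_space[OF \<nu>] L2_norm_square)
  then have "(u x)\<^sup>2 \<le> 2 / ?m * (L2_norm \<nu> u)\<^sup>2 + 800 * M * total u"
    using mass_pos by (simp add: field_simps)
  also have "\<dots> \<le> sup_const * (L2_norm \<nu> u)\<^sup>2 + sup_const * total u"
    unfolding sup_const_def using mass_pos M t by (intro add_mono mult_right_mono) auto
  also have "\<dots> = sup_const * (form_norm \<nu> form u)\<^sup>2"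
    unfolding form_norm_square[OF u] by (simp add: distrib_left)
  finally show ?thesis .
qed

lemma sup_const_pos: "sup_const > 0"
proof -
  have "2 / measure \<nu> K > 0" using mass_pos by simp
  then show ?thesis unfolding sup_const_def using leg_system_bound_pos[OF sys] by linarith
qed

text \<open>A Cauchy sequence in the form norm converges uniformly on \<open>K\<close>. The energies of each fixed level are
  continuous under pointwise convergence, so the bound for the energy of \<open>f n - f m\<close> passes to the
  limit \<open>m \<rightarrow> \<infinity>\<close> at every level, and then to the limit energy.\<close>

lemma form_complete:
  assumes f: "\<And>n. f n \<in> \<F>"
    and cauchy: "\<forall>e>0. \<exists>N. \<forall>m\<ge>N. \<forall>n\<ge>N. form_norm \<nu> form (\<lambda>x. f m x - f n x) < e"
  shows "\<exists>u\<in>\<F>. (\<lambda>n. form_norm \<nu> form (\<lambda>x. f n x - u x)) \<longlonglongrightarrow> 0"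
proof -
  let ?N = "\<lambda>m n. form_norm \<nu> form (\<lambda>x. f m x - f n x)"
  have fd: "(\<lambda>x. f m x - f n x) \<in> \<F>" for m n by (intro dom_diff f)
  have "uniformly_Cauchy_on K f"
  proof (rule uniformly_Cauchy_onI)
    fix e :: real assume e: "e > 0"
    define d where "d = e / sqrt sup_const"
    have d: "d > 0" "sup_const * d\<^sup>2 = e\<^sup>2" unfolding d_def using e sup_const_pos by (auto simp: power_divide)
    obtain N where N: "\<And>m n. m \<ge> N \<Longrightarrow> n \<ge> N \<Longrightarrow> ?N m n < d"
      using cauchy d(1) by blast
    have "dist (f m x) (f n x) < e" if "x \<in> K" "m \<ge> N" "n \<ge> N" for x m n
    proof -
      have "(f m x - f n x)\<^sup>2 \<le> sup_const * (?N m n)\<^sup>2"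
        by (rule sup_bound[OF fd that(1)])
      also have "\<dots> < sup_const * d\<^sup>2"
        using N[OF that(2,3)] form_norm_nonneg[OF fd] sup_const_pos
        by (intro mult_strict_left_mono power_strict_mono) auto
      finally have "\<bar>f m x - f n x\<bar>\<^sup>2 < e\<^sup>2" unfolding d(2) by simp
      then show ?thesis using e unfolding dist_real_def by (rule power2_less_imp_less[OF _ less_imp_le])
    qed
    then show "\<exists>N. \<forall>x\<in>K. \<forall>m\<ge>N. \<forall>n\<ge>N. dist (f m x) (f n x) < e" by blast
  qed
  then have "uniformly_convergent_on K f" by (rule Cauchy_uniformly_convergent)
  then obtain u where u: "uniform_limit K f u sequentially"
    unfolding uniformly_convergent_on_def by blast
  have uc: "continuous_on K u"
    by (rule uniform_limit_theorem[OF _ u]) (use dom_continuous[OF f] in auto)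
  have pt: "(\<lambda>n. f n x) \<longlonglongrightarrow> u x" if "x \<in> K" for x
    by (rule tendsto_uniform_limitI[OF u that])
  have close: "(\<lambda>x. f n x - u x) \<in> \<F> \<and> total (\<lambda>x. f n x - u x) \<le> e\<^sup>2 \<and> (\<forall>x\<in>K. (f n x - u x)\<^sup>2 \<le> sup_const * e\<^sup>2)"
    if N: "\<And>m n. m \<ge> N \<Longrightarrow> n \<ge> N \<Longrightarrow> ?N m n < e" and n: "n \<ge> N" for N n e
  proof -
    have fn: "(?N n m)\<^sup>2 \<le> e\<^sup>2" if "m \<ge> N" for m
      using N[OF n that] form_norm_nonneg[OF fd] by (intro power_mono) auto
    have "E k (\<lambda>x. f n x - u x) \<le> e\<^sup>2" for k
    proof (rule LIMSEQ_le_const2[OF E_pointwise_tendsto])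
      show "(\<lambda>m. f n x - f m x) \<longlonglongrightarrow> f n x - u x" if "x \<in> vertices I k" for x
        by (intro tendsto_intros pt vertices_K[OF that])
      have "E k (\<lambda>x. f n x - f m x) \<le> e\<^sup>2" if "m \<ge> N" for m
      proof -
        have "E k (\<lambda>x. f n x - f m x) \<le> total (\<lambda>x. f n x - f m x)" by (rule E_le_total[OF fd])
        also have "\<dots> \<le> (?N n m)\<^sup>2" unfolding form_norm_square[OF fd] by simp
        finally show ?thesis using fn[OF that] by simp
      qed
      then show "\<exists>N. \<forall>m\<ge>N. E k (\<lambda>x. f n x - f m x) \<le> e\<^sup>2" by blast
    qed
    then have "(\<lambda>x. f n x - u x) \<in> \<F>" "total (\<lambda>x. f n x - u x) \<le> e\<^sup>2"
      using domI[of "\<lambda>x. f n x - u x" "e\<^sup>2"] dom_continuous[OF f[of n]] uc by (auto intro!: continuous_intros)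
    moreover have "(f n x - u x)\<^sup>2 \<le> sup_const * e\<^sup>2" if x: "x \<in> K" for x
    proof (rule LIMSEQ_le_const2)
      show "(\<lambda>m. (f n x - f m x)\<^sup>2) \<longlonglongrightarrow> (f n x - u x)\<^sup>2" by (intro tendsto_intros pt x)
      have "(f n x - f m x)\<^sup>2 \<le> sup_const * e\<^sup>2" if "m \<ge> N" for m
      proof -
        have "(f n x - f m x)\<^sup>2 \<le> sup_const * (?N n m)\<^sup>2" by (rule sup_bound[OF fd x])
        also have "\<dots> \<le> sup_const * e\<^sup>2" using fn[OF that] sup_const_pos by (intro mult_left_mono) auto
        finally show ?thesis .
      qed
      then show "\<exists>N. \<forall>m\<ge>N. (f n x - f m x)\<^sup>2 \<le> sup_const * e\<^sup>2" by blast
    qed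
    ultimately show ?thesis by blast
  qed
  obtain N1 where N1: "\<And>m n. m \<ge> N1 \<Longrightarrow> n \<ge> N1 \<Longrightarrow> ?N m n < 1"
    using cauchy zero_less_one by blast
  have "(\<lambda>x. f N1 x - (f N1 x - u x)) \<in> \<F>"
    by (rule dom_diff[OF f conjunct1[OF close[OF N1 order_refl]]])
  then have ud: "u \<in> \<F>" by simp
  define Q where "Q = 1 + sup_const * measure \<nu> K"
  have Q: "Q > 0" unfolding Q_def using sup_const_pos mass_pos by (simp add: add_pos_pos)
  let ?L = "\<lambda>n. form_norm \<nu> form (\<lambda>x. f n x - u x)"
  have "?L \<longlonglongrightarrow> 0"
  proof (rule LIMSEQ_I)
    fix e :: real assume e: "e > 0"
    define d where "d = e / sqrt (2 * Q)"
    have d: "d > 0" "Q * d\<^sup>2 = e\<^sup>2 / 2" unfolding d_def using e Q by (auto simp: power_divide)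
    obtain N where N: "\<And>m n. m \<ge> N \<Longrightarrow> n \<ge> N \<Longrightarrow> ?N m n < d"
      using cauchy d(1) by blast
    have "norm (?L n - 0) < e" if n: "n \<ge> N" for n
    proof -
      have c: "(\<lambda>x. f n x - u x) \<in> \<F>" "total (\<lambda>x. f n x - u x) \<le> d\<^sup>2"
        "\<And>x. x \<in> K \<Longrightarrow> (f n x - u x)\<^sup>2 \<le> sup_const * d\<^sup>2"
        using close[OF N n] by blast+
      have "(?L n)\<^sup>2 \<le> d\<^sup>2 + sup_const * d\<^sup>2 * measure \<nu> K"
        unfolding form_norm_square[OF c(1)]
        by (rule add_mono[OF c(2) L2_norm_bound[OF dom_continuous[OF c(1)] c(3)]])
      also have "\<dots> = Q * d\<^sup>2" unfolding Q_def by (simp add: algebra_simps)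
      also have "\<dots> < e\<^sup>2" unfolding d(2) using e by simp
      finally have "?L n < e"
        using e by (rule power2_less_imp_less[OF _ less_imp_le])
      then show ?thesis using form_norm_nonneg[OF c(1)] by simp
    qed
    then show "\<exists>N. \<forall>n\<ge>N. norm (?L n - 0) < e" by blast
  qed
  with ud show ?thesis by blast
qed

lemma form_dense:
  assumes approx: "\<And>f e. f \<in> square_integrable \<nu> \<Longrightarrow> e > 0 \<Longrightarrow>
      \<exists>g. continuous_on K g \<and> L2_norm \<nu> (\<lambda>x. f x - g x) < e"
    and f: "f \<in> square_integrable \<nu>" and e: "e > 0"
  shows "\<exists>u\<in>\<F>. L2_norm \<nu> (\<lambda>x. f x - u x) < e"
proof -
  obtain g where g: "continuous_on K g" "L2_norm \<nu> (\<lambda>x. f x - g x) < e / 2"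
    using approx[OF f, of "e / 2"] e by auto
  define d where "d = e / (2 * sqrt (measure \<nu> K))"
  have d: "d > 0" "d\<^sup>2 * measure \<nu> K = e\<^sup>2 / 4"
    unfolding d_def using e mass_pos by (auto simp: power_divide power_mult_distrib)
  obtain u where u: "u \<in> \<F>" "\<And>x. x \<in> K \<Longrightarrow> \<bar>g x - u x\<bar> < d"
    using dom_uniformly_dense[OF g(1) d(1)] by blast
  have uc: "continuous_on K u" by (rule dom_continuous[OF u(1)])
  have gu: "continuous_on K (\<lambda>x. g x - u x)" by (intro continuous_intros g uc)
  have "(g x - u x)\<^sup>2 \<le> d\<^sup>2" if "x \<in> K" for x
    using power_mono[OF less_imp_le[OF u(2)[OF that]], of 2] by simp
  then have 1: "(L2_norm \<nu> (\<lambda>x. g x - u x))\<^sup>2 \<le> e\<^sup>2 / 4"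
    using L2_norm_bound[OF gu] d(2) by metis
  have fm: "f \<in> borel_measurable \<nu>" and fi: "integrable \<nu> (\<lambda>x. (f x)\<^sup>2)"
    using f unfolding square_integrable_def by auto
  have gm: "g \<in> borel_measurable \<nu>" "u \<in> borel_measurable \<nu>"
    using radon_continuous_measurable[OF \<nu>] g uc by auto
  have sub: "integrable \<nu> (\<lambda>x. (f x - h x)\<^sup>2)" if h: "continuous_on K h" for h
  proof (rule Bochner_Integration.integrable_bound)
    show "integrable \<nu> (\<lambda>x. 2 * (f x)\<^sup>2 + 2 * (h x)\<^sup>2)"
      using fi continuous_square_integrable(2)[OF h] by auto
    show "(\<lambda>x. (f x - h x)\<^sup>2) \<in> borel_measurable \<nu>"
      using fm radon_continuous_measurable[OF \<nu> h] by measurable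
    show "AE x in \<nu>. norm ((f x - h x)\<^sup>2) \<le> norm (2 * (f x)\<^sup>2 + 2 * (h x)\<^sup>2)"
    proof (rule AE_I2)
      fix x show "norm ((f x - h x)\<^sup>2) \<le> norm (2 * (f x)\<^sup>2 + 2 * (h x)\<^sup>2)"
        using square_sum_le[of "f x" "- h x"] by simp
    qed
  qed
  have "(LINT x|\<nu>. (f x - u x)\<^sup>2) \<le> (LINT x|\<nu>. 2 * (f x - g x)\<^sup>2 + 2 * (g x - u x)\<^sup>2)"
  proof (rule integral_mono)
    show "integrable \<nu> (\<lambda>x. (f x - u x)\<^sup>2)" by (rule sub[OF uc])
    show "integrable \<nu> (\<lambda>x. 2 * (f x - g x)\<^sup>2 + 2 * (g x - u x)\<^sup>2)"
      using sub[OF g(1)] continuous_square_integrable(2)[OF gu] by auto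
    show "(f x - u x)\<^sup>2 \<le> 2 * (f x - g x)\<^sup>2 + 2 * (g x - u x)\<^sup>2" for x
      using square_sum_le[of "f x - g x" "g x - u x"] by simp
  qed
  also have "\<dots> = 2 * (L2_norm \<nu> (\<lambda>x. f x - g x))\<^sup>2 + 2 * (L2_norm \<nu> (\<lambda>x. g x - u x))\<^sup>2"
    unfolding L2_norm_square using sub[OF g(1)] continuous_square_integrable(2)[OF gu] by simp
  also have "\<dots> < e\<^sup>2"
  proof -
    have "(L2_norm \<nu> (\<lambda>x. f x - g x))\<^sup>2 < (e / 2)\<^sup>2"
      by (rule power_strict_mono[OF g(2) L2_norm_nonneg]) simp
    then show ?thesis using 1 by (simp add: power_divide)
  qed
  finally have "(L2_norm \<nu> (\<lambda>x. f x - u x))\<^sup>2 < e\<^sup>2" unfolding L2_norm_square .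
  then have "L2_norm \<nu> (\<lambda>x. f x - u x) < e" using e by (rule power2_less_imp_less[OF _ less_imp_le])
  then show ?thesis using u(1) by blast
qed

lemma form_markov:
  assumes u: "u \<in> \<F>"
  shows "(\<lambda>x. min 1 (max 0 (u x))) \<in> \<F>" "total (\<lambda>x. min 1 (max 0 (u x))) \<le> total u"
proof -
  have c: "continuous_on K (\<lambda>x. min 1 (max 0 (u x)))" by (intro continuous_intros dom_continuous[OF u])
  have "E n (\<lambda>x. min 1 (max 0 (u x))) \<le> total u" for n
  proof -
    have "E n (\<lambda>x. min 1 (max 0 (u x))) \<le> 1 * E n u + 0 * E n u"
    proof (rule net_energy_mono[OF sys])
      fix x y
      have "\<bar>min 1 (max 0 (u x)) - min 1 (max 0 (u y))\<bar> \<le> \<bar>u x - u y\<bar>" by linarith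
      then show "(min 1 (max 0 (u x)) - min 1 (max 0 (u y)))\<^sup>2 \<le> 1 * (u x - u y)\<^sup>2 + 0 * (u x - u y)\<^sup>2"
        by (simp add: abs_le_square_iff)
    qed
    then show ?thesis using E_le_total[OF u, of n] by simp
  qed
  then show "(\<lambda>x. min 1 (max 0 (u x))) \<in> \<F>" "total (\<lambda>x. min 1 (max 0 (u x))) \<le> total u"
    using domI[OF c] by auto
qed

text \<open>Supports at distance \<open>d\<close> cannot both meet a cell of diameter less than \<open>d\<close>, so on fine levels the
  bilinear form vanishes cell by cell.\<close>

lemma form_local:
  assumes u: "u \<in> \<F>" and v: "v \<in> \<F>"
    and c: "compact (AE_support \<nu> u)" "compact (AE_support \<nu> v)" and disj: "AE_support \<nu> u \<inter> AE_support \<nu> v = {}"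
  shows "form u v = 0"
proof -
  obtain d where d: "d > 0" "\<And>x y. x \<in> AE_support \<nu> u \<Longrightarrow> y \<in> AE_support \<nu> v \<Longrightarrow> d \<le> dist x y"
    using separate_compact_closed[OF c(1) compact_imp_closed[OF c(2)] disj] by blast
  have far: "u x = 0 \<or> v y = 0" if "x \<in> K" "y \<in> K" "dist x y < d" for x y
    using AE_support_continuous[OF \<nu> dom_continuous[OF u] that(1)]
      AE_support_continuous[OF \<nu> dom_continuous[OF v] that(2)] d(2)[of x y] that(3) by linarith
  obtain n0 where n0: "2 / 9 ^ n0 < d" using power_scale_small[OF d(1)] by blast
  have zero: "E_bilinear n u v = 0" if n: "n \<ge> n0" for n
    unfolding E_bilinear_def
  proof (rule sum.neutral, rule ballI)
    fix w assume w: "w \<in> words I n"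
    then have len: "length w = n" by (simp add: words_def)
    have "2 / 9 ^ n \<le> (2 / 9 ^ n0 :: real)"
      using n by (intro divide_left_mono power_increasing) auto
    then have small: "dist (word_map w p) (word_map w q) < d" if "p \<in> corners" "q \<in> corners" for p q
      using cell_diameter(3)[of p q w] that corners_subset_square n0 unfolding len by fastforce
    have "u (word_map w p) = 0 \<or> v (word_map w q) = 0" if "p \<in> corners" "q \<in> corners" for p q
      using that by (intro far small vertices_K[OF cell_corner_vertex[OF w]])
    then have "(\<forall>p\<in>corners. u (word_map w p) = 0) \<or> (\<forall>q\<in>corners. v (word_map w q) = 0)" by blast
    then show "star_bilinear (r w) (s w) (u \<circ> word_map w) (v \<circ> word_map w) = 0"
      by (elim disjE) (simp_all add: star_bilinear_def Let_def corners_def)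
  qed
  have "\<forall>\<^sub>F n in sequentially. E_bilinear n u v = 0"
    using eventually_ge_at_top[of n0] by eventually_elim (rule zero)
  then have "(\<lambda>n. E_bilinear n u v) \<longlonglongrightarrow> 0" by (rule tendsto_eventually)
  then show ?thesis using E_bilinear_tendsto[OF u v] LIMSEQ_unique by blast
qed

end

text \<open>All functions in \<open>\<F>\<close> are continuous and the measure has full support, so equality almost everywhere
  is equality on \<open>K\<close>.\<close>

theorem local_regular_dirichlet_form: "local_regular_dirichlet_form_on K form \<F>"
proof -
  obtain \<nu> where \<nu>: "radon_full_support K \<nu>" and approx: "\<And>f e. f \<in> square_integrable \<nu> \<Longrightarrow> e > 0 \<Longrightarrow>
      \<exists>g. continuous_on K g \<and> L2_norm \<nu> (\<lambda>x. f x - g x) < e"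
    by (rule exists_full_support_measure[OF compact_imp_closed[OF K_compact] K_nonempty]) (rule that)
  have "dirichlet_form \<nu> form \<F>"
  proof
    show "\<F> \<subseteq> square_integrable \<nu>"
      using continuous_square_integrable(1)[OF \<nu> dom_continuous] by blast
    show "(\<lambda>x. 0) \<in> \<F>" by (rule dom_const)
    show "(\<lambda>x. a * u x + b * v x) \<in> \<F>" if "u \<in> \<F>" "v \<in> \<F>" for a b u v
      by (rule dom_lincomb[OF that])
    show "form u w = form v w" if "u \<in> \<F>" "v \<in> \<F>" "w \<in> \<F>" "AE x in \<nu>. u x = v x" for u v w
    proof -
      have "u x = v x" if "x \<in> K" for x
        by (rule AE_eq_continuous[OF \<nu>]) (use \<open>u \<in> \<F>\<close> \<open>v \<in> \<F>\<close> \<open>AE x in \<nu>. u x = v x\<close> that dom_continuous in auto)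
      then show ?thesis
        unfolding energy_form_def
        using total_cong[of "\<lambda>x. u x + w x" "\<lambda>x. v x + w x"] total_cong[of "\<lambda>x. u x - w x" "\<lambda>x. v x - w x"] by simp
    qed
    show "form u v = form v u" if "u \<in> \<F>" "v \<in> \<F>" for u v by (rule form_commute[OF that])
    show "form (\<lambda>x. a * u x + b * v x) w = a * form u w + b * form v w"
      if "u \<in> \<F>" "v \<in> \<F>" "w \<in> \<F>" for a b u v w by (rule form_linear[OF that])
    show "form u u \<ge> 0" if "u \<in> \<F>" for u using total_nonneg[OF that] by (simp add: form_diag[OF that])
    show "\<exists>u\<in>\<F>. L2_norm \<nu> (\<lambda>x. f x - u x) < e" if "f \<in> square_integrable \<nu>" "e > 0" for f e
      by (rule form_dense[OF \<nu> approx that])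
    show "\<exists>u\<in>\<F>. (\<lambda>n. form_norm \<nu> form (\<lambda>x. f n x - u x)) \<longlonglongrightarrow> 0"
      if "\<And>n. f n \<in> \<F>" "\<forall>e>0. \<exists>N. \<forall>m\<ge>N. \<forall>n\<ge>N. form_norm \<nu> form (\<lambda>x. f m x - f n x) < e" for f
      by (rule form_complete[OF \<nu> that])
    show "\<exists>v\<in>\<F>. (AE x in \<nu>. v x = min 1 (max 0 (u x))) \<and> form v v \<le> form u u" if "u \<in> \<F>" for u
      using form_markov[OF \<nu> that] form_diag that by (intro bexI[of _ "\<lambda>x. min 1 (max 0 (u x))"]) auto
  qed
  moreover have "regular_form \<nu> form \<F>"
    unfolding regular_form_def radon_space[OF \<nu>]
  proof (intro conjI allI impI ballI)
    fix f :: "point \<Rightarrow> real" and e :: real assume "continuous_on K f \<and> e > 0"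
    then obtain g where "g \<in> \<F>" "\<And>x. x \<in> K \<Longrightarrow> \<bar>f x - g x\<bar> < e" using dom_uniformly_dense by blast
    then show "\<exists>u\<in>\<F>. continuous_on K u \<and> (\<forall>x\<in>K. \<bar>f x - u x\<bar> < e)" using dom_continuous by blast
  next
    fix f :: "point \<Rightarrow> real" and e :: real assume f: "f \<in> \<F>" and e: "e > 0"
    have "total (\<lambda>x. 0) \<le> 0" by (rule domI(2)) (auto simp: E_const)
    then have "form_norm \<nu> form (\<lambda>x. f x - f x) < e"
      using total_nonneg[OF dom_const[of 0]] e form_diag[OF dom_const[of 0]]
      by (simp add: form_norm_def L2_norm_def)
    then show "\<exists>u\<in>\<F>. continuous_on K u \<and> form_norm \<nu> form (\<lambda>x. f x - u x) < e"
      using f dom_continuous by blast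
  qed
  moreover have "local_form \<nu> form \<F>"
    unfolding local_form_def using form_local[OF \<nu>] by blast
  ultimately show ?thesis unfolding local_regular_dirichlet_form_on_def using \<nu> by blast
qed

end

section \<open>Self-similarity\<close>

lemma cell_energy_scale:
  assumes "c > 0" shows "cell_energy (c * r) (c * s) u = inverse c * cell_energy r s u"
proof -
  have 1: "2 * (c * r + c * s) = c * (2 * (r + s))" by (simp add: algebra_simps)
  have 2: "c * s / (c * r) = s / r" "c * r / (c * s) = r / s" using assms by auto
  have 3: "N / (c * k) = inverse c * (N / k)" for N k :: real by (simp add: divide_inverse)
  show ?thesis unfolding cell_energy_def star_energy_def 2 unfolding 1 3 by (rule refl)
qed

lemma cell_energy_axes:
  assumes "r > 0" "s > 0"
  shows "cell_energy r s (\<lambda>x. fst x + snd x) = 2 / r" "cell_energy r s (\<lambda>x. fst x - snd x) = 2 / s"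
proof -
  have k: "2 * (r + s) \<noteq> 0" using assms by simp
  have e: "4 * s / r + 4 = 2 / r * (2 * (r + s))" "4 * r / s + 4 = 2 / s * (2 * (r + s))"
    using assms by (simp_all add: field_simps)
  have "(4 * s / r + 4) / (2 * (r + s)) = 2 / r" "(4 * r / s + 4) / (2 * (r + s)) = 2 / s"
    unfolding e by (rule nonzero_mult_div_cancel_right[OF k])+
  then show "cell_energy r s (\<lambda>x. fst x + snd x) = 2 / r" "cell_energy r s (\<lambda>x. fst x - snd x) = 2 / s"
    unfolding cell_energy_def star_energy_def by (simp_all add: mult.commute add.commute)
qed

lemma cell_energy_antimono:
  assumes "r > 0" "s > 0" "r' > 0" "s' > 0" "c > 0" "r \<le> c * r'" "s \<le> c * s'"
  shows "cell_energy r' s' u \<le> c * cell_energy r s u"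
proof -
  obtain m where m: "cell_energy r s u = ((u (-1/2, -1/2) - m)\<^sup>2 + (u (1/2, 1/2) - m)\<^sup>2) / r
      + ((u (1/2, -1/2) - m)\<^sup>2 + (u (-1/2, 1/2) - m)\<^sup>2) / s"
    using star_energy_center[OF assms(1,2), of "u (-1/2, -1/2)" "u (1/2, -1/2)" "u (1/2, 1/2)" "u (-1/2, 1/2)"]
    unfolding cell_energy_def by blast
  have k: "a / x' \<le> c * (a / x)" if "a \<ge> 0" "x > 0" "x' > 0" "x \<le> c * x'" for a x x'
    using mult_left_mono[OF that(4,1)] that by (simp add: field_simps)
  have "cell_energy r' s' u \<le> ((u (-1/2, -1/2) - m)\<^sup>2 + (u (1/2, 1/2) - m)\<^sup>2) / r'
      + ((u (1/2, -1/2) - m)\<^sup>2 + (u (-1/2, 1/2) - m)\<^sup>2) / s'"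
    unfolding cell_energy_def by (rule star_energy_le[OF assms(3,4)])
  also have "\<dots> \<le> c * (((u (-1/2, -1/2) - m)\<^sup>2 + (u (1/2, 1/2) - m)\<^sup>2) / r)
      + c * (((u (1/2, -1/2) - m)\<^sup>2 + (u (-1/2, 1/2) - m)\<^sup>2) / s)"
    by (intro add_mono k) (use assms in auto)
  finally show ?thesis unfolding m by (simp add: distrib_left)
qed

lemma arm_resistance_less: "r > 0 \<Longrightarrow> s > 0 \<Longrightarrow> arm_resistance r s < 8 * s"
  and arm_resistance_ge: "r > 0 \<Longrightarrow> s > 0 \<Longrightarrow> arm_resistance r s \<ge> 7 * s"
proof -
  assume a: "r > 0" "s > 0"
  have "s\<^sup>2 / (r + s) \<le> s" using a by (simp add: divide_simps power2_eq_square algebra_simps)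
  moreover have "s\<^sup>2 / (r + s) > 0" using a by simp
  ultimately show "arm_resistance r s < 8 * s" "arm_resistance r s \<ge> 7 * s"
    unfolding arm_resistance_def by linarith+
qed

context eyebolted_form
begin

text \<open>The primal energy of level zero is symmetric in the two diagonals, the star is not unless \<open>r = s\<close>.\<close>

lemma non_primal_network:
  assumes "r [] \<noteq> s []" shows "non_primal I conduct"
  unfolding non_primal_def
proof
  assume "\<forall>n. \<exists>k. \<forall>u. energy I conduct n u = k * primal_energy I n u"
  then obtain k where k: "\<And>u. energy I conduct 0 u = k * primal_energy I 0 u" by blast
  have p: "primal_energy I 0 (\<lambda>x. fst x + snd x) = 8" "primal_energy I 0 (\<lambda>x. fst x - snd x) = 8"
    unfolding primal_energy_def energy_def by (simp_all add: cell_vertices_def corners_def)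
  have rs: "r [] > 0" "s [] > 0" using leg_systemD[OF sys] by auto
  have "2 / r [] = k * 8" "2 / s [] = k * 8"
    using k[of "\<lambda>x. fst x + snd x"] k[of "\<lambda>x. fst x - snd x"]
    unfolding p energy_net net_energy_0 cell_energy_axes[OF rs] by auto
  then have "2 / r [] = 2 / s []" by simp
  then show False using assms rs by simp
qed

lemma E_Suc: "E (Suc n) u = (\<Sum>i\<in>I. net_energy I (\<lambda>w. r (i # w)) (\<lambda>w. s (i # w)) n (u \<circ> contraction i))"
  using net_energy_add[of I r s "Suc 0" n u] unfolding sum_words_Suc by simp

lemma self_similar_network:
  assumes \<tau>: "\<And>i. i \<in> I \<Longrightarrow> 0 < \<tau> i \<and> \<tau> i < 1"
    and rs: "\<And>i w. r (i # w) = \<tau> i * r w" "\<And>i w. s (i # w) = \<tau> i * s w"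
  shows "self_similar_identity I K conduct"
  unfolding self_similar_identity_def
proof (intro exI[of _ \<tau>] conjI ballI)
  fix i assume "i \<in> I" then show "0 < \<tau> i" "\<tau> i < 1" using \<tau> by auto
next
  fix u assume u: "u \<in> \<F>"
  have sc: "net_energy I (\<lambda>w. r (i # w)) (\<lambda>w. s (i # w)) n v = inverse (\<tau> i) * E n v" if "i \<in> I" for i n v
    unfolding net_energy_def rs sum_distrib_left
    by (intro sum.cong refl cell_energy_scale) (use \<tau> that in auto)
  have step: "E (Suc n) u = (\<Sum>i\<in>I. inverse (\<tau> i) * E n (u \<circ> contraction i))" for n
    unfolding E_Suc by (intro sum.cong refl sc)
  have di: "u \<circ> contraction i \<in> \<F>" if i: "i \<in> I" for i
  proof (rule domI(1))
    show "continuous_on K (u \<circ> contraction i)"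
      by (intro continuous_on_compose continuous_contraction continuous_on_subset[OF dom_continuous[OF u]])
        (use contraction_in_K[OF i] in auto)
    fix n
    have "inverse (\<tau> i) * E n (u \<circ> contraction i) \<le> E (Suc n) u"
      unfolding step using i \<tau> net_energy_nonneg[OF sys]
      by (intro member_le_sum[of i I "\<lambda>i. inverse (\<tau> i) * E n (u \<circ> contraction i)"]) (auto simp: less_imp_le)
    also have "\<dots> \<le> total u" by (rule E_le_total[OF u])
    finally show "E n (u \<circ> contraction i) \<le> \<tau> i * total u"
      using \<tau>[OF i] by (simp add: field_simps)
  qed
  have "(\<lambda>n. \<Sum>i\<in>I. inverse (\<tau> i) * E n (u \<circ> contraction i)) \<longlonglongrightarrow> (\<Sum>i\<in>I. inverse (\<tau> i) * total (u \<circ> contraction i))"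
    by (intro tendsto_intros E_tendsto_total di)
  then have "(\<lambda>n. E (Suc n) u) \<longlonglongrightarrow> (\<Sum>i\<in>I. inverse (\<tau> i) * total (u \<circ> contraction i))"
    unfolding step .
  then have "total u = (\<Sum>i\<in>I. inverse (\<tau> i) * total (u \<circ> contraction i))"
    using LIMSEQ_Suc[OF E_tendsto_total[OF u]] LIMSEQ_unique by blast
  then have "lim_energy u = ereal (\<Sum>i\<in>I. inverse (\<tau> i) * total (u \<circ> contraction i))"
    using dom_limit[OF u] by simp
  also have "\<dots> = (\<Sum>i\<in>I. ereal (inverse (\<tau> i) * total (u \<circ> contraction i)))"
    by (rule sum_ereal[symmetric])
  also have "\<dots> = (\<Sum>i\<in>I. ereal (inverse (\<tau> i)) * lim_energy (u \<circ> contraction i))"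
    by (intro sum.cong refl) (simp add: dom_limit[OF di])
  finally show "lim_energy u = (\<Sum>i\<in>I. ereal (inverse (\<tau> i)) * lim_energy (u \<circ> contraction i))" .
qed

lemma reverse_recursive_network:
  assumes "\<And>v w. length v = length w \<Longrightarrow> r v = r w \<and> s v = s w"
  shows "reverse_recursive I conduct"
  unfolding reverse_recursive_def
proof (intro exI[of _ "\<lambda>n. star_conductance (r (replicate n (0,0))) (s (replicate n (0,0)))"] allI ballI impI)
  fix n w p q assume "w \<in> words I n"
  then have "r w = r (replicate n (0,0)) \<and> s w = s (replicate n (0,0))"
    by (intro assms) (simp add: words_def)
  then show "conduct w (word_map w p) (word_map w q)
    = star_conductance (r (replicate n (0,0))) (s (replicate n (0,0))) p q"
    by (simp add: network_conductance_def)
qed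

text \<open>Suppose that the identity holds. Tested on functions that are constant outside the corner cell
  \<open>(4,4)\<close>, it shows that the form \<open>sh\<close> with the legs of the next level is \<open>t\<close> times the given one, where \<open>t\<close> is
  the inverse of the ratio of that cell (\<open>key\<close>). The function that is harmonic for the
  given form with boundary values \<open>fst x + snd x\<close> yields \<open>9 \<le> t\<close>, because legs on the main diagonal
  are divided by nine. The one that is harmonic for \<open>sh\<close> with boundary values \<open>fst x - snd x\<close> yields
  \<open>t < 9\<close>, because the eyebolts make the other legs shrink by a factor less than nine.\<close>

lemma not_self_similar_network:
  assumes hom: "\<And>v w. length v = length w \<Longrightarrow> r v = r w \<and> s v = s w"
  shows "\<not> self_similar_identity I K conduct"
proof
  assume "self_similar_identity I K conduct"
  then obtain \<tau> where \<tau>: "\<And>i. i \<in> I \<Longrightarrow> 0 < \<tau> i"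
    and ss: "\<And>u. u \<in> \<F> \<Longrightarrow> lim_energy u
      = (\<Sum>i\<in>I. ereal (inverse (\<tau> i)) * lim_energy (u \<circ> contraction i))"
    unfolding self_similar_identity_def by blast
  define t where "t = inverse (\<tau> (4,4))"
  have t: "t > 0" unfolding t_def using \<tau>[OF corner_cells(3)] by simp
  have p1: "(-1/2, -1/2) \<in> corners" by (simp add: corners_def)
  let ?r = "\<lambda>w. r ((4,4) # w)" and ?s = "\<lambda>w. s ((4,4) # w)"
  interpret sh: eyebolted_form L U K ?r ?s "M / 8"
  proof
    show "leg_system ?r ?s (M / 8)" using leg_system_shift[OF sys, of "[(4,4)]"] by simp
  qed
  have down: "r w = 9 * ?r w \<and> s w < 9 * ?s w" for w
  proof -
    obtain \<rho> \<sigma> \<rho>' \<sigma>' where *: "\<rho> > 0" "\<sigma> > 0" "\<rho>' > 0" "\<sigma>' > 0"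
      "\<And>i. r (w @ [i]) = (if fst i = snd i then \<rho> else \<rho>')"
      "\<And>i. s (w @ [i]) = (if fst i = snd i then \<sigma> else \<sigma>')"
      "r w = 9 * \<rho>" "s w = \<sigma> + arm_resistance \<rho>' \<sigma>'"
      using leg_system_step[OF sys, of w] by blast
    have "s (w @ [(0,0)]) = s (w @ [(1,0)])" using hom[of "w @ [(0,0)]" "w @ [(1,0)]"] by simp
    then have "\<sigma> = \<sigma>'" unfolding *(6) by simp
    moreover have "?r w = \<rho>" "?s w = \<sigma>"
      using hom[of "(4,4) # w" "w @ [(0,0)]"] unfolding *(5,6) by simp_all
    ultimately show ?thesis using *(7,8) arm_resistance_less[OF *(3,4)] by simp
  qed
  \<comment> \<open>The corner cell \<open>(4,4)\<close> touches the rest of the cross only in its lower left corner, so a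
    function on it can be continued by a constant without further energy; the identity for the
    continued function compares the forms of two consecutive levels.\<close>
  have key: "v \<in> \<F> \<and> sh.total v = t * total v" if v: "v \<in> sh.\<F>" for v
  proof -
    \<comment> \<open>the inverse of the contraction of the corner cell; the line \<open>fst x + snd x = 7/9\<close> separates this
      cell from the others and meets the cross only in the common corner\<close>
    define G :: "point \<Rightarrow> point" where "G x = 9 *\<^sub>R x - (4, 4)" for x
    define k where "k = v (-1/2, -1/2)"
    define u where "u x = (if fst x + snd x \<le> 7/9 then k else v (G x))" for x
    have GF: "G (contraction (4,4) x) = x" for x
      unfolding G_def contraction_def by (simp add: prod_eq_iff)
    have vertex: "x = (-1/2, -1/2)" if "x \<in> square" "fst (contraction (4,4) x) + snd (contraction (4,4) x) \<le> 7/9" for x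
    proof -
      have "fst x + snd x \<le> -1" using that(2) by (simp add: contraction_def)
      moreover have "fst x \<ge> -1/2" "snd x \<ge> -1/2" using that(1) by (auto simp: square_def)
      ultimately have "fst x = -1/2" "snd x = -1/2" by linarith+
      then show ?thesis by (simp add: prod_eq_iff)
    qed
    have other: "fst (contraction j x) + snd (contraction j x) \<le> 7/9
        \<and> (fst (contraction j x) + snd (contraction j x) = 7/9 \<longrightarrow> contraction j x = (7/18, 7/18))"
      if j: "j \<in> I" "j \<noteq> (4,4)" and x: "x \<in> square" for j x
    proof -
      have x': "fst x \<le> 1/2" "snd x \<le> 1/2" using x by (auto simp: square_def)
      have "j = (3,3) \<or> fst j + snd j \<le> 5"
        using j L_cases U_cases
        unfolding cells_eq diagonal_cells_def lower_right_cells_def upper_left_cells_def by auto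
      then show ?thesis
      proof
        assume "j = (3,3)"
        then show ?thesis using x' by (auto simp: contraction_def prod_eq_iff)
      next
        assume "fst j + snd j \<le> 5"
        then have "real_of_int (fst j) + real_of_int (snd j) \<le> 5" by linarith
        then show ?thesis using x' by (simp add: contraction_def)
      qed
    qed
    have uF: "u (contraction (4,4) x) = v x" if "x \<in> square" for x
      using vertex[OF that] by (auto simp: u_def GF k_def)
    have uj: "u (contraction j x) = k" if "j \<in> I" "j \<noteq> (4,4)" "x \<in> square" for j x
      using other[OF that] by (simp add: u_def)
    have GK: "G x \<in> K" "fst x + snd x = 7/9 \<Longrightarrow> v (G x) = k"
      if x: "x \<in> K" "7/9 \<le> fst x + snd x" for x
    proof -
      obtain j y where j: "j \<in> I" "y \<in> K" "x = contraction j y" using x(1) K_eq by blast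
      have y: "y \<in> square" using j(2) K_subset_square by blast
      have "G x \<in> K \<and> (fst x + snd x = 7/9 \<longrightarrow> v (G x) = k)"
      proof (cases "j = (4,4)")
        case True
        then show ?thesis using j(2,3) GF vertex[OF y] k_def by auto
      next
        case False
        then have "x = (7/18, 7/18)" using other[OF j(1) False y] x(2) j(3) by auto
        then have "G x = (-1/2, -1/2)" by (simp add: G_def)
        then show ?thesis using p1 corners_in_K k_def by auto
      qed
      then show "G x \<in> K" "fst x + snd x = 7/9 \<Longrightarrow> v (G x) = k" by auto
    qed
    have uc: "continuous_on K u"
      unfolding u_def
    proof (rule continuous_on_cases_le)
      have "continuous_on {x \<in> K. 7/9 \<le> fst x + snd x} G"
        unfolding G_def by (intro continuous_intros)
      then show "continuous_on {x \<in> K. 7/9 \<le> fst x + snd x} (\<lambda>x. v (G x))"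
        by (rule continuous_on_compose2[OF sh.dom_continuous[OF v]]) (use GK in auto)
    qed (use GK in \<open>auto intro!: continuous_intros\<close>)
    have Eu: "E (Suc n) u = sh.E n v" for n
    proof -
      have z: "net_energy I (\<lambda>w. r (j # w)) (\<lambda>w. s (j # w)) n (u \<circ> contraction j) = 0"
        if "j \<in> I - {(4,4)}" for j
      proof -
        have "net_energy I (\<lambda>w. r (j # w)) (\<lambda>w. s (j # w)) n (u \<circ> contraction j)
          = net_energy I (\<lambda>w. r (j # w)) (\<lambda>w. s (j # w)) n (\<lambda>x. k)"
          by (rule net_energy_cong) (use that in \<open>simp add: uj subsetD[OF vertices_subset_square]\<close>)
        then show ?thesis unfolding net_energy_def by (simp add: cell_energy_const)
      qed
      have "E (Suc n) u = net_energy I ?r ?s n (u \<circ> contraction (4,4))"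
        unfolding E_Suc sum.remove[OF finite_cells corner_cells(3)] by (simp add: z sum.neutral)
      also have "\<dots> = sh.E n v"
        by (rule net_energy_cong) (simp add: uF subsetD[OF vertices_subset_square])
      finally show ?thesis .
    qed
    have "E n u \<le> sh.total v" for n
      using net_energy_Suc[OF sys, of n u] Eu[of n] sh.E_le_total[OF v, of n] by simp
    then have ud: "u \<in> \<F>" using domI(1)[OF uc] by blast
    have tot: "total u = sh.total v"
      using LIMSEQ_Suc[OF E_tendsto_total[OF ud]] sh.E_tendsto_total[OF v] LIMSEQ_unique unfolding Eu by blast
    have lz: "lim_energy (u \<circ> contraction j) = 0" if "j \<in> I - {(4,4)}" for j
    proof -
      have "lim_energy (u \<circ> contraction j) = lim_energy (\<lambda>x. k)"
        by (rule total_cong) (use that in \<open>simp add: uj subsetD[OF K_subset_square]\<close>)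
      also have "\<dots> = 0"
        unfolding limit_energy_def energy_net E_const by (simp add: zero_ereal_def[symmetric])
      finally show ?thesis .
    qed
    have lv: "lim_energy (u \<circ> contraction (4,4)) = lim_energy v"
      by (rule total_cong) (simp add: uF subsetD[OF K_subset_square])
    have "ereal (sh.total v) = ereal t * lim_energy v"
      using ss[OF ud] unfolding dom_limit[OF ud] tot sum.remove[OF finite_cells corner_cells(3)] lv t_def
      by (simp add: lz sum.neutral)
    moreover from this have "lim_energy v < \<infinity>"
      using t by (cases "lim_energy v") auto
    ultimately show ?thesis
      using sh.dom_continuous[OF v] limit_energy_finite[of v] unfolding energy_domain_def by simp
  qed
  have pos: "r [] > 0" "s [] > 0" "?r [] > 0" "?s [] > 0" using leg_systemD[OF sys] by auto
  obtain v where v: "v \<in> sh.\<F>" "\<And>x. x \<in> vertices I 0 \<Longrightarrow> v x = fst x - snd x"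
    "sh.total v = sh.E 0 (\<lambda>x. fst x - snd x)"
    by (rule sh.harmonic_extension_dom[of 0 "\<lambda>x. fst x - snd x"]) (rule that)
  have "E 0 v = E 0 (\<lambda>x. fst x - snd x)" by (rule net_energy_cong) (rule v(2))
  then have "2 / s [] \<le> total v" using E_le_total[of v 0] key[OF v(1)] cell_energy_axes(2)[OF pos(1,2)] by simp
  then have "t * (2 / s []) \<le> 2 / ?s []"
    using key[OF v(1)] v(3) cell_energy_axes(2)[OF pos(3,4)] mult_left_mono[of "2 / s []" "total v" t] t by simp
  then have 1: "t * ?s [] \<le> s []" using pos by (simp add: field_simps)
  obtain v where v: "v \<in> \<F>" "\<And>x. x \<in> vertices I 0 \<Longrightarrow> v x = fst x + snd x"
    "total v = E 0 (\<lambda>x. fst x + snd x)"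
    by (rule harmonic_extension_dom[of 0 "\<lambda>x. fst x + snd x"]) (rule that)
  have vs: "v \<in> sh.\<F>"
  proof (rule sh.domI(1)[OF dom_continuous[OF v(1)]])
    fix n
    have "cell_energy (?r w) (?s w) f \<le> 9 * cell_energy (r w) (s w) f" for w f
      by (rule cell_energy_antimono)
        (use leg_systemD[OF sys, of w] leg_systemD[OF sys, of "(4,4) # w"] down[of w] in linarith)+
    then have "sh.E n v \<le> 9 * E n v"
      unfolding net_energy_def sum_distrib_left by (intro sum_mono)
    then show "sh.E n v \<le> 9 * total v" using E_le_total[OF v(1), of n] by simp
  qed
  have "sh.E 0 v = sh.E 0 (\<lambda>x. fst x + snd x)" by (rule net_energy_cong) (rule v(2))
  then have "2 / ?r [] \<le> sh.total v" using sh.E_le_total[OF vs, of 0] cell_energy_axes(1)[OF pos(3,4)] by simp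
  also have "\<dots> = t * (2 / r [])" using key[OF vs] v(3) cell_energy_axes(1)[OF pos(1,2)] by simp
  finally have "9 \<le> t" using pos down[of "[]"] by (simp add: field_simps)
  then have "9 * ?s [] \<le> t * ?s []" using pos by (intro mult_right_mono) auto
  then show False using 1 down[of "[]"] by simp
qed

end

section \<open>The two systems of legs\<close>

text \<open>With \<open>r = 1\<close>, \<open>s = 2\<close> and ratio \<open>\<tau>\<close> outside of the main diagonal, the second relation reads
  \<open>2 = 2/9 + 16 * \<tau> - 4/3 * \<tau>\<close>, with the solution \<open>\<tau> = 4/33\<close>, which is less than \<open>1/8\<close>.\<close>

definition ratio :: "index \<Rightarrow> real" where
  "ratio i = (if fst i = snd i then 1/9 else 4/33)"

definition ratio_word :: "index list \<Rightarrow> real" where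
  "ratio_word w = prod_list (map ratio w)"

lemma leg_system_ratio: "leg_system ratio_word (\<lambda>w. 2 * ratio_word w) 3"
proof -
  have pos: "ratio_word w > 0" for w
    unfolding ratio_word_def by (induction w) (auto simp: ratio_def)
  have le: "ratio_word w \<le> (1 / 8) ^ length w" for w
  proof (induction w)
    case (Cons i w)
    have "ratio i * ratio_word w \<le> 1 / 8 * (1 / 8) ^ length w"
      using Cons pos[of w] by (intro mult_mono) (auto simp: ratio_def)
    then show ?case by (simp add: ratio_word_def)
  qed (simp add: ratio_word_def)
  have snoc: "ratio_word (w @ [i]) = (if fst i = snd i then ratio_word w / 9 else 4 / 33 * ratio_word w)" for w i
    by (simp add: ratio_word_def ratio_def)
  have arm: "2 * x = 2 * (x / 9) + arm_resistance (4 / 33 * x) (2 * (4 / 33 * x))" if "x > 0" for x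
    using that unfolding arm_resistance_def by (simp add: field_simps power2_eq_square)
  show ?thesis
    unfolding leg_system_def
  proof (intro allI conjI)
    fix w
    show "0 < ratio_word w" "0 < 2 * ratio_word w" using pos[of w] by simp_all
    show "ratio_word w + 2 * ratio_word w \<le> 3 / 8 ^ length w"
      using le[of w] by (simp add: power_divide)
    show "\<exists>\<rho> \<sigma> \<rho>' \<sigma>'. (\<forall>i. ratio_word (w @ [i]) = (if fst i = snd i then \<rho> else \<rho>')) \<and>
        (\<forall>i. 2 * ratio_word (w @ [i]) = (if fst i = snd i then \<sigma> else \<sigma>')) \<and>
        ratio_word w = 9 * \<rho> \<and> 2 * ratio_word w = \<sigma> + arm_resistance \<rho>' \<sigma>'"
      unfolding snoc
      by (intro exI[of _ "ratio_word w / 9"] exI[of _ "2 * (ratio_word w / 9)"]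
          exI[of _ "4 / 33 * ratio_word w"] exI[of _ "2 * (4 / 33 * ratio_word w)"])
        (use arm[OF pos[of w]] in auto)
  qed
qed

text \<open>The equation is equivalent to \<open>8 * x\<^sup>2 + (9 * \<rho> - S) * x = S * \<rho>\<close>, whose positive root is taken.\<close>

lemma reverse_step:
  assumes "\<rho> > 0" "S > 0"
  shows "\<exists>x>0. S = x + arm_resistance \<rho> x"
proof -
  define D where "D = (9 * \<rho> - S)\<^sup>2 + 32 * S * \<rho>"
  define x where "x = ((S - 9 * \<rho>) + sqrt D) / 16"
  have D: "(9 * \<rho> - S)\<^sup>2 < D" unfolding D_def using assms by simp
  then have "\<bar>9 * \<rho> - S\<bar> < sqrt D" using real_less_rsqrt[of "\<bar>9 * \<rho> - S\<bar>" D] by simp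
  then have x: "x > 0" unfolding x_def by simp
  have "16 * x = (S - 9 * \<rho>) + sqrt D" unfolding x_def by simp
  then have "sqrt D = 16 * x - (S - 9 * \<rho>)" by linarith
  then have "D = (16 * x - (S - 9 * \<rho>))\<^sup>2"
    using D by (metis less_eq_real_def order_trans real_sqrt_pow2 zero_le_power2)
  then have "8 * x\<^sup>2 + (9 * \<rho> - S) * x = S * \<rho>"
    unfolding D_def by (simp add: power2_eq_square algebra_simps)
  then have "S = x + arm_resistance \<rho> x"
    unfolding arm_resistance_def using assms x
    by (simp add: field_simps power2_eq_square)
  then show ?thesis using x by blast
qed

fun reverse_leg :: "nat \<Rightarrow> real" where
  "reverse_leg 0 = 2"
| "reverse_leg (Suc n) = (SOME x. x > 0 \<and> reverse_leg n = x + arm_resistance ((1/9) ^ Suc n) x)"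

lemma reverse_leg:
  shows "reverse_leg n > 0"
    and "reverse_leg n = reverse_leg (Suc n) + arm_resistance ((1/9) ^ Suc n) (reverse_leg (Suc n))"
proof -
  have step: "reverse_leg (Suc n) > 0
      \<and> reverse_leg n = reverse_leg (Suc n) + arm_resistance ((1/9) ^ Suc n) (reverse_leg (Suc n))"
    if "reverse_leg n > 0" for n
  proof -
    have "\<exists>x. x > 0 \<and> reverse_leg n = x + arm_resistance ((1/9) ^ Suc n) x"
      using reverse_step[OF _ that, of "(1/9) ^ Suc n"] by auto
    from someI_ex[OF this] show ?thesis unfolding reverse_leg.simps(2)[symmetric] .
  qed
  show pos: "reverse_leg n > 0" for n
    by (induction n) (simp, use step in blast)
  then show "reverse_leg n = reverse_leg (Suc n) + arm_resistance ((1/9) ^ Suc n) (reverse_leg (Suc n))"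
    using step by blast
qed

text \<open>Since \<open>arm_resistance \<rho> x \<ge> 7 * x\<close>, the legs shrink at least by the factor \<open>8\<close> from one level to
  the next.\<close>

lemma leg_system_reverse: "leg_system (\<lambda>w. (1/9) ^ length w) (\<lambda>w. reverse_leg (length w)) 3"
proof -
  have le: "reverse_leg n \<le> 2 * (1/8) ^ n" for n
  proof (induction n)
    case (Suc n)
    have "8 * reverse_leg (Suc n) \<le> reverse_leg n"
      using reverse_leg(2)[of n] arm_resistance_ge[OF _ reverse_leg(1)[of "Suc n"], of "(1/9) ^ Suc n"] by simp
    then show ?case using Suc by simp
  qed simp
  show ?thesis
    unfolding leg_system_def
  proof (intro allI conjI)
    fix w :: "index list"
    show "0 < (1/9 :: real) ^ length w" "0 < reverse_leg (length w)" using reverse_leg(1) by simp_all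
    have "(1/9 :: real) ^ length w \<le> (1/8) ^ length w" by (intro power_mono) auto
    then show "(1/9) ^ length w + reverse_leg (length w) \<le> 3 / 8 ^ length w"
      using le[of "length w"] by (simp add: power_divide)
    show "\<exists>\<rho> \<sigma> \<rho>' \<sigma>'. (\<forall>i. (1/9) ^ length (w @ [i]) = (if fst i = snd i then \<rho> else \<rho>')) \<and>
        (\<forall>i. reverse_leg (length (w @ [i])) = (if fst i = snd i then \<sigma> else \<sigma>')) \<and>
        (1/9) ^ length w = 9 * \<rho> \<and> reverse_leg (length w) = \<sigma> + arm_resistance \<rho>' \<sigma>'"
      using reverse_leg(2)[of "length w"]
      by (intro exI[of _ "(1/9) ^ Suc (length w)"] exI[of _ "reverse_leg (Suc (length w))"]) simp
  qed
qed

theorem theorem6p1: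
  fixes L U :: "index set" and K :: "point set"
  assumes "L \<in> lower_right_eyebolts" and "U \<in> upper_left_eyebolts"
    and "attractor (eyebolted_indices L U) K"
  shows "(\<exists>c. positive_conductance (eyebolted_indices L U) c \<and>
              compatible (eyebolted_indices L U) c \<and>
              non_primal (eyebolted_indices L U) c \<and>
              local_regular_dirichlet_form_on K
                (energy_form (eyebolted_indices L U) c)
                (energy_domain (eyebolted_indices L U) K c) \<and>
              self_similar_identity (eyebolted_indices L U) K c)
       \<and> (\<exists>c. positive_conductance (eyebolted_indices L U) c \<and>
              compatible (eyebolted_indices L U) c \<and>
              non_primal (eyebolted_indices L U) c \<and>
              local_regular_dirichlet_form_on K
                (energy_form (eyebolted_indices L U) c)
                (energy_domain (eyebolted_indices L U) K c) \<and>
              reverse_recursive (eyebolted_indices L U) c \<and>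
              \<not> self_similar_identity (eyebolted_indices L U) K c)"
proof
  let ?I = "eyebolted_indices L U"
  interpret ss: eyebolted_form L U K ratio_word "\<lambda>w. 2 * ratio_word w" 3
    using assms leg_system_ratio by unfold_locales
  have "self_similar_identity ?I K ss.conduct"
    by (rule ss.self_similar_network[of ratio]) (simp_all add: ratio_def ratio_word_def)
  moreover have "non_primal ?I ss.conduct"
    by (rule ss.non_primal_network) (simp add: ratio_word_def)
  ultimately show "\<exists>c. positive_conductance ?I c \<and> compatible ?I c \<and> non_primal ?I c \<and>
      local_regular_dirichlet_form_on K (energy_form ?I c) (energy_domain ?I K c) \<and>
      self_similar_identity ?I K c"
    using positive_network_conductance[OF ss.sys] ss.compatible_network[OF ss.sys]
      ss.local_regular_dirichlet_form by blast
  interpret rr: eyebolted_form L U K "\<lambda>w. (1/9) ^ length w" "\<lambda>w. reverse_leg (length w)" 3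
    using assms leg_system_reverse by unfold_locales
  have "reverse_recursive ?I rr.conduct" "\<not> self_similar_identity ?I K rr.conduct"
    by (rule rr.reverse_recursive_network rr.not_self_similar_network; simp)+
  moreover have "non_primal ?I rr.conduct"
    by (rule rr.non_primal_network) simp
  ultimately show "\<exists>c. positive_conductance ?I c \<and> compatible ?I c \<and> non_primal ?I c \<and>
      local_regular_dirichlet_form_on K (energy_form ?I c) (energy_domain ?I K c) \<and>
      reverse_recursive ?I c \<and> \<not> self_similar_identity ?I K c"
    using positive_network_conductance[OF rr.sys] ss.compatible_network[OF rr.sys]
      rr.local_regular_dirichlet_form by blast
qed

end
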